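(* Let $n \geq 1$, $d \geq 2$, let $u \in \mathbb{R}^n$ be generic and let $f \in \mathbb{R}[x_1,\ldots,x_n]$ be a generic polynomial of degree $d$. Consider the optimization problem $\min_{x \in \mathbb{R}^n} u^T x$ subject to $f(x) = 0$, and its Lagrange system $\mathcal{L}_{u,f}(x,\lambda) = \{\ell_1,\ldots,\ell_n,f\}$, where $\ell_i = u_i - \lambda \frac{\partial f}{\partial x_i}(x)$. Then the system $\mathcal{L}_{u,f}(x,\lambda) = 0$ has exactly $d(d-1)^{n-1}$ complex solutions $(x,\lambda) \in \mathbb{C}^{n+1}$. Moreover, all of these solutions can be found via the homotopy \[ H(x,\lambda;t) = (1-t)\,B(x,\lambda) + t\,\gamma\,\mathcal{L}_{u,f}(x,\lambda), \qquad t \in [0,1], \] where $\gamma \in \mathbb{C}$ is a generic constant and $B(x,\lambda)$ is the start system of $n+1$ polynomials \[ B(x,\lambda) = \left( u_1 - d\,\lambda c_1 x_1^{d-1},\ \ldots,\ u_n - d\,\lambda c_n x_n^{d-1},\ c_0 + c_1 x_1^d \right) \] with $c_0, c_1, \ldots, c_n$ generic constants. That is, the limits as $t \to 1$ of the solution paths of $H(x,\lambda;t)=0$ that start at $t=0$ at the solutions of $B(x,\lambda)=0$ include all complex solutions of $\mathcal{L}_{u,f}(x,\lambda) = 0$.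
   Context: Systems of polynomials are combined componentwise (the $i$-th component of $B$ with $\ell_i$, the last component of $B$ with $f$). "Generic" for $u$, for the coefficients of $f$ and for the $c_i$ means lying outside some proper algebraic subvariety of the corresponding complex parameter space. "Generic" for $\gamma$ means lying in some open dense (Euclidean topology) subset of $\mathbb{C}$, which may depend on the other data. A solution path is a continuous path $t \mapsto (x(t),\lambda(t)) \in \mathbb{C}^{n+1}$, $t \in [0,1)$, with $H(x(t),\lambda(t);t)=0$; such a path is tracked by solving the ODE initial value problem obtained by differentiating $H(x(t),\lambda(t);t)=0$ in $t$, with initial values the solutions of $B=0$. *)

theory Defs
  imports "HOL-Analysis.Analysis" "HOL-Library.Poly_Mapping"
begin

text \<open>
  Polynomials in variables indexed by \<open>'k\<close> with coefficients in \<open>'a\<close> are finitely supported maps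
  from monomials (exponent vectors \<open>'k \<Rightarrow>\<^sub>0 nat\<close>) to coefficients; the ring structure is the
  convolution product of \<open>HOL-Library.Poly_Mapping\<close>.
\<close>

type_synonym ('k, 'a) mpoly = "('k \<Rightarrow>\<^sub>0 nat) \<Rightarrow>\<^sub>0 'a"

definition mpoly_at :: "('k, 'a::comm_semiring_1) mpoly \<Rightarrow> ('k \<Rightarrow> 'a) \<Rightarrow> 'a" where
  "mpoly_at p a =
     (\<Sum>m\<in>Poly_Mapping.keys p. Poly_Mapping.lookup p m *
        (\<Prod>k\<in>Poly_Mapping.keys m. a k ^ Poly_Mapping.lookup m k))"

definition mdegree :: "('k \<Rightarrow>\<^sub>0 nat) \<Rightarrow> nat" where
  "mdegree m = (\<Sum>k\<in>Poly_Mapping.keys m. Poly_Mapping.lookup m k)"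

definition total_degree :: "('k, 'a::zero) mpoly \<Rightarrow> nat" where
  "total_degree p = Max (insert 0 (mdegree ` Poly_Mapping.keys p))"

text \<open>If \<open>k\<close> does not occur in \<open>m\<close>, the subtraction below truncates, but the coefficient is \<open>0\<close>.\<close>

definition mpderiv :: "'k \<Rightarrow> ('k, 'a::comm_semiring_1) mpoly \<Rightarrow> ('k, 'a) mpoly" where
  "mpderiv k p =
     (\<Sum>m\<in>Poly_Mapping.keys p.
        Poly_Mapping.single (m - Poly_Mapping.single k 1)
          (of_nat (Poly_Mapping.lookup m k) * Poly_Mapping.lookup p m))"

definition complexify :: "('k, real) mpoly \<Rightarrow> ('k, complex) mpoly" where
  "complexify p = Poly_Mapping.map complex_of_real p"

text \<open>
  The complex affine space with coordinates indexed by \<open>I\<close> is \<open>I \<rightarrow>\<^sub>E UNIV\<close>. A subvariety is the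
  set of common zeros of a set of polynomials in these coordinates (not necessarily irreducible).
\<close>

definition subvariety :: "'k set \<Rightarrow> ('k \<Rightarrow> complex) set \<Rightarrow> bool" where
  "subvariety I V \<longleftrightarrow>
     (\<exists>S :: ('k, complex) mpoly set.
        (\<forall>p\<in>S. \<forall>m\<in>Poly_Mapping.keys p. Poly_Mapping.keys m \<subseteq> I) \<and>
        V = {a \<in> I \<rightarrow>\<^sub>E UNIV. \<forall>p\<in>S. mpoly_at p a = 0})"

definition proper_subvariety :: "'k set \<Rightarrow> ('k \<Rightarrow> complex) set \<Rightarrow> bool" where
  "proper_subvariety I V \<longleftrightarrow> subvariety I V \<and> V \<noteq> (I \<rightarrow>\<^sub>E UNIV)"

text \<open>
  Coordinates on the joint parameter space of the pairs \<open>(u, f)\<close> with \<open>f\<close> of degree at most \<open>d\<close>: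
  the entries of \<open>u\<close> (\<open>Inl\<close>) and the coefficients of \<open>f\<close> (\<open>Inr\<close>).
\<close>

definition uf_index :: "nat \<Rightarrow> ('n + ('n \<Rightarrow>\<^sub>0 nat)) set" where
  "uf_index d = UNIV <+> {m. mdegree m \<le> d}"

definition uf_point :: "nat \<Rightarrow> real ^ 'n \<Rightarrow> ('n, real) mpoly \<Rightarrow> 'n + ('n \<Rightarrow>\<^sub>0 nat) \<Rightarrow> complex" where
  "uf_point d u f =
     restrict (case_sum (\<lambda>i. complex_of_real (u $ i))
                        (\<lambda>m. complex_of_real (Poly_Mapping.lookup f m))) (uf_index d)"

text \<open>
  A system of \<open>n + 1\<close> polynomials in the unknowns \<open>(x, \<lambda>)\<close> is given by its evaluation map; the
  first \<open>n\<close> components form the vector part and the last one is the second entry of the pair.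
\<close>

definition lagrange_system ::
  "real ^ 'n \<Rightarrow> ('n, real) mpoly \<Rightarrow> (complex ^ 'n) \<times> complex \<Rightarrow> (complex ^ 'n) \<times> complex" where
  "lagrange_system u f = (\<lambda>(x, l).
     (\<chi> i. complex_of_real (u $ i) - l * mpoly_at (mpderiv i (complexify f)) (($) x),
      mpoly_at (complexify f) (($) x)))"

text \<open>
  The index \<open>i1\<close> plays the role of the first variable. The constants are \<open>c\<^sub>0 = c None\<close> and
  \<open>c\<^sub>i = c (Some i)\<close>.
\<close>

definition start_system ::
  "'n \<Rightarrow> nat \<Rightarrow> real ^ 'n \<Rightarrow> ('n option \<Rightarrow> complex) \<Rightarrow>
     (complex ^ 'n) \<times> complex \<Rightarrow> (complex ^ 'n) \<times> complex" where
  "start_system i1 d u c = (\<lambda>(x, l).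
     (\<chi> i. complex_of_real (u $ i) - of_nat d * l * c (Some i) * (x $ i) ^ (d - 1),
      c None + c (Some i1) * (x $ i1) ^ d))"

definition homotopy ::
  "('v \<Rightarrow> (complex ^ 'n) \<times> complex) \<Rightarrow> complex \<Rightarrow> ('v \<Rightarrow> (complex ^ 'n) \<times> complex) \<Rightarrow>
     real \<Rightarrow> 'v \<Rightarrow> (complex ^ 'n) \<times> complex" where
  "homotopy B \<gamma> L t z =
     (\<chi> i. complex_of_real (1 - t) * (fst (B z) $ i) + complex_of_real t * \<gamma> * (fst (L z) $ i),
      complex_of_real (1 - t) * snd (B z) + complex_of_real t * \<gamma> * snd (L z))"

definition solution_path ::
  "(real \<Rightarrow> (complex ^ 'n) \<times> complex \<Rightarrow> (complex ^ 'n) \<times> complex) \<Rightarrow>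
     (real \<Rightarrow> (complex ^ 'n) \<times> complex) \<Rightarrow> bool" where
  "solution_path H p \<longleftrightarrow> continuous_on {0..<1} p \<and> (\<forall>t\<in>{0..<1}. H t (p t) = 0)"

end

theory Submission
  imports Defs "HOL-Computational_Algebra.Polynomial"
begin

text \<open>
  Write \<open>g i\<close> for the \<open>i\<close>-th partial derivative of \<open>f\<close> and \<open>1\<close> for the index \<open>i1\<close>. When all \<open>u i\<close> are
  nonzero, \<open>u i = \<lambda> * g i x\<close> for all \<open>i\<close> says the same as \<open>u 1 * g i x = u i * g 1 x\<close> for \<open>i \<noteq> 1\<close>
  together with \<open>\<lambda> = u 1 / g 1 x\<close>. So the multiplier disappears, and what remains is a square
  system \<open>Q\<close> in \<open>x\<close> alone: one equation of degree \<open>d\<close> and \<open>n - 1\<close> equations of degree \<open>d - 1\<close>. The start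
  system has the same shape with \<open>g i = d * c i * x i ^ (d - 1)\<close>. Its solutions are written down by
  extracting roots, and there are \<open>d * (d - 1) ^ (n - 1)\<close> of them. Up to the factor
  \<open>1 - t + t * \<gamma>\<close>, the homotopy at time \<open>t\<close> is the point \<open>s = t * \<gamma> / (1 - t + t * \<gamma>)\<close> of the complex
  line of systems \<open>Q s\<close> from the start system (\<open>s = 0\<close>) to the Lagrange system (\<open>s = 1\<close>).

  Call a system nondegenerate if its homogenisation has no zero at infinity and, at every zero, both
  the Jacobian and \<open>g 1\<close> are nonzero. Over the set of nondegenerate parameters \<open>s\<close> the zeros
  locally stay in a compact set, and each continues along a unique local branch, so they form a finite covering space
  (lemma \<open>covering\<close>). If only finitely many \<open>s\<close> are degenerate, the base is connected; hence
  the number of zeros is constant, and paths of parameters lift through every prescribed end point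
  (lemmas \<open>card_Z_constant\<close> and \<open>zero_path_lift\<close>). A degenerate \<open>s\<close> is hit by the arc
  belonging to \<open>\<gamma>\<close> only if \<open>\<gamma>\<close> lies on a certain ray from the origin. Avoiding finitely many lines
  therefore suffices, and this defines the open dense set of admissible \<open>\<gamma>\<close>.

  The algebraic core is that degeneracy is contained in a hypersurface that misses a
  given nondegenerate base point (theorem \<open>elimination\<close>). Degeneracy means that
  finitely many forms, the members of \<open>Q\<close> and the product of \<open>x 0\<close>, \<open>g 1\<close> and the Jacobian, have a
  common nonzero root. Suppose that at the base point a power of every variable lies in the ideal of
  these forms. Then every monomial of some large degree \<open>D\<close> does; writing down such
  representations with the parameters left free gives a square system of linear relations between
  the monomials of degree \<open>D\<close> which is the identity at the base point. Gaussian elimination turns it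
  into one polynomial in the parameters, equal to \<open>1\<close> at the base point, whose nonvanishing forces all
  monomials of degree \<open>D\<close> to vanish at a common root.

  This is applied twice. Along the line of systems the base point is the start system, and
  the conclusion is that finitely many \<open>s\<close> are degenerate. On the space of all \<open>(u, f)\<close> the base point is
  \<open>u = (1, 0, \<dots>, 0)\<close> with \<open>f = x 1 ^ d + C + (\<Sum>i\<ge>2. x i ^ d - d * x i)\<close> for a large
  constant \<open>C\<close>, and the conclusion is that generic Lagrange systems are nondegenerate. The memberships of
  powers of variables at the two base points are lemmas \<open>start_base\<close> and \<open>lagrange_base\<close>.
\<close>

section \<open>Families of forms\<close>

text \<open>
  A ring of functions on a parameter space, used as coefficients. The instances are the polynomial functions on an
  affine space, the polynomial functions of one variable, and the constants.
\<close>

locale coeff_ring =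
  fixes A :: "('p \<Rightarrow> complex) set"
  assumes const_in: "(\<lambda>_. c) \<in> A"
    and add_in: "a \<in> A \<Longrightarrow> b \<in> A \<Longrightarrow> (\<lambda>p. a p + b p) \<in> A"
    and mult_in: "a \<in> A \<Longrightarrow> b \<in> A \<Longrightarrow> (\<lambda>p. a p * b p) \<in> A"
begin

lemma uminus_in: "a \<in> A \<Longrightarrow> (\<lambda>p. - a p) \<in> A"
  using mult_in[OF const_in[of "-1"]] by simp

lemma diff_in: "a \<in> A \<Longrightarrow> b \<in> A \<Longrightarrow> (\<lambda>p. a p - b p) \<in> A"
  using add_in[OF _ uminus_in] by simp

lemma sum_in: "(\<And>i. i \<in> S \<Longrightarrow> a i \<in> A) \<Longrightarrow> (\<lambda>p. \<Sum>i\<in>S. a i p) \<in> A"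
  by (induction S rule: infinite_finite_induct) (auto intro: add_in const_in)

lemma prod_in: "(\<And>i. i \<in> S \<Longrightarrow> a i \<in> A) \<Longrightarrow> (\<lambda>p. \<Prod>i\<in>S. a i p) \<in> A"
  by (induction S rule: infinite_finite_induct) (auto intro: mult_in const_in)

end

text \<open>
  A form (homogeneous polynomial) of degree \<open>k\<close> in the variables \<open>X v\<close>, with coefficients that are functions
  of the parameter \<open>p\<close>. Only the evaluation map is kept. The generating rules make
  facts such as continuity or the existence of derivatives routine inductions.
\<close>

inductive hom_family :: "('p \<Rightarrow> complex) set \<Rightarrow> nat \<Rightarrow> ('p \<Rightarrow> ('v \<Rightarrow> complex) \<Rightarrow> complex) \<Rightarrow> bool"
  for A where
  hom_coeff: "a \<in> A \<Longrightarrow> hom_family A 0 (\<lambda>p X. a p)"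
| hom_var: "hom_family A 1 (\<lambda>p X. X v)"
| hom_zero: "hom_family A k (\<lambda>p X. 0)"
| hom_add: "hom_family A k F \<Longrightarrow> hom_family A k G \<Longrightarrow> hom_family A k (\<lambda>p X. F p X + G p X)"
| hom_mult: "hom_family A k F \<Longrightarrow> hom_family A l G \<Longrightarrow> hom_family A (k + l) (\<lambda>p X. F p X * G p X)"

definition partial :: "'v \<Rightarrow> (('v \<Rightarrow> complex) \<Rightarrow> complex) \<Rightarrow> ('v \<Rightarrow> complex) \<Rightarrow> complex" where
  "partial v F X = deriv (\<lambda>z. F (X(v := z))) (X v)"

lemma pd_eqI:
  "((\<lambda>z. F (X(v := z))) has_field_derivative D) (at (X v)) \<Longrightarrow> partial v F X = D"
  unfolding partial_def by (rule DERIV_imp_deriv)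

lemma hom_mult_eq: "hom_family A k F \<Longrightarrow> hom_family A l G \<Longrightarrow> m = k + l \<Longrightarrow> hom_family A m (\<lambda>p X. F p X * G p X)"
  using hom_mult by auto

lemma hom_sum: "(\<And>i. i \<in> S \<Longrightarrow> hom_family A k (F i)) \<Longrightarrow> hom_family A k (\<lambda>p X. \<Sum>i\<in>S. F i p X)"
  by (induction S rule: infinite_finite_induct) (auto intro: hom_add hom_zero)

lemma hom_scale: "a \<in> A \<Longrightarrow> hom_family A k F \<Longrightarrow> hom_family A k (\<lambda>p X. a p * F p X)"
  using hom_mult[OF hom_coeff, of a A k F] by simp

context coeff_ring begin

lemma hom_const: "hom_family A 0 (\<lambda>p X. c)"
  by (rule hom_coeff[where a="\<lambda>_. c", OF const_in])

lemma hom_uminus: "hom_family A k F \<Longrightarrow> hom_family A k (\<lambda>p X. - F p X)"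
  using hom_scale[where a="\<lambda>_. -1", OF const_in] by simp

lemma hom_diff: "hom_family A k F \<Longrightarrow> hom_family A k G \<Longrightarrow> hom_family A k (\<lambda>p X. F p X - G p X)"
  using hom_add[OF _ hom_uminus] by simp

lemma hom_cmult: "hom_family A k F \<Longrightarrow> hom_family A k (\<lambda>p X. c * F p X)"
  by (rule hom_scale[where a="\<lambda>_. c", OF const_in])

lemma hom_power: "hom_family A k F \<Longrightarrow> m = k * j \<Longrightarrow> hom_family A m (\<lambda>p X. F p X ^ j)"
proof (induction j arbitrary: m)
  case 0
  then show ?case using hom_const[of 1] by simp
next
  case (Suc j)
  then show ?case using hom_mult_eq[of A k F "k * j" _ m] by simp
qed

lemma hom_prod:
  "finite S \<Longrightarrow> (\<And>i. i \<in> S \<Longrightarrow> hom_family A (k i) (F i)) \<Longrightarrow> m = sum k S \<Longrightarrow>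
    hom_family A m (\<lambda>p X. \<Prod>i\<in>S. F i p X)"
proof (induction S arbitrary: m rule: finite_induct)
  case empty
  then show ?case using hom_const[of 1] by simp
next
  case (insert x S)
  have "hom_family A m (\<lambda>p X. F x p X * (\<Prod>i\<in>S. F i p X))"
    by (rule hom_mult_eq[where k="k x" and l="sum k S"]) (use insert in auto)
  with insert.hyps show ?case by simp
qed

lemma hom_var_power: "hom_family A k (\<lambda>p X. X v ^ k)"
  by (rule hom_power[OF hom_var]) simp

lemma hom_monomial: "finite S \<Longrightarrow> hom_family A (sum m S) (\<lambda>p X. \<Prod>v\<in>S. X v ^ m v)"
  by (rule hom_prod[where k=m]) (auto intro: hom_var_power)

text \<open>
  In degree \<open>0\<close> the derivative is recorded to be the zero function. The product rule needs this: the degree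
  \<open>k - 1\<close> is truncated at \<open>k = 0\<close>, where degrees would otherwise not add up.
\<close>

lemma hom_pd_aux:
  assumes "hom_family A k F"
  shows "\<exists>D. (k = 0 \<longrightarrow> D = (\<lambda>p X. 0)) \<and> (k > 0 \<longrightarrow> hom_family A (k - 1) D) \<and>
    (\<forall>p X. ((\<lambda>z. F p (X(v := z))) has_field_derivative D p X) (at (X v)))"
  using assms
proof induction
  case (hom_coeff a)
  then show ?case by (intro exI[of _ "\<lambda>p X. 0"]) auto
next
  case (hom_var w)
  show ?case using hom_const
    by (intro exI[of _ "\<lambda>p X. if v = w then 1 else 0"]) (auto intro!: derivative_eq_intros)
next
  case (hom_zero k)
  show ?case by (intro exI[of _ "\<lambda>p X. 0"]) (auto intro: hom_family.hom_zero)
next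
  case (hom_add k F G)
  then obtain D E where *:
    "(k = 0 \<longrightarrow> D = (\<lambda>p X. 0)) \<and> (k > 0 \<longrightarrow> hom_family A (k - 1) D)"
    "\<And>p X. ((\<lambda>z. F p (X(v := z))) has_field_derivative D p X) (at (X v))"
    "(k = 0 \<longrightarrow> E = (\<lambda>p X. 0)) \<and> (k > 0 \<longrightarrow> hom_family A (k - 1) E)"
    "\<And>p X. ((\<lambda>z. G p (X(v := z))) has_field_derivative E p X) (at (X v))"
    by blast
  show ?case
    by (intro exI[of _ "\<lambda>p X. D p X + E p X"] conjI impI allI DERIV_add *(2,4))
      (use *(1,3) in \<open>auto intro: hom_family.hom_add\<close>)
next
  case (hom_mult k F l G)
  then obtain D E where D:
    "k = 0 \<Longrightarrow> D = (\<lambda>p X. 0)" "k > 0 \<Longrightarrow> hom_family A (k - 1) D"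
    "\<And>p X. ((\<lambda>z. F p (X(v := z))) has_field_derivative D p X) (at (X v))"
    and E:
    "l = 0 \<Longrightarrow> E = (\<lambda>p X. 0)" "l > 0 \<Longrightarrow> hom_family A (l - 1) E"
    "\<And>p X. ((\<lambda>z. G p (X(v := z))) has_field_derivative E p X) (at (X v))"
    by blast
  have 1: "hom_family A (k + l - 1) (\<lambda>p X. D p X * G p X)" if "k + l > 0"
  proof (cases "k = 0")
    case True
    then show ?thesis using D(1) hom_family.hom_zero by simp
  next
    case False
    then show ?thesis by (intro hom_mult_eq[OF D(2) hom_mult.hyps(2)]) auto
  qed
  have 2: "hom_family A (k + l - 1) (\<lambda>p X. E p X * F p X)" if "k + l > 0"
  proof (cases "l = 0")
    case True
    then show ?thesis using E(1) hom_family.hom_zero by simp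
  next
    case False
    then show ?thesis by (intro hom_mult_eq[OF E(2) hom_mult.hyps(1)]) auto
  qed
  show ?case
  proof (intro exI[of _ "\<lambda>p X. D p X * G p X + E p X * F p X"] conjI allI impI)
    show "((\<lambda>z. F p (X(v := z)) * G p (X(v := z))) has_field_derivative
        D p X * G p X + E p X * F p X) (at (X v))" for p X
      by (rule DERIV_cong[OF DERIV_mult[OF D(3) E(3)]]) simp
  qed (use D(1) E(1) 1 2 in \<open>auto intro: hom_family.hom_add\<close>)
qed

lemma hom_pd:
  assumes "hom_family A k F"
  shows "hom_family A (k - 1) (\<lambda>p. partial v (F p))"
proof -
  obtain D where D: "k = 0 \<longrightarrow> D = (\<lambda>p X. 0)" "k > 0 \<longrightarrow> hom_family A (k - 1) D"
    "\<And>p X. ((\<lambda>z. F p (X(v := z))) has_field_derivative D p X) (at (X v))"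
    using hom_pd_aux[OF assms] by blast
  have "(\<lambda>p. partial v (F p)) = D"
    by (intro ext pd_eqI D(3))
  with D(1,2) show ?thesis by (cases "k = 0") (auto intro: hom_zero)
qed

end

lemma hom_homogeneous: "hom_family A k F \<Longrightarrow> F p (\<lambda>v. c * X v) = c ^ k * F p X"
  by (induction rule: hom_family.induct) (auto simp: algebra_simps power_add)

lemma hom_continuous:
  assumes "hom_family A k F" "\<And>a. a \<in> A \<Longrightarrow> continuous_on S (\<lambda>t. a (\<pi> t))"
    "\<And>v. continuous_on S (\<lambda>t. \<xi> t v)"
  shows "continuous_on S (\<lambda>t. F (\<pi> t) (\<xi> t))"
  using assms(1) by induction (auto intro!: continuous_intros assms(2,3))

text \<open>
  Hadamard's lemma, with difference quotients that are continuous in all arguments. It replaces differentiation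
  in several variables: where the matrix of difference quotients of a square system is invertible,
  the system is injective.
\<close>

lemma hom_Hadamard:
  fixes F :: "'p \<Rightarrow> ('v::finite \<Rightarrow> complex) \<Rightarrow> complex"
  assumes "hom_family A k F" and A: "\<And>a. a \<in> A \<Longrightarrow> continuous_on S (\<lambda>t. a (\<pi> t))"
    and x: "\<And>v. continuous_on S (\<lambda>t. \<xi> t v)" and y: "\<And>v. continuous_on S (\<lambda>t. \<eta> t v)"
  shows "\<exists>R. (\<forall>p X Y. F p X - F p Y = (\<Sum>v\<in>UNIV. R v p X Y * (X v - Y v))) \<and>
    (\<forall>p X v. R v p X X = partial v (F p) X) \<and>
    (\<forall>v. continuous_on S (\<lambda>t. R v (\<pi> t) (\<xi> t) (\<eta> t)))"
proof -
  have "\<exists>R. (\<forall>p X Y. F p X - F p Y = (\<Sum>v\<in>UNIV. R v p X Y * (X v - Y v))) \<and>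
    (\<forall>p X v. ((\<lambda>z. F p (X(v := z))) has_field_derivative R v p X X) (at (X v))) \<and>
    (\<forall>v. continuous_on S (\<lambda>t. R v (\<pi> t) (\<xi> t) (\<eta> t)))"
    using assms(1)
  proof induction
    case (hom_coeff a)
    show ?case by (rule exI[of _ "\<lambda>v p X Y. 0"]) auto
  next
    case (hom_var w)
    show ?case
      by (rule exI[of _ "\<lambda>v p X Y. if v = w then 1 else 0"])
        (auto intro!: derivative_eq_intros simp: if_distrib[of "\<lambda>x. x * _"] cong: if_cong)
  next
    case (hom_zero k)
    show ?case by (rule exI[of _ "\<lambda>v p X Y. 0"]) auto
  next
    case (hom_add k F G)
    then obtain R T where R: "\<And>p X Y. F p X - F p Y = (\<Sum>v\<in>UNIV. R v p X Y * (X v - Y v))"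
      "\<And>p X v. ((\<lambda>z. F p (X(v := z))) has_field_derivative R v p X X) (at (X v))"
      "\<And>v. continuous_on S (\<lambda>t. R v (\<pi> t) (\<xi> t) (\<eta> t))"
      and T: "\<And>p X Y. G p X - G p Y = (\<Sum>v\<in>UNIV. T v p X Y * (X v - Y v))"
      "\<And>p X v. ((\<lambda>z. G p (X(v := z))) has_field_derivative T v p X X) (at (X v))"
      "\<And>v. continuous_on S (\<lambda>t. T v (\<pi> t) (\<xi> t) (\<eta> t))"
      by blast
    show ?case
    proof (intro exI[of _ "\<lambda>v p X Y. R v p X Y + T v p X Y"] conjI allI)
      show "F p X + G p X - (F p Y + G p Y) =
          (\<Sum>v\<in>UNIV. (R v p X Y + T v p X Y) * (X v - Y v))" for p X Y
        unfolding distrib_right sum.distrib R(1)[symmetric] T(1)[symmetric] by simp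
    qed (intro DERIV_add continuous_on_add R T)+
  next
    case (hom_mult k F l G)
    then obtain R T where R: "\<And>p X Y. F p X - F p Y = (\<Sum>v\<in>UNIV. R v p X Y * (X v - Y v))"
      "\<And>p X v. ((\<lambda>z. F p (X(v := z))) has_field_derivative R v p X X) (at (X v))"
      "\<And>v. continuous_on S (\<lambda>t. R v (\<pi> t) (\<xi> t) (\<eta> t))"
      and T: "\<And>p X Y. G p X - G p Y = (\<Sum>v\<in>UNIV. T v p X Y * (X v - Y v))"
      "\<And>p X v. ((\<lambda>z. G p (X(v := z))) has_field_derivative T v p X X) (at (X v))"
      "\<And>v. continuous_on S (\<lambda>t. T v (\<pi> t) (\<xi> t) (\<eta> t))"
      by blast
    show ?case
    proof (intro exI[of _ "\<lambda>v p X Y. R v p X Y * G p X + T v p X Y * F p Y"] conjI allI)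
      fix p X Y
      have "F p X * G p X - F p Y * G p Y = (F p X - F p Y) * G p X + (G p X - G p Y) * F p Y"
        by (simp add: algebra_simps)
      also have "\<dots> = (\<Sum>v\<in>UNIV. (R v p X Y * G p X + T v p X Y * F p Y) * (X v - Y v))"
        unfolding R(1) T(1) sum_distrib_right sum.distrib[symmetric]
        by (intro sum.cong) (auto simp: algebra_simps)
      finally show "F p X * G p X - F p Y * G p Y =
          (\<Sum>v\<in>UNIV. (R v p X Y * G p X + T v p X Y * F p Y) * (X v - Y v))" .
    next
      fix p X v
      show "((\<lambda>z. F p (X(v := z)) * G p (X(v := z))) has_field_derivative
          R v p X X * G p X + T v p X X * F p X) (at (X v))"
        by (rule DERIV_cong[OF DERIV_mult[OF R(2) T(2)]]) simp
    next
      fix v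
      have "continuous_on S (\<lambda>t. F (\<pi> t) (\<eta> t))" "continuous_on S (\<lambda>t. G (\<pi> t) (\<xi> t))"
        using hom_continuous hom_mult.hyps A x y by blast+
      then show "continuous_on S (\<lambda>t. R v (\<pi> t) (\<xi> t) (\<eta> t) * G (\<pi> t) (\<xi> t) +
          T v (\<pi> t) (\<xi> t) (\<eta> t) * F (\<pi> t) (\<eta> t))"
        by (intro continuous_intros R T)
    qed
  qed
  then obtain R where R: "\<forall>p X Y. F p X - F p Y = (\<Sum>v\<in>UNIV. R v p X Y * (X v - Y v))"
    "\<And>p X v. ((\<lambda>z. F p (X(v := z))) has_field_derivative R v p X X) (at (X v))"
    "\<forall>v. continuous_on S (\<lambda>t. R v (\<pi> t) (\<xi> t) (\<eta> t))"
    by blast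
  have "partial v (F p) X = R v p X X" for p X v by (rule pd_eqI) (rule R(2))
  with R show ?thesis by (intro exI[of _ R]) simp
qed

definition expvecs :: "nat \<Rightarrow> ('v::finite \<Rightarrow> nat) set" where
  "expvecs k = {m. sum m UNIV = k}"

definition power_prod :: "('v::finite \<Rightarrow> nat) \<Rightarrow> ('v \<Rightarrow> complex) \<Rightarrow> complex" where
  "power_prod m X = (\<Prod>v\<in>UNIV. X v ^ m v)"

lemma finite_expvecs: "finite (expvecs k :: ('v::finite \<Rightarrow> nat) set)"
proof (rule finite_subset)
  show "expvecs k \<subseteq> (UNIV :: 'v set) \<rightarrow>\<^sub>E {..k}"
    by (auto simp: expvecs_def PiE_def intro: member_le_sum)
  show "finite ((UNIV :: 'v set) \<rightarrow>\<^sub>E {..k})" by (intro finite_PiE) auto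
qed

lemma power_prod_add: "power_prod (\<lambda>v. m v + n v) X = power_prod m X * power_prod n X"
  by (simp add: power_prod_def power_add prod.distrib)

text \<open>
  Collects coefficients, so that forms become linear functions of the vector of monomials.
\<close>

lemma (in coeff_ring) hom_normal_form:
  fixes F :: "'p \<Rightarrow> ('v::finite \<Rightarrow> complex) \<Rightarrow> complex"
  assumes "hom_family A k F"
  shows "\<exists>E. (\<forall>m. E m \<in> A) \<and> (\<forall>p X. F p X = (\<Sum>m\<in>expvecs k. E m p * power_prod m X))"
  using assms
proof induction
  case (hom_coeff a)
  have "expvecs 0 = {\<lambda>v::'v. 0}" by (auto simp: expvecs_def)
  with hom_coeff show ?case by (intro exI[of _ "\<lambda>m. a"]) (auto simp: power_prod_def)
next
  case (hom_var w)
  define e where "e = (\<lambda>v. if v = w then 1::nat else 0)"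
  have e: "e \<in> expvecs 1" by (simp add: expvecs_def e_def)
  have "power_prod e X = X w" for X
    by (simp add: power_prod_def e_def if_distrib[of "\<lambda>k. _ ^ k"] cong: if_cong)
  then show ?case
    using e const_in
    by (intro exI[of _ "\<lambda>m p. if m = e then 1 else 0"])
      (auto simp: if_distrib[of "\<lambda>x. x * _"] sum.delta[OF finite_expvecs] simp del: One_nat_def cong: if_cong)
next
  case (hom_zero k)
  show ?case using const_in by (intro exI[of _ "\<lambda>m p. 0"]) auto
next
  case (hom_add k F G)
  then obtain D E where "\<forall>m. D m \<in> A" "\<And>p X. F p X = (\<Sum>m\<in>expvecs k. D m p * power_prod m X)"
    "\<forall>m. E m \<in> A" "\<And>p X. G p X = (\<Sum>m\<in>expvecs k. E m p * power_prod m X)" by blast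
  then show ?case
    by (intro exI[of _ "\<lambda>m p. D m p + E m p"]) (auto simp: add_in sum.distrib algebra_simps)
next
  case (hom_mult k F l G)
  then obtain D E where D: "\<forall>m. D m \<in> A" "\<And>p X. F p X = (\<Sum>m\<in>expvecs k. D m p * power_prod m X)"
    and E: "\<forall>m. E m \<in> A" "\<And>p X. G p X = (\<Sum>m\<in>expvecs l. E m p * power_prod m X)" by blast
  define plus where "plus = (\<lambda>(m :: 'v \<Rightarrow> nat, n) v. m v + n v)"
  define C where "C = (\<lambda>M p. \<Sum>(m, n)\<in>{q \<in> expvecs k \<times> expvecs l. plus q = M}. D m p * E n p)"
  have "C M \<in> A" for M
    unfolding C_def case_prod_beta by (intro sum_in mult_in) (use D E in auto)
  moreover have "F p X * G p X = (\<Sum>M\<in>expvecs (k + l). C M p * power_prod M X)" for p X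
  proof -
    have "F p X * G p X = (\<Sum>q\<in>expvecs k \<times> expvecs l. D (fst q) p * E (snd q) p * power_prod (plus q) X)"
      unfolding D(2) E(2) sum_product sum.cartesian_product
      by (intro sum.cong) (auto simp: plus_def power_prod_add)
    also have "\<dots> = (\<Sum>M\<in>expvecs (k + l). \<Sum>q\<in>{q \<in> expvecs k \<times> expvecs l. plus q = M}.
        D (fst q) p * E (snd q) p * power_prod (plus q) X)"
      by (rule sum.group[symmetric])
        (use finite_expvecs in blast, rule finite_expvecs,
          auto simp: plus_def expvecs_def sum.distrib)
    also have "\<dots> = (\<Sum>M\<in>expvecs (k + l). C M p * power_prod M X)"
      by (auto simp: C_def sum_distrib_right case_prod_beta intro!: sum.cong)
    finally show ?thesis .
  qed
  ultimately show ?case by blast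
qed


section \<open>Elimination near a base point\<close>

text \<open>
  Over a one-point parameter space a family is a single form, so the closure rules above apply to single forms too.
\<close>

abbreviation form :: "nat \<Rightarrow> (('v \<Rightarrow> complex) \<Rightarrow> complex) \<Rightarrow> bool" where
  "form k \<phi> \<equiv> hom_family (UNIV :: (unit \<Rightarrow> complex) set) k (\<lambda>_. \<phi>)"

interpretation form: coeff_ring "UNIV :: (unit \<Rightarrow> complex) set"
  by unfold_locales auto

lemma (in coeff_ring) hom_form:
  assumes "form k \<phi>" shows "hom_family A k (\<lambda>p. \<phi>)"
proof -
  have "hom_family A k (\<lambda>p. F ())" if "hom_family (UNIV :: (unit \<Rightarrow> complex) set) k F" for k and F
    using that
  proof induction
    case (hom_coeff a)
    show ?case by (rule hom_const)
  qed (intro hom_family.intros; assumption)+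
  from this[OF assms] show ?thesis .
qed

text \<open>
  The homogeneous ideal generated by forms of prescribed degrees. The degree
  of each element is carried along because the linear algebra below takes place in one fixed degree.
\<close>

inductive idl ::
  "(nat \<times> (('v \<Rightarrow> complex) \<Rightarrow> complex)) set \<Rightarrow> nat \<Rightarrow> (('v \<Rightarrow> complex) \<Rightarrow> complex) \<Rightarrow> bool"
  for \<G> where
  idl_gen: "(k, \<phi>) \<in> \<G> \<Longrightarrow> idl \<G> k \<phi>"
| idl_zero: "idl \<G> k (\<lambda>X. 0)"
| idl_add: "idl \<G> k \<phi> \<Longrightarrow> idl \<G> k \<psi> \<Longrightarrow> idl \<G> k (\<lambda>X. \<phi> X + \<psi> X)"
| idl_mult: "idl \<G> k \<phi> \<Longrightarrow> form l \<psi> \<Longrightarrow> idl \<G> (k + l) (\<lambda>X. \<phi> X * \<psi> X)"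

text \<open>
  An ideal member at the base point \<open>p0\<close> extends to a family of the same degree lying in the ideal of the
  given families: keep the cofactors constant and let only the generators vary.
\<close>

lemma (in coeff_ring) idl_lift:
  assumes "idl ((\<lambda>(k, P). (k, P p0)) ` Ps) k \<phi>"
    and Ps: "\<And>k P. (k, P) \<in> Ps \<Longrightarrow> hom_family A k P"
  shows "\<exists>F. hom_family A k F \<and> F p0 = \<phi> \<and>
    (\<forall>p X. (\<forall>(k, P)\<in>Ps. P p X = 0) \<longrightarrow> F p X = 0)"
  using assms(1)
proof induction
  case (idl_gen k \<phi>)
  then show ?case using Ps by fastforce
next
  case (idl_zero k)
  show ?case by (intro exI[of _ "\<lambda>p X. 0"]) (auto intro: hom_zero)
next
  case (idl_add k \<phi> \<psi>)
  then obtain F G where "hom_family A k F" "F p0 = \<phi>" "\<forall>p X. (\<forall>(k, P)\<in>Ps. P p X = 0) \<longrightarrow> F p X = 0"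
    "hom_family A k G" "G p0 = \<psi>" "\<forall>p X. (\<forall>(k, P)\<in>Ps. P p X = 0) \<longrightarrow> G p X = 0" by blast
  then show ?case by (intro exI[of _ "\<lambda>p X. F p X + G p X"]) (auto intro: hom_add)
next
  case (idl_mult k \<phi> l \<psi>)
  then obtain F where "hom_family A k F" "F p0 = \<phi>" "\<forall>p X. (\<forall>(k, P)\<in>Ps. P p X = 0) \<longrightarrow> F p X = 0"
    by blast
  then show ?case
    by (intro exI[of _ "\<lambda>p X. F p X * \<psi> X"])
      (auto intro: hom_mult[OF _ hom_form[OF idl_mult.hyps(2)]])
qed

text \<open>
  This takes the role of a determinant: a matrix over \<open>A\<close> that is the identity at \<open>p0\<close> has trivial kernel wherever
  a certain element of \<open>A\<close> does not vanish. Fraction-free pivoting on the entry at \<open>(a, a)\<close> preserves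
  the hypothesis, and \<open>\<Delta>\<close> is the product of the pivots.
\<close>

lemma (in coeff_ring) gaussian_elimination:
  assumes "finite S" "\<And>m n. m \<in> S \<Longrightarrow> n \<in> S \<Longrightarrow> E m n \<in> A"
    and "\<And>m n. m \<in> S \<Longrightarrow> n \<in> S \<Longrightarrow> E m n p0 = (if m = n then 1 else 0)"
  shows "\<exists>\<Delta>\<in>A. \<Delta> p0 = 1 \<and> (\<forall>p v. \<Delta> p \<noteq> 0 \<longrightarrow>
    (\<forall>m\<in>S. (\<Sum>n\<in>S. E m n p * v n) = 0) \<longrightarrow> (\<forall>m\<in>S. v m = 0))"
  using assms
proof (induction S arbitrary: E rule: finite_induct)
  case empty
  show ?case using const_in[of 1] by (intro bexI[of _ "\<lambda>p. 1"]) auto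
next
  case (insert a S)
  define E' where "E' = (\<lambda>m n p. E a a p * E m n p - E m a p * E a n p)"
  have "\<exists>\<Delta>\<in>A. \<Delta> p0 = 1 \<and> (\<forall>p v. \<Delta> p \<noteq> 0 \<longrightarrow>
    (\<forall>m\<in>S. (\<Sum>n\<in>S. E' m n p * v n) = 0) \<longrightarrow> (\<forall>m\<in>S. v m = 0))"
  proof (rule insert.IH)
    show "E' m n \<in> A" if "m \<in> S" "n \<in> S" for m n
      unfolding E'_def using that by (intro diff_in mult_in insert.prems) auto
    show "E' m n p0 = (if m = n then 1 else 0)" if "m \<in> S" "n \<in> S" for m n
      using that insert.hyps insert.prems(2) by (auto simp: E'_def)
  qed
  then obtain \<Delta> where \<Delta>: "\<Delta> \<in> A" "\<Delta> p0 = 1"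
    "\<And>p v. \<Delta> p \<noteq> 0 \<Longrightarrow> (\<forall>m\<in>S. (\<Sum>n\<in>S. E' m n p * v n) = 0) \<Longrightarrow> (\<forall>m\<in>S. v m = 0)" by blast
  show ?case
  proof (intro bexI[of _ "\<lambda>p. E a a p * \<Delta> p"] conjI allI impI)
    show "(\<lambda>p. E a a p * \<Delta> p) \<in> A" using insert.prems(1) \<Delta>(1) by (intro mult_in) auto
    show "E a a p0 * \<Delta> p0 = 1" using insert.prems(2)[of a a] \<Delta>(2) by simp
    fix p v
    assume nz: "E a a p * \<Delta> p \<noteq> 0"
      and ker: "\<forall>m\<in>insert a S. (\<Sum>n\<in>insert a S. E m n p * v n) = 0"
    have ker': "E m a p * v a + (\<Sum>n\<in>S. E m n p * v n) = 0" if "m \<in> insert a S" for m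
      using ker that insert.hyps by auto
    have "(\<Sum>n\<in>S. E' m n p * v n) = 0" if "m \<in> S" for m
    proof -
      have "(\<Sum>n\<in>S. E' m n p * v n) =
          E a a p * (\<Sum>n\<in>S. E m n p * v n) - E m a p * (\<Sum>n\<in>S. E a n p * v n)"
        by (simp add: E'_def sum_distrib_left left_diff_distrib sum_subtractf mult.assoc)
      also have "\<dots> = E a a p * (E m a p * v a + (\<Sum>n\<in>S. E m n p * v n)) -
          E m a p * (E a a p * v a + (\<Sum>n\<in>S. E a n p * v n))"
        by (simp add: algebra_simps)
      finally show ?thesis using ker'[of m] ker'[of a] that by simp
    qed
    then have "\<forall>m\<in>S. (\<Sum>n\<in>S. E' m n p * v n) = 0" by blast
    from \<Delta>(3)[OF _ this] nz have 0: "\<forall>m\<in>S. v m = 0" by simp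
    then have "E a a p * v a = 0" using ker'[of a] by simp
    with nz 0 show "\<forall>m\<in>insert a S. v m = 0" by simp
  qed
qed

lemma power_prod_split:
  assumes "K \<le> m v"
  shows "power_prod m X = X v ^ K * power_prod (m(v := m v - K)) X"
proof -
  have "power_prod m X = X v ^ m v * (\<Prod>w\<in>UNIV-{v}. X w ^ m w)"
    unfolding power_prod_def by (simp add: prod.remove)
  moreover have "power_prod (m(v := m v - K)) X = X v ^ (m v - K) * (\<Prod>w\<in>UNIV-{v}. X w ^ m w)"
    unfolding power_prod_def by (subst prod.remove[of _ v]) (auto intro!: prod.cong)
  ultimately show ?thesis using assms by (simp flip: power_add mult.assoc)
qed

text \<open>
  The set of parameters with a nontrivial common root lies in a hypersurface avoiding \<open>p0\<close>, provided every
  variable is in the radical of the ideal at \<open>p0\<close>. By Hilbert's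
  Nullstellensatz this hypothesis says that there is no nontrivial common root at \<open>p0\<close>; at the two
  base points it is verified by explicit computation.
\<close>

theorem (in coeff_ring) elimination:
  fixes Ps :: "(nat \<times> ('p \<Rightarrow> ('v::finite \<Rightarrow> complex) \<Rightarrow> complex)) set"
  assumes Ps: "\<And>k P. (k, P) \<in> Ps \<Longrightarrow> hom_family A k P"
    and base: "\<And>v. \<exists>K. idl ((\<lambda>(k, P). (k, P p0)) ` Ps) K (\<lambda>X. X v ^ K)"
  shows "\<exists>\<Delta>\<in>A. \<Delta> p0 = 1 \<and>
    (\<forall>p X. \<Delta> p \<noteq> 0 \<longrightarrow> (\<forall>(k, P)\<in>Ps. P p X = 0) \<longrightarrow> X = (\<lambda>v. 0))"
proof -
  let ?I = "idl ((\<lambda>(k, P). (k, P p0)) ` Ps)"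
  obtain K where K: "\<And>v. ?I (K v) (\<lambda>X. X v ^ K v)" using base by metis
  \<comment> \<open>By the pigeonhole principle a monomial of this degree contains some \<open>X v ^ K v\<close>.\<close>
  define D where "D = Suc (sum K UNIV)"
  have in_idl: "?I D (power_prod m)" if "m \<in> expvecs D" for m
  proof -
    have "\<exists>v. K v \<le> m v"
    proof (rule ccontr)
      assume "\<not> ?thesis"
      then have "sum m UNIV \<le> sum K UNIV" by (intro sum_mono) (simp add: not_le less_imp_le)
      with that show False by (simp add: expvecs_def D_def)
    qed
    then obtain v where v: "K v \<le> m v" by blast
    define m' where "m' = m(v := m v - K v)"
    have "sum m UNIV = m v + sum m (UNIV - {v})" by (simp add: sum.remove)
    moreover have "sum m' UNIV = (m v - K v) + sum m (UNIV - {v})"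
      unfolding m'_def by (subst sum.remove[of _ v]) (auto intro!: sum.cong)
    ultimately have D: "K v + sum m' UNIV = D" using that v by (simp add: expvecs_def)
    have "form (sum m' UNIV) (power_prod m')"
      unfolding power_prod_def[abs_def] by (rule form.hom_monomial) simp
    from idl_mult[OF K[of v] this] have "?I D (\<lambda>X. X v ^ K v * power_prod m' X)" by (simp add: D)
    moreover have "power_prod m = (\<lambda>X. X v ^ K v * power_prod m' X)"
      unfolding m'_def by (rule ext, rule power_prod_split, rule v)
    ultimately show ?thesis by simp
  qed
  have "\<exists>E. (\<forall>n. E n \<in> A) \<and> (\<forall>n\<in>expvecs D. E n p0 = (if m = n then 1 else 0)) \<and>
    (\<forall>p X. (\<forall>(k, P)\<in>Ps. P p X = 0) \<longrightarrow> (\<Sum>n\<in>expvecs D. E n p * power_prod n X) = 0)"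
    if m: "m \<in> expvecs D" for m
  proof -
    obtain F where F: "hom_family A D F" "F p0 = power_prod m"
      "\<forall>p X. (\<forall>(k, P)\<in>Ps. P p X = 0) \<longrightarrow> F p X = 0"
      using idl_lift[OF in_idl[OF m] Ps] by blast
    obtain E where E: "\<forall>n. E n \<in> A" "\<And>p X. F p X = (\<Sum>n\<in>expvecs D. E n p * power_prod n X)"
      using hom_normal_form[OF F(1)] by blast
    \<comment> \<open>The coefficients at \<open>p0\<close> are replaced by those of the monomial itself. Both represent
      \<open>power_prod m\<close>, so this does not change the form, and uniqueness of coefficients is
      not required.\<close>
    define E' where "E' = (\<lambda>n p. (E n p - E n p0) + (if m = n then 1 else 0))"
    have "(\<Sum>n\<in>expvecs D. E' n p * power_prod n X) = F p X" for p X
    proof -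
      have "(\<Sum>n\<in>expvecs D. E' n p * power_prod n X) = F p X - F p0 X +
        (\<Sum>n\<in>expvecs D. (if m = n then 1 else 0) * power_prod n X)"
        unfolding E(2) E'_def by (simp add: distrib_right left_diff_distrib sum.distrib sum_subtractf)
      also have "(\<Sum>n\<in>expvecs D. (if m = n then 1 else 0) * power_prod n X) = power_prod m X"
        using m by (simp add: if_distrib[of "\<lambda>x. x * _"] sum.delta'[OF finite_expvecs] cong: if_cong)
      finally show ?thesis by (simp add: F(2))
    qed
    moreover have "E' n \<in> A" for n
      unfolding E'_def using E(1) by (intro add_in diff_in const_in) auto
    ultimately show ?thesis using F(3) by (intro exI[of _ E']) (simp add: E'_def)
  qed
  then have "\<forall>m\<in>expvecs D. \<exists>E. (\<forall>n. E n \<in> A) \<and> (\<forall>n\<in>expvecs D. E n p0 = (if m = n then 1 else 0)) \<and>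
    (\<forall>p X. (\<forall>(k, P)\<in>Ps. P p X = 0) \<longrightarrow> (\<Sum>n\<in>expvecs D. E n p * power_prod n X) = 0)" by blast
  from bchoice[OF this] obtain E where E': "\<forall>m\<in>expvecs D. (\<forall>n. E m n \<in> A) \<and>
    (\<forall>n\<in>expvecs D. E m n p0 = (if m = n then 1 else 0)) \<and>
    (\<forall>p X. (\<forall>(k, P)\<in>Ps. P p X = 0) \<longrightarrow> (\<Sum>n\<in>expvecs D. E m n p * power_prod n X) = 0)" ..
  have E: "E m n \<in> A" "E m n p0 = (if m = n then 1 else 0)"
    if "m \<in> expvecs D" "n \<in> expvecs D" for m n
    using E' that by simp_all
  obtain \<Delta> where \<Delta>: "\<Delta> \<in> A" "\<Delta> p0 = 1" "\<And>p v. \<Delta> p \<noteq> 0 \<Longrightarrow>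
    (\<forall>m\<in>expvecs D. (\<Sum>n\<in>expvecs D. E m n p * v n) = 0) \<Longrightarrow> (\<forall>m\<in>expvecs D. v m = 0)"
    using gaussian_elimination[OF finite_expvecs E(1,2)] by blast
  have "X = (\<lambda>v. 0)" if "\<Delta> p \<noteq> 0" "\<forall>(k, P)\<in>Ps. P p X = 0" for p X
  proof
    fix v :: 'v
    have z: "\<forall>m\<in>expvecs D. power_prod m X = 0"
      by (rule \<Delta>(3)[OF that(1)]) (use E' that(2) in simp)
    have "(\<lambda>w. if w = v then D else 0) \<in> expvecs D" by (simp add: expvecs_def)
    with z have "power_prod (\<lambda>w. if w = v then D else 0) X = 0" by blast
    then have "X v ^ D = 0"
      by (simp add: power_prod_def if_distrib[of "\<lambda>k. _ ^ k"] cong: if_cong)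
    then show "X v = 0" by simp
  qed
  then show ?thesis using \<Delta>(1,2) by (intro bexI[of _ \<Delta>]) auto
qed


section \<open>Nondegenerate systems are generic\<close>

definition jacobian :: "('n::finite \<Rightarrow> ('n option \<Rightarrow> complex) \<Rightarrow> complex) \<Rightarrow> ('n option \<Rightarrow> complex) \<Rightarrow> complex"
  where "jacobian Q X = det (\<chi> i j. partial (Some j) (Q i) X)"

text \<open>
  The variable \<open>None\<close> is the homogenising one, so \<open>X None \<noteq> 0\<close> excludes zeros at infinity. \<open>G\<close>
  will be the form whose value has to be inverted to recover the Lagrange multiplier.
\<close>

definition nondegenerate ::
  "('n::finite \<Rightarrow> ('n option \<Rightarrow> complex) \<Rightarrow> complex) \<Rightarrow> (('n option \<Rightarrow> complex) \<Rightarrow> complex) \<Rightarrow> bool"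
  where "nondegenerate Q G \<longleftrightarrow> (\<forall>X. (\<forall>i. Q i X = 0) \<longrightarrow> X \<noteq> (\<lambda>v. 0) \<longrightarrow>
    X None \<noteq> 0 \<and> G X \<noteq> 0 \<and> jacobian Q X \<noteq> 0)"

text \<open>
  Degeneracy is the existence of a nonzero common root of these forms: the three nonvanishing
  conditions of \<^const>\<open>nondegenerate\<close> are multiplied into one form. Here \<open>k\<close> and \<open>l\<close> are
  the degrees of \<open>Q\<close> and \<open>G\<close>.
\<close>

definition critical_gens ::
  "('n::finite \<Rightarrow> nat) \<Rightarrow> nat \<Rightarrow> ('n \<Rightarrow> ('n option \<Rightarrow> complex) \<Rightarrow> complex) \<Rightarrow>
     (('n option \<Rightarrow> complex) \<Rightarrow> complex) \<Rightarrow> (nat \<times> (('n option \<Rightarrow> complex) \<Rightarrow> complex)) set"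
  where "critical_gens k l Q G =
    insert (1 + l + (\<Sum>i\<in>UNIV. k i - 1), \<lambda>X. X None * G X * jacobian Q X) (range (\<lambda>i. (k i, Q i)))"

context coeff_ring begin

lemma hom_jac:
  fixes Q :: "'p \<Rightarrow> 'n::finite \<Rightarrow> ('n option \<Rightarrow> complex) \<Rightarrow> complex"
  assumes "\<And>i. hom_family A (k i) (\<lambda>p. Q p i)"
  shows "hom_family A (\<Sum>i\<in>UNIV. k i - 1) (\<lambda>p. jacobian (Q p))"
proof -
  have "hom_family A (\<Sum>i\<in>UNIV. k i - 1) (\<lambda>p X. \<Sum>\<pi>\<in>{\<pi>. \<pi> permutes (UNIV :: 'n set)}.
      of_int (sign \<pi>) * (\<Prod>i\<in>UNIV. partial (Some (\<pi> i)) (Q p i) X))"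
    by (intro hom_sum hom_cmult hom_prod[where k="\<lambda>i. k i - 1"] hom_pd assms) auto
  then show ?thesis by (simp add: jacobian_def[abs_def] det_def)
qed

theorem generically_nondegenerate:
  fixes Q :: "'p \<Rightarrow> 'n::finite \<Rightarrow> ('n option \<Rightarrow> complex) \<Rightarrow> complex"
  assumes Q: "\<And>i. hom_family A (k i) (\<lambda>p. Q p i)" and G: "hom_family A l G"
    and base: "\<And>v. \<exists>K. idl (critical_gens k l (Q p0) (G p0)) K (\<lambda>X. X v ^ K)"
  shows "\<exists>\<Delta>\<in>A. \<Delta> p0 = 1 \<and> (\<forall>p. \<Delta> p \<noteq> 0 \<longrightarrow> nondegenerate (Q p) (G p))"
proof -
  define Ps where "Ps = insert (1 + l + (\<Sum>i\<in>UNIV. k i - 1), \<lambda>p X. X None * G p X * jacobian (Q p) X)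
    (range (\<lambda>i. (k i, \<lambda>p. Q p i)))"
  have "hom_family A m P" if "(m, P) \<in> Ps" for m P
    using that Q hom_mult[OF hom_mult[OF hom_var G] hom_jac[OF Q]] by (auto simp: Ps_def)
  moreover have "(\<lambda>(k, P). (k, P p0)) ` Ps = critical_gens k l (Q p0) (G p0)"
    by (simp add: Ps_def critical_gens_def image_image)
  ultimately obtain \<Delta> where \<Delta>: "\<Delta> \<in> A" "\<Delta> p0 = 1"
    "\<And>p X. \<Delta> p \<noteq> 0 \<Longrightarrow> (\<forall>(k, P)\<in>Ps. P p X = 0) \<Longrightarrow> X = (\<lambda>v. 0)"
    using elimination[of Ps p0] base by metis
  have "nondegenerate (Q p) (G p)" if "\<Delta> p \<noteq> 0" for p
    unfolding nondegenerate_def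
  proof (intro allI impI)
    fix X assume "\<forall>i. Q p i X = 0" "X \<noteq> (\<lambda>v. 0)"
    then have "X None * G p X * jacobian (Q p) X \<noteq> 0"
      using \<Delta>(3)[OF that, of X] by (auto simp: Ps_def)
    then show "X None \<noteq> 0 \<and> G p X \<noteq> 0 \<and> jacobian (Q p) X \<noteq> 0" by simp
  qed
  with \<Delta>(1,2) show ?thesis by auto
qed

end

section \<open>Powers of variables in the ideals at the two base points\<close>

definition cong_mod where "cong_mod \<G> k \<phi> \<psi> \<longleftrightarrow> idl \<G> k (\<lambda>X. \<phi> X - \<psi> X)"

lemma form_const: "form 0 (\<lambda>X. c)" by (rule form.hom_const)

lemma idl_cmult: "idl \<G> k \<phi> \<Longrightarrow> idl \<G> k (\<lambda>X. c * \<phi> X)"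
  using idl_mult[OF _ form_const, of \<G> k \<phi> c] by (simp add: mult.commute)

lemma idl_mult_eq: "idl \<G> k \<phi> \<Longrightarrow> form l \<psi> \<Longrightarrow> m = k + l \<Longrightarrow> idl \<G> m (\<lambda>X. \<phi> X * \<psi> X)"
  using idl_mult by blast

lemma cg_refl: "cong_mod \<G> k \<phi> \<phi>" by (simp add: cong_mod_def idl_zero)

lemma cg_trans [trans]: "cong_mod \<G> k \<phi> \<psi> \<Longrightarrow> cong_mod \<G> k \<psi> \<theta> \<Longrightarrow> cong_mod \<G> k \<phi> \<theta>"
  unfolding cong_mod_def using idl_add[of \<G> k "\<lambda>X. \<phi> X - \<psi> X" "\<lambda>X. \<psi> X - \<theta> X"] by simp

lemma cg_sym: "cong_mod \<G> k \<phi> \<psi> \<Longrightarrow> cong_mod \<G> k \<psi> \<phi>"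
  unfolding cong_mod_def using idl_cmult[of \<G> k _ "-1"] by fastforce

lemma cg_idl: "cong_mod \<G> k \<phi> \<psi> \<Longrightarrow> idl \<G> k \<phi> \<Longrightarrow> idl \<G> k \<psi>"
  using idl_add[of \<G> k \<phi> "\<lambda>X. \<psi> X - \<phi> X"] cg_sym[of \<G> k \<phi> \<psi>] by (simp add: cong_mod_def)

lemma cg_mult:
  assumes "cong_mod \<G> k \<phi> \<psi>" "cong_mod \<G> l \<phi>' \<psi>'" "form k \<psi>" "form l \<phi>'" "m = k + l"
  shows "cong_mod \<G> m (\<lambda>X. \<phi> X * \<phi>' X) (\<lambda>X. \<psi> X * \<psi>' X)"
proof -
  have "idl \<G> m (\<lambda>X. (\<phi> X - \<psi> X) * \<phi>' X)" "idl \<G> m (\<lambda>X. (\<phi>' X - \<psi>' X) * \<psi> X)"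
    using assms by (auto simp: cong_mod_def intro: idl_mult_eq)
  from idl_add[OF this] show ?thesis by (simp add: cong_mod_def algebra_simps)
qed

lemma cg_prod:
  assumes "finite S" "\<And>i. i \<in> S \<Longrightarrow> cong_mod \<G> (k i) (\<phi> i) (\<psi> i)"
    "\<And>i. i \<in> S \<Longrightarrow> form (k i) (\<phi> i)" "\<And>i. i \<in> S \<Longrightarrow> form (k i) (\<psi> i)" "m = sum k S"
  shows "cong_mod \<G> m (\<lambda>X. \<Prod>i\<in>S. \<phi> i X) (\<lambda>X. \<Prod>i\<in>S. \<psi> i X)"
  using assms
proof (induction S arbitrary: m rule: finite_induct)
  case empty
  then show ?case by (simp add: cg_refl)
next
  case (insert x S)
  have "cong_mod \<G> m (\<lambda>X. \<phi> x X * (\<Prod>i\<in>S. \<phi> i X)) (\<lambda>X. \<psi> x X * (\<Prod>i\<in>S. \<psi> i X))"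
    by (rule cg_mult[where k="k x" and l="sum k S"])
      (use insert in \<open>auto intro!: form.hom_prod[where k=k]\<close>)
  with insert.hyps show ?case by simp
qed

lemma cg_power:
  assumes "cong_mod \<G> k \<phi> \<psi>" "form k \<phi>" "form k \<psi>" "m = k * j"
  shows "cong_mod \<G> m (\<lambda>X. \<phi> X ^ j) (\<lambda>X. \<psi> X ^ j)"
  using cg_prod[of "{..<j}" \<G> "\<lambda>_. k" "\<lambda>_. \<phi>" "\<lambda>_. \<psi>" m] assms by (simp add: mult.commute)

text \<open>
  If \<open>X v ^ k\<close> is divisible by \<open>X w\<close> modulo the ideal and \<open>X w\<close> is in the radical, then so is \<open>X v\<close>.
\<close>

lemma idl_power_transfer:
  assumes "cong_mod \<G> k (\<lambda>X. X v ^ k) (\<lambda>X. X w ^ j * \<psi> X)" "form (k - j) \<psi>" "1 \<le> j" "j \<le> k"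
    and w: "idl \<G> a (\<lambda>X. X w ^ a)"
  shows "idl \<G> (k * a) (\<lambda>X. X v ^ (k * a))"
proof -
  have f: "form k (\<lambda>X. X w ^ j * \<psi> X)"
    by (rule hom_mult_eq[OF form.hom_var_power assms(2)]) (use assms(4) in simp)
  have "cong_mod \<G> (k * a) (\<lambda>X. (X v ^ k) ^ a) (\<lambda>X. (X w ^ j * \<psi> X) ^ a)"
    by (rule cg_power[OF assms(1) form.hom_var_power f]) simp
  moreover have "idl \<G> (k * a) (\<lambda>X. X w ^ a * (X w ^ (j * a - a) * \<psi> X ^ a))"
  proof (rule idl_mult_eq[OF w])
    show "form (j * a - a + (k - j) * a) (\<lambda>X. X w ^ (j * a - a) * \<psi> X ^ a)"
      by (rule hom_mult[OF form.hom_var_power form.hom_power[OF assms(2)]]) simp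
    show "k * a = a + (j * a - a + (k - j) * a)"
      using assms(3,4) by (simp add: diff_mult_distrib)
  qed
  moreover have "X w ^ a * (X w ^ (j * a - a) * \<psi> X ^ a) = (X w ^ j * \<psi> X) ^ a" for X
    using assms(3) by (simp add: power_mult_distrib flip: power_mult power_add mult.assoc)
  ultimately show ?thesis
    using cg_idl[OF cg_sym] by (simp add: power_mult)
qed

text \<open>
  The common first step at both base points. There the Jacobian is a constant times a monomial, and multiplying by the missing
  variables turns the factors \<open>X i ^ (d - 2)\<close> into \<open>X i ^ (d - 1)\<close>, which the equations of degree \<open>d - 1\<close>
  replace by powers of a single variable \<open>w\<close>.
\<close>

lemma jac_reduce:
  fixes i1 :: "'n::finite"
  assumes W: "idl \<G> k (\<lambda>X. c * (X None * X (Some i1) ^ (2 * (d - 1)) * (\<Prod>i\<in>-{i1}. X (Some i) ^ (d - 2))))"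
    and "c \<noteq> 0" "d \<ge> 2"
    and q: "\<And>i. i \<noteq> i1 \<Longrightarrow> cong_mod \<G> (d - 1) (\<lambda>X. X (Some i) ^ (d - 1)) (\<lambda>X. \<kappa> i * X w ^ (d - 1))"
    and \<kappa>: "\<And>i. i \<noteq> i1 \<Longrightarrow> \<kappa> i \<noteq> 0"
    and N: "N = card (- {i1})" and k: "k = 1 + 2 * (d - 1) + N * (d - 2)"
  shows "idl \<G> (1 + 2 * (d - 1) + N * (d - 1))
    (\<lambda>X. X None * X (Some i1) ^ (2 * (d - 1)) * X w ^ (N * (d - 1)))"
proof -
  let ?k = "1 + 2 * (d - 1) + N * (d - 1)"
  let ?A = "\<lambda>X. X None * X (Some i1) ^ (2 * (d - 1))"
  define \<kappa>' where "\<kappa>' = (\<Prod>i\<in>-{i1}. \<kappa> i)"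
  have "\<kappa>' \<noteq> 0" using \<kappa> by (simp add: \<kappa>'_def)
  have fA: "form (1 + 2 * (d - 1)) ?A" by (rule hom_mult[OF hom_var form.hom_var_power])
  have "idl \<G> k (\<lambda>X. inverse c * (c * (?A X * (\<Prod>i\<in>-{i1}. X (Some i) ^ (d - 2)))))"
    by (rule idl_cmult) (rule W)
  then have "idl \<G> k (\<lambda>X. ?A X * (\<Prod>i\<in>-{i1}. X (Some i) ^ (d - 2)))"
    using \<open>c \<noteq> 0\<close> by (simp flip: mult.assoc)
  moreover have "form N (\<lambda>X. \<Prod>i\<in>-{i1}. X (Some i))"
    by (rule form.hom_prod[where k="\<lambda>_. 1"]) (auto intro: hom_var[unfolded One_nat_def] simp: N)
  moreover have "?k = k + N"
    using \<open>d \<ge> 2\<close> unfolding k by (cases d) (auto simp: algebra_simps Suc_diff_le dest!: le_Suc_ex)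
  ultimately have "idl \<G> ?k (\<lambda>X. ?A X * (\<Prod>i\<in>-{i1}. X (Some i) ^ (d - 2)) * (\<Prod>i\<in>-{i1}. X (Some i)))"
    by (rule idl_mult_eq)
  moreover have "X (Some i) ^ (d - 2) * X (Some i) = X (Some i) ^ (d - 1)"
    for i and X :: "'n option \<Rightarrow> complex"
    using \<open>d \<ge> 2\<close> power_Suc2[of "X (Some i)" "d - 2"] by (simp add: Suc_diff_Suc numeral_2_eq_2)
  ultimately have *: "idl \<G> ?k (\<lambda>X. ?A X * (\<Prod>i\<in>-{i1}. X (Some i) ^ (d - 1)))"
    by (simp add: mult.assoc flip: prod.distrib)
  have "cong_mod \<G> (N * (d - 1)) (\<lambda>X. \<Prod>i\<in>-{i1}. X (Some i) ^ (d - 1)) (\<lambda>X. \<Prod>i\<in>-{i1}. \<kappa> i * X w ^ (d - 1))"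
    by (rule cg_prod[where k="\<lambda>_. d - 1"])
      (auto intro!: q form.hom_cmult form.hom_var_power simp: N simp del: One_nat_def)
  also have "(\<lambda>X. \<Prod>i\<in>-{i1}. \<kappa> i * X w ^ (d - 1)) = (\<lambda>X. \<kappa>' * X w ^ (N * (d - 1)))"
    by (simp add: prod.distrib \<kappa>'_def N mult.commute flip: power_mult)
  finally have "cong_mod \<G> ?k (\<lambda>X. ?A X * (\<Prod>i\<in>-{i1}. X (Some i) ^ (d - 1))) (\<lambda>X. ?A X * (\<kappa>' * X w ^ (N * (d - 1))))"
    by (rule cg_mult[OF cg_refl _ fA])
      (auto intro!: form.hom_prod[where k="\<lambda>_. d - 1"] form.hom_var_power simp: N)
  from idl_cmult[OF cg_idl[OF this *], of "inverse \<kappa>'"] \<open>\<kappa>' \<noteq> 0\<close>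
  show ?thesis by (simp add: mult.left_commute flip: mult.assoc)
qed

text \<open>
  After the reduction to \<open>X None\<close> and \<open>X (Some i1)\<close>, a further power of \<open>X (Some i1)\<close> makes the exponent a multiple of \<open>d\<close>,
  and \<open>X (Some i1) ^ d\<close> is a nonzero multiple of \<open>X None ^ d\<close>. Hence a power of \<open>X None\<close> is in the ideal, and the
  equations pass this on to the other variables.
\<close>

lemma start_base:
  fixes i1 :: "'n::finite"
  assumes d: "d \<ge> 2"
    and h: "(d, \<lambda>X. c0 * X None ^ d + c1 * X (Some i1) ^ d) \<in> \<G>" "c0 \<noteq> 0" "c1 \<noteq> 0"
    and q: "\<And>i. i \<noteq> i1 \<Longrightarrow> (d - 1, \<lambda>X. a i * X (Some i) ^ (d - 1) - b i * X (Some i1) ^ (d - 1)) \<in> \<G>"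
      "\<And>i. i \<noteq> i1 \<Longrightarrow> a i \<noteq> 0" "\<And>i. i \<noteq> i1 \<Longrightarrow> b i \<noteq> 0"
    and W: "(1 + 2 * (d - 1) + card (- {i1}) * (d - 2), \<lambda>X. c * (X None * X (Some i1) ^ (2 * (d - 1)) *
      (\<Prod>i\<in>-{i1}. X (Some i) ^ (d - 2)))) \<in> \<G>" "c \<noteq> 0"
  shows "\<exists>K. idl \<G> K (\<lambda>X. X v ^ K)"
proof -
  define e where "e = 2 * (d - 1) + card (- {i1}) * (d - 1)"
  define \<kappa> where "\<kappa> = - c0 / c1"
  have "\<kappa> \<noteq> 0" using h by (simp add: \<kappa>_def)
  have q': "cong_mod \<G> (d - 1) (\<lambda>X. X (Some i) ^ (d - 1)) (\<lambda>X. b i / a i * X (Some i1) ^ (d - 1))"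
    if "i \<noteq> i1" for i
    using idl_cmult[OF idl_gen[OF q(1)[OF that]], of "inverse (a i)"] q(2)[OF that]
    by (simp add: cong_mod_def field_simps)
  have h': "cong_mod \<G> d (\<lambda>X. X (Some i1) ^ d) (\<lambda>X. \<kappa> * X None ^ d)"
    using idl_cmult[OF idl_gen[OF h(1)], of "inverse c1"] h(3)
    by (simp add: cong_mod_def \<kappa>_def field_simps)
  have "idl \<G> (1 + 2 * (d - 1) + card (- {i1}) * (d - 1))
    (\<lambda>X. X None * X (Some i1) ^ (2 * (d - 1)) * X (Some i1) ^ (card (- {i1}) * (d - 1)))"
    by (rule jac_reduce[OF idl_gen[OF W(1)] W(2) d q' _ refl refl]) (use q in auto)
  then have "idl \<G> (1 + e) (\<lambda>X. X None * X (Some i1) ^ e)"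
    by (simp add: e_def mult.assoc flip: power_add)
  from idl_mult_eq[OF this form.hom_var_power[of "e * (d - 1)" "Some i1"] refl]
  have "idl \<G> (1 + e + e * (d - 1)) (\<lambda>X. X None * X (Some i1) ^ (e + e * (d - 1)))"
    by (simp add: mult.assoc power_add)
  moreover have "e + e * (d - 1) = d * e" using d by (simp add: algebra_simps diff_mult_distrib2)
  ultimately have 1: "idl \<G> (1 + d * e) (\<lambda>X. X None * (X (Some i1) ^ d) ^ e)"
    by (simp add: power_mult add.assoc)
  have "cong_mod \<G> (1 + d * e) (\<lambda>X. X None * (X (Some i1) ^ d) ^ e) (\<lambda>X. X None * (\<kappa> * X None ^ d) ^ e)"
    by (rule cg_mult[OF cg_refl cg_power[OF h' form.hom_var_power _ refl] hom_var _ refl])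
      (auto intro!: hom_var[unfolded One_nat_def] form.hom_cmult form.hom_var_power form.hom_power[OF form.hom_var_power])
  from idl_cmult[OF cg_idl[OF this 1], of "inverse (\<kappa> ^ e)"] \<open>\<kappa> \<noteq> 0\<close>
  have x0: "idl \<G> (1 + d * e) (\<lambda>X. X None ^ (1 + d * e))"
    by (simp add: power_mult_distrib power_mult mult.left_commute flip: mult.assoc)
  have x1: "idl \<G> (d * (1 + d * e)) (\<lambda>X. X (Some i1) ^ (d * (1 + d * e)))"
  proof (rule idl_power_transfer[OF _ _ _ _ x0])
    show "cong_mod \<G> d (\<lambda>X. X (Some i1) ^ d) (\<lambda>X. X None ^ d * \<kappa>)" using h' by (simp add: mult.commute)
  qed (use d form_const in auto)
  have xi: "idl \<G> ((d - 1) * (d * (1 + d * e))) (\<lambda>X. X (Some i) ^ ((d - 1) * (d * (1 + d * e))))"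
    if "i \<noteq> i1" for i
  proof (rule idl_power_transfer[OF _ _ _ _ x1])
    show "cong_mod \<G> (d - 1) (\<lambda>X. X (Some i) ^ (d - 1)) (\<lambda>X. X (Some i1) ^ (d - 1) * (b i / a i))"
      using q'[OF that] by (simp add: mult.commute)
  qed (use d form_const in auto)
  show ?thesis
    using x0 x1 xi by (metis not_Some_eq)
qed

lemma finite_roots_of_unity: "q > 0 \<Longrightarrow> finite {z::complex. z ^ q = 1}"
  using card_roots_unity_eq[of q] card.infinite by fastforce

lemma prod_roots_unity:
  fixes a b :: complex
  assumes "q > 0"
  shows "(\<Prod>\<omega>\<in>{z. z ^ q = 1}. a - \<omega> * b) = a ^ q - b ^ q"
proof (cases "b = 0")
  case True
  with assms show ?thesis by (simp add: card_roots_unity_eq)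
next
  case False
  let ?R = "{z::complex. z ^ q = 1}"
  note fin = finite_roots_of_unity[OF assms]
  define P where "P = (\<Prod>\<omega>\<in>?R. [:- \<omega>, 1:])"
  have deg: "degree P = q" unfolding P_def
    by (subst degree_prod_eq_sum_degree) (auto simp: card_roots_unity_eq[OF assms])
  have lead: "poly.coeff P q = 1"
    using lead_coeff_prod[of "\<lambda>\<omega>. [:- \<omega>, 1:]" ?R] deg by (simp add: P_def)
  have "P = monom 1 q - 1"
  proof (rule poly_eqI_degree_lead_coeff[where n=q and A="?R"])
    show "poly.coeff P q = poly.coeff (monom 1 q - 1) q" using lead assms by simp
    show "degree (monom 1 q - 1 :: complex poly) \<le> q"
      by (rule order.trans[OF degree_diff_le_max]) (simp add: degree_monom_le)
    show "poly P z = poly (monom 1 q - 1) z" if "z \<in> ?R" for z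
      using that fin by (auto simp: P_def poly_prod poly_monom prod_zero_iff)
  qed (use deg card_roots_unity_eq[OF assms] in auto)
  moreover have "(\<Prod>\<omega>\<in>?R. z - \<omega>) = poly P z" for z by (simp add: P_def poly_prod)
  ultimately have "(\<Prod>\<omega>\<in>?R. z - \<omega>) = z ^ q - 1" for z by (simp add: poly_monom)
  from this[of "a / b"] have "b ^ q * (\<Prod>\<omega>\<in>?R. a / b - \<omega>) = a ^ q - b ^ q"
    using False by (simp add: field_simps power_divide)
  moreover have "b ^ q * (\<Prod>\<omega>\<in>?R. a / b - \<omega>) = (\<Prod>\<omega>\<in>?R. b * (a / b - \<omega>))"
    by (simp add: prod.distrib card_roots_unity_eq[OF assms])
  ultimately show ?thesis using False by (simp add: algebra_simps)
qed

text \<open>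
  Modulo the equations \<open>X v ^ q = X w ^ q\<close> the linear form \<open>C * X w - (\<Sum>v\<in>S. X v)\<close> divides a power of \<open>X w\<close>: at a solution
  with \<open>X w = 1\<close> all \<open>X v\<close> are roots of unity, so it cannot vanish when \<open>C\<close> has norm larger than
  the number of summands. Induction on \<open>S\<close> makes this explicit. With \<open>A\<close> the form for the smaller set,
  \<open>A - X u\<close> divides \<open>A ^ q - X u ^ q\<close>, hence \<open>A ^ q - X w ^ q\<close>, which is the
  product of \<open>A - \<omega> * X w\<close> over the \<open>q\<close>-th roots of unity. Each factor is a form of the same kind, for
  the constant \<open>C - \<omega>\<close>.
\<close>

lemma linear_form_divides_power:
  assumes "finite S" "q > 0"
    "\<And>v. v \<in> S \<Longrightarrow> cong_mod \<G> q (\<lambda>X. X v ^ q) (\<lambda>X. X w ^ q)" "norm C > card S"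
  shows "\<exists>K \<psi> \<kappa>. form K \<psi> \<and> \<kappa> \<noteq> 0 \<and>
    cong_mod \<G> (K + 1) (\<lambda>X. \<psi> X * (C * X w - (\<Sum>v\<in>S. X v))) (\<lambda>X. \<kappa> * X w ^ (K + 1))"
  using assms(1,3,4)
proof (induction S arbitrary: C rule: finite_induct)
  case empty
  then show ?case
    by (intro exI[of _ 0] exI[of _ "\<lambda>X. 1"] exI[of _ C]) (auto simp: cg_refl form_const)
next
  case (insert u S)
  let ?R = "{z::complex. z ^ q = 1}"
  let ?A = "\<lambda>X. C * X w - (\<Sum>v\<in>S. X v)"
  note R = finite_roots_of_unity[OF \<open>q > 0\<close>]
  have "\<forall>\<omega>\<in>?R. \<exists>t. form (fst t) (fst (snd t)) \<and> snd (snd t) \<noteq> 0 \<and>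
    cong_mod \<G> (fst t + 1) (\<lambda>X. fst (snd t) X * ((C - \<omega>) * X w - (\<Sum>v\<in>S. X v)))
      (\<lambda>X. snd (snd t) * X w ^ (fst t + 1))"
  proof
    fix \<omega> :: complex assume "\<omega> \<in> ?R"
    then have "norm \<omega> = 1" using \<open>q > 0\<close> power_eq_1_iff[of \<omega> q] by auto
    then have "norm (C - \<omega>) > card S"
      using insert.prems(2) insert.hyps norm_triangle_ineq2[of C \<omega>] by simp
    from insert.IH[OF _ this] insert.prems(1) obtain K \<psi> \<kappa> where "form K \<psi> \<and> \<kappa> \<noteq> 0 \<and>
      cong_mod \<G> (K + 1) (\<lambda>X. \<psi> X * ((C - \<omega>) * X w - (\<Sum>v\<in>S. X v))) (\<lambda>X. \<kappa> * X w ^ (K + 1))"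
      by auto
    then show "\<exists>t. form (fst t) (fst (snd t)) \<and> snd (snd t) \<noteq> 0 \<and>
      cong_mod \<G> (fst t + 1) (\<lambda>X. fst (snd t) X * ((C - \<omega>) * X w - (\<Sum>v\<in>S. X v)))
        (\<lambda>X. snd (snd t) * X w ^ (fst t + 1))"
      by (intro exI[of _ "(K, \<psi>, \<kappa>)"]) simp
  qed
  from bchoice[OF this] obtain t where t: "\<forall>\<omega>\<in>?R. form (fst (t \<omega>)) (fst (snd (t \<omega>))) \<and>
    snd (snd (t \<omega>)) \<noteq> 0 \<and>
    cong_mod \<G> (fst (t \<omega>) + 1) (\<lambda>X. fst (snd (t \<omega>)) X * ((C - \<omega>) * X w - (\<Sum>v\<in>S. X v)))
      (\<lambda>X. snd (snd (t \<omega>)) * X w ^ (fst (t \<omega>) + 1))" ..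
  define K where "K = (\<lambda>\<omega>. fst (t \<omega>))"
  define \<psi> where "\<psi> = (\<lambda>\<omega>. fst (snd (t \<omega>)))"
  define \<kappa> where "\<kappa> = (\<lambda>\<omega>. snd (snd (t \<omega>)))"
  have t: "form (K \<omega>) (\<psi> \<omega>)" "\<kappa> \<omega> \<noteq> 0"
    "cong_mod \<G> (K \<omega> + 1) (\<lambda>X. \<psi> \<omega> X * (?A X - \<omega> * X w)) (\<lambda>X. \<kappa> \<omega> * X w ^ (K \<omega> + 1))"
    if "\<omega> \<in> ?R" for \<omega>
    using t that by (auto simp: K_def \<psi>_def \<kappa>_def algebra_simps)
  have fA: "form 1 ?A"
    by (intro form.hom_diff form.hom_cmult hom_sum hom_var)
  define g where "g = (\<lambda>X. \<Sum>i<q. X u ^ (q - Suc i) * ?A X ^ i)"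
  have g: "?A X ^ q - X u ^ q = (?A X - X u) * g X" for X
    unfolding g_def by (rule power_diff_sumr2)
  have fg: "form (q - 1) g" unfolding g_def
    by (intro hom_sum, rule hom_mult_eq[OF form.hom_var_power form.hom_power[OF fA refl]]) auto
  define \<Psi> where "\<Psi> = (\<lambda>X. \<Prod>\<omega>\<in>?R. \<psi> \<omega> X)"
  have f\<Psi>: "form (sum K ?R) \<Psi>" unfolding \<Psi>_def
    by (rule form.hom_prod[where k=K]) (use R t in auto)
  have cR: "(\<Sum>\<omega>\<in>?R. K \<omega> + 1) = sum K ?R + q"
    using card_roots_unity_eq[OF \<open>q > 0\<close>] unfolding sum.distrib by simp
  have fA\<omega>: "form 1 (\<lambda>X. ?A X - \<omega> * X w)" for \<omega>
    by (intro form.hom_diff[OF fA] form.hom_cmult hom_var)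
  have "cong_mod \<G> (sum K ?R + q) (\<lambda>X. \<Prod>\<omega>\<in>?R. \<psi> \<omega> X * (?A X - \<omega> * X w))
      (\<lambda>X. \<Prod>\<omega>\<in>?R. \<kappa> \<omega> * X w ^ (K \<omega> + 1))"
    by (rule cg_prod[where k="\<lambda>\<omega>. K \<omega> + 1"])
      (use R t fA\<omega> cR in \<open>auto intro!: hom_mult[of _ _ _ 1, simplified] form.hom_cmult form.hom_var_power[of "Suc _", simplified]\<close>)
  also have "(\<lambda>X. \<Prod>\<omega>\<in>?R. \<psi> \<omega> X * (?A X - \<omega> * X w)) = (\<lambda>X. \<Psi> X * (?A X ^ q - X w ^ q))"
    by (simp add: \<Psi>_def prod.distrib prod_roots_unity[OF \<open>q > 0\<close>])
  also have "(\<lambda>X. \<Prod>\<omega>\<in>?R. \<kappa> \<omega> * X w ^ (K \<omega> + 1)) = (\<lambda>X. prod \<kappa> ?R * X w ^ (sum K ?R + q))"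
    by (simp only: prod.distrib power_sum[symmetric] cR)
  finally have 1: "cong_mod \<G> (sum K ?R + q) (\<lambda>X. \<Psi> X * (?A X ^ q - X w ^ q))
    (\<lambda>X. prod \<kappa> ?R * X w ^ (sum K ?R + q))" .
  have "cong_mod \<G> (sum K ?R + q) (\<lambda>X. \<Psi> X * (?A X ^ q - X u ^ q)) (\<lambda>X. \<Psi> X * (?A X ^ q - X w ^ q))"
  proof (rule cg_mult[OF cg_refl _ f\<Psi> _ refl])
    have "cong_mod \<G> q (\<lambda>X. X u ^ q) (\<lambda>X. X w ^ q)" using insert.prems(1) by simp
    from cg_sym[OF this] show "cong_mod \<G> q (\<lambda>X. ?A X ^ q - X u ^ q) (\<lambda>X. ?A X ^ q - X w ^ q)"
      by (simp add: cong_mod_def)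
    show "form q (\<lambda>X. ?A X ^ q - X u ^ q)"
      by (intro form.hom_diff form.hom_var_power form.hom_power[OF fA]) simp
  qed
  from cg_trans[OF this 1] show ?case
  proof (intro exI conjI)
    show "form (sum K ?R + (q - 1)) (\<lambda>X. \<Psi> X * g X)" by (rule hom_mult[OF f\<Psi> fg])
    show "prod \<kappa> ?R \<noteq> 0" using t(2) R by simp
    assume *: "cong_mod \<G> (sum K ?R + q) (\<lambda>X. \<Psi> X * (?A X ^ q - X u ^ q))
      (\<lambda>X. prod \<kappa> ?R * X w ^ (sum K ?R + q))"
    have "\<Psi> X * (?A X ^ q - X u ^ q) = \<Psi> X * g X * (C * X w - (\<Sum>v\<in>insert u S. X v))" for X
      unfolding g using insert.hyps by (simp add: algebra_simps)
    with * \<open>q > 0\<close> show "cong_mod \<G> (sum K ?R + (q - 1) + 1)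
        (\<lambda>X. \<Psi> X * g X * (C * X w - (\<Sum>v\<in>insert u S. X v)))
        (\<lambda>X. prod \<kappa> ?R * X w ^ (sum K ?R + (q - 1) + 1))" by simp
  qed
qed

text \<open>
  By the equations of degree \<open>d - 1\<close>, the equation of degree \<open>d\<close> expresses \<open>X (Some i1) ^ d\<close> as \<open>X None ^ (d - 1)\<close>
  times a multiple of a linear form \<open>Y\<close>. So the reduced Jacobian condition puts \<open>Y ^ 2\<close> times a power of \<open>X None\<close>
  into the ideal, and \<open>Y\<close> divides a power of \<open>X None\<close>. The constant \<open>(d - 1) * (N + 1)\<close> is
  chosen to make the constant of \<open>Y\<close> equal to \<open>N + 1\<close>, one more than the number of its other terms.
\<close>

lemma lagrange_base:
  fixes i1 :: "'n::finite"
  assumes d: "d \<ge> 2" and N: "N = card (- {i1})"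
    and h: "(d, \<lambda>X. X (Some i1) ^ d + of_nat (d - 1) * of_nat (N + 1) * X None ^ d +
      (\<Sum>i\<in>-{i1}. X (Some i) ^ d - of_nat d * (X (Some i) * X None ^ (d - 1)))) \<in> \<G>"
    and q: "\<And>i. i \<noteq> i1 \<Longrightarrow>
      (d - 1, \<lambda>X. of_nat d * X (Some i) ^ (d - 1) - of_nat d * X None ^ (d - 1)) \<in> \<G>"
    and W: "(1 + 2 * (d - 1) + card (- {i1}) * (d - 2), \<lambda>X. c * (X None * X (Some i1) ^ (2 * (d - 1)) *
      (\<Prod>i\<in>-{i1}. X (Some i) ^ (d - 2)))) \<in> \<G>" "c \<noteq> 0"
  shows "\<exists>K. idl \<G> K (\<lambda>X. X v ^ K)"
proof -
  define Y where "Y = (\<lambda>X. of_nat (N + 1) * X None - (\<Sum>i\<in>-{i1}. X (Some i)) :: complex)"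
  have fY: "form 1 Y"
    unfolding Y_def by (intro form.hom_diff form.hom_cmult hom_sum hom_var)
  define \<delta> :: complex where "\<delta> = - of_nat (d - 1)"
  have "\<delta> \<noteq> 0" using d by (simp add: \<delta>_def)
  have q': "cong_mod \<G> (d - 1) (\<lambda>X. X (Some i) ^ (d - 1)) (\<lambda>X. X None ^ (d - 1))" if "i \<noteq> i1" for i
    using idl_cmult[OF idl_gen[OF q[OF that]], of "inverse (of_nat d)"] d
    by (simp add: cong_mod_def right_diff_distrib flip: mult.assoc)
  have pw: "a * a ^ (d - 1) = a ^ d" for a :: complex
    using d by (cases d) auto
  have h': "cong_mod \<G> d (\<lambda>X. X (Some i1) ^ d) (\<lambda>X. X None ^ (d - 1) * (\<delta> * Y X))"
  proof -
    have "idl \<G> d (\<lambda>X. \<Sum>i\<in>S. (X (Some i) ^ (d - 1) - X None ^ (d - 1)) * X (Some i))"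
      if "S \<subseteq> - {i1}" for S
      using finite_subset[OF that finite] that
    proof (induction S rule: finite_induct)
      case empty
      show ?case by (simp add: idl_zero)
    next
      case (insert i S)
      have "idl \<G> d (\<lambda>X. (X (Some i) ^ (d - 1) - X None ^ (d - 1)) * X (Some i))"
        by (rule idl_mult_eq[OF q'[unfolded cong_mod_def] hom_var]) (use insert.prems d in auto)
      from idl_add[OF this insert.IH] insert show ?case by simp
    qed
    from idl_add[OF idl_gen[OF h] idl_cmult[OF this[OF order.refl], of "-1"]]
    have "idl \<G> d (\<lambda>X. X (Some i1) ^ d + of_nat (d - 1) * of_nat (N + 1) * X None ^ d +
        (\<Sum>i\<in>-{i1}. X (Some i) ^ d - of_nat d * (X (Some i) * X None ^ (d - 1))) +
        - 1 * (\<Sum>i\<in>-{i1}. (X (Some i) ^ (d - 1) - X None ^ (d - 1)) * X (Some i)))" .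
    moreover have "X (Some i1) ^ d + of_nat (d - 1) * of_nat (N + 1) * X None ^ d +
        (\<Sum>i\<in>-{i1}. X (Some i) ^ d - of_nat d * (X (Some i) * X None ^ (d - 1))) +
        - 1 * (\<Sum>i\<in>-{i1}. (X (Some i) ^ (d - 1) - X None ^ (d - 1)) * X (Some i)) =
        X (Some i1) ^ d - X None ^ (d - 1) * (\<delta> * Y X)" for X
    proof -
      have "(\<Sum>i\<in>-{i1}. X (Some i) ^ d - of_nat d * (X (Some i) * X None ^ (d - 1))) +
          - 1 * (\<Sum>i\<in>-{i1}. (X (Some i) ^ (d - 1) - X None ^ (d - 1)) * X (Some i)) =
          (\<Sum>i\<in>-{i1}. X None ^ (d - 1) * (\<delta> * X (Some i)))"
        unfolding sum_distrib_left sum.distrib[symmetric]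
        by (intro sum.cong refl)
          (use d in \<open>simp add: \<delta>_def algebra_simps pw[symmetric] of_nat_diff del: One_nat_def\<close>)
      then show ?thesis
        by (simp add: Y_def pw[symmetric] \<delta>_def algebra_simps sum_distrib_left sum_negf)
    qed
    ultimately show ?thesis by (simp only: cong_mod_def)
  qed
  let ?e = "1 + 2 * (d - 1) + N * (d - 1)"
  have e1: "idl \<G> ?e (\<lambda>X. X None * X (Some i1) ^ (2 * (d - 1)) * X None ^ (N * (d - 1)))"
    by (rule jac_reduce[OF idl_gen[OF W(1)] W(2) d, where \<kappa>="\<lambda>_. 1"]) (use q' N in auto)
  have e2: "idl \<G> (?e + 2) (\<lambda>X. X None ^ (1 + N * (d - 1)) * (X (Some i1) ^ d) ^ 2)"
  proof -
    have sq: "X (Some i1) ^ (2 * (d - 1)) * X (Some i1) ^ 2 = (X (Some i1) ^ d) ^ 2"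
      for X :: "'n option \<Rightarrow> complex"
    proof -
      have "2 * (d - 1) + 2 = d * 2" using d by simp
      then show ?thesis by (simp only: power_mult[symmetric] power_add[symmetric])
    qed
    then have "X None * X (Some i1) ^ (2 * (d - 1)) * X None ^ (N * (d - 1)) * X (Some i1) ^ 2 =
        X None ^ (1 + N * (d - 1)) * (X (Some i1) ^ d) ^ 2" for X :: "'n option \<Rightarrow> complex"
      by (simp only: sq[symmetric] power_add power_one_right mult_ac)
    with idl_mult_eq[OF e1 form.hom_var_power[of 2 "Some i1"] refl] show ?thesis
      by (simp only:)
  qed
  have "cong_mod \<G> (?e + 2) (\<lambda>X. X None ^ (1 + N * (d - 1)) * (X (Some i1) ^ d) ^ 2)
    (\<lambda>X. X None ^ (1 + N * (d - 1)) * (X None ^ (d - 1) * (\<delta> * Y X)) ^ 2)"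
  proof (rule cg_mult[OF cg_refl cg_power[OF h' _ _ refl] form.hom_var_power])
    show "form d (\<lambda>X. X None ^ (d - 1) * (\<delta> * Y X))"
      by (rule hom_mult_eq[OF form.hom_var_power form.hom_cmult[OF fY]]) (use d in simp)
    show "?e + 2 = 1 + N * (d - 1) + d * 2" using d by simp
  qed (rule form.hom_var_power form.hom_power[OF form.hom_var_power refl])+
  from idl_cmult[OF cg_idl[OF this e2], of "inverse (\<delta> ^ 2)"]
  have "idl \<G> (?e + 2) (\<lambda>X. inverse (\<delta> ^ 2) *
    (X None ^ (1 + N * (d - 1)) * (X None ^ (d - 1) * (\<delta> * Y X)) ^ 2))" .
  moreover have "inverse (\<delta> ^ 2) * (X None ^ (1 + N * (d - 1)) * (X None ^ (d - 1) * (\<delta> * Y X)) ^ 2) =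
    X None ^ ?e * Y X ^ 2" for X
    using \<open>\<delta> \<noteq> 0\<close> by (simp add: power2_eq_square power_add mult_2 field_simps)
  ultimately have e3: "idl \<G> (?e + 2) (\<lambda>X. X None ^ ?e * Y X ^ 2)" by (simp only:)
  have "\<exists>K \<psi> \<kappa>. form K \<psi> \<and> \<kappa> \<noteq> 0 \<and> cong_mod \<G> (K + 1)
    (\<lambda>X. \<psi> X * (of_nat (N + 1) * X None - (\<Sum>v\<in>Some ` (- {i1}). X v))) (\<lambda>X. \<kappa> * X None ^ (K + 1))"
  proof (rule linear_form_divides_power[where q="d - 1"])
    show "real (card (Some ` (- {i1}))) < norm (of_nat (N + 1) :: complex)"
      unfolding norm_of_nat by (simp add: card_image N)
  qed (use q' d in auto)
  then obtain K \<psi> \<kappa> where f\<psi>: "form K \<psi>" and "\<kappa> \<noteq> 0"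
    and "cong_mod \<G> (K + 1) (\<lambda>X. \<psi> X * Y X) (\<lambda>X. \<kappa> * X None ^ (K + 1))"
    by (auto simp: Y_def sum.reindex)
  from cg_power[OF this(3) hom_mult[OF f\<psi> fY] form.hom_cmult[OF form.hom_var_power] refl, of 2]
  have "cong_mod \<G> (?e + (K + 1) * 2) (\<lambda>X. X None ^ ?e * (\<psi> X * Y X) ^ 2)
    (\<lambda>X. X None ^ ?e * (\<kappa> * X None ^ (K + 1)) ^ 2)"
    by (rule cg_mult[OF cg_refl _ form.hom_var_power])
      (auto intro!: form.hom_power hom_mult[OF f\<psi> fY, simplified])
  moreover have "idl \<G> (?e + (K + 1) * 2) (\<lambda>X. X None ^ ?e * (\<psi> X * Y X) ^ 2)"
    using idl_mult_eq[OF e3 form.hom_power[OF f\<psi>, of "K * 2" 2], of "?e + (K + 1) * 2"]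
    by (simp add: power_mult_distrib mult_ac)
  ultimately have "idl \<G> (?e + (K + 1) * 2) (\<lambda>X. X None ^ ?e * (\<kappa> * X None ^ (K + 1)) ^ 2)"
    by (rule cg_idl)
  from idl_cmult[OF this, of "inverse (\<kappa> ^ 2)"]
  have "idl \<G> (?e + (K + 1) * 2)
    (\<lambda>X. inverse (\<kappa> ^ 2) * (X None ^ ?e * (\<kappa> * X None ^ (K + 1)) ^ 2))" .
  moreover have "inverse (\<kappa> ^ 2) * (X None ^ ?e * (\<kappa> * X None ^ (K + 1)) ^ 2) =
    X None ^ (?e + (K + 1) * 2)" for X :: "'n option \<Rightarrow> complex"
    using \<open>\<kappa> \<noteq> 0\<close> by (simp only: power_mult_distrib power_add power_mult) (simp add: field_simps)
  ultimately have x0: "idl \<G> (?e + (K + 1) * 2) (\<lambda>X. X None ^ (?e + (K + 1) * 2))" by (simp only:)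
  have x1: "\<exists>K. idl \<G> K (\<lambda>X. X (Some i1) ^ K)"
    by (rule exI, rule idl_power_transfer[OF h' _ _ _ x0])
      (use d form.hom_cmult[OF fY] in auto)
  have xi: "\<exists>K. idl \<G> K (\<lambda>X. X (Some i) ^ K)" if "i \<noteq> i1" for i
    by (rule exI, rule idl_power_transfer[where \<psi>="\<lambda>_. 1" and k="d - 1" and j="d - 1", OF _ _ _ _ x0])
      (use d form_const q'[OF that] in auto)
  show ?thesis
  proof (cases v)
    case None
    with x0 show ?thesis by blast
  next
    case (Some i)
    with x1 xi show ?thesis by (cases "i = i1") auto
  qed
qed


section \<open>The zeros of a nondegenerate family form a covering space\<close>

definition hom_coords :: "complex ^ 'n \<Rightarrow> 'n option \<Rightarrow> complex" where
  "hom_coords x = case_option 1 (($) x)"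

lemma hc_simps [simp]: "hom_coords x None = 1" "hom_coords x (Some i) = x $ i"
  by (simp_all add: hom_coords_def)

lemma UNIV_option_sum:
  fixes f :: "'n::finite option \<Rightarrow> 'a::comm_monoid_add"
  shows "sum f UNIV = f None + (\<Sum>i\<in>UNIV. f (Some i))"
  by (simp add: UNIV_option_conv sum.reindex)

locale nondegenerate_family = coeff_ring A for A :: "(complex \<Rightarrow> complex) set" +
  fixes Q :: "complex \<Rightarrow> 'n::finite \<Rightarrow> ('n option \<Rightarrow> complex) \<Rightarrow> complex"
    and G :: "complex \<Rightarrow> ('n option \<Rightarrow> complex) \<Rightarrow> complex"
    and k :: "'n \<Rightarrow> nat" and B :: "complex set"
  assumes A_continuous: "a \<in> A \<Longrightarrow> continuous_on UNIV a"
    and hom_Q: "hom_family A (k i) (\<lambda>s. Q s i)"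
    and finite_B: "finite B"
    and nondegenerate_Q: "s \<notin> B \<Longrightarrow> nondegenerate (Q s) (G s)"
begin

definition Z :: "complex \<Rightarrow> (complex ^ 'n) set" where
  "Z s = {x. \<forall>i. Q s i (hom_coords x) = 0}"

definition F :: "complex \<Rightarrow> complex ^ 'n \<Rightarrow> complex ^ 'n" where
  "F s x = (\<chi> i. Q s i (hom_coords x))"

lemma Z_iff_F: "x \<in> Z s \<longleftrightarrow> F s x = 0"
  by (simp add: Z_def F_def vec_eq_iff)

lemma continuous_hc:
  "continuous_on S f \<Longrightarrow> continuous_on S (\<lambda>t. hom_coords (f t) v)"
  by (cases v) (auto intro!: continuous_intros)

lemma continuous_Q:
  assumes "continuous_on S \<pi>" "\<And>v. continuous_on S (\<lambda>t. \<xi> t v)"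
  shows "continuous_on S (\<lambda>t. Q (\<pi> t) i (\<xi> t))"
proof (rule hom_continuous[OF hom_Q _ assms(2)])
  fix a assume "a \<in> A"
  from continuous_on_compose2[OF A_continuous[OF this] assms(1)]
  show "continuous_on S (\<lambda>t. a (\<pi> t))" by simp
qed

lemma continuous_F: "continuous_on UNIV (\<lambda>t. F (fst t) (snd t))"
  unfolding F_def by (intro continuous_on_vec_lambda continuous_Q continuous_hc continuous_intros)

lemma jac_nonzero:
  assumes "s \<notin> B" "x \<in> Z s"
  shows "jacobian (Q s) (hom_coords x) \<noteq> 0"
proof -
  have "hom_coords x \<noteq> (\<lambda>v. 0)" by (metis hc_simps(1) zero_neq_one)
  with assms nondegenerate_Q show ?thesis by (auto simp: nondegenerate_def Z_def)
qed

text \<open>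
  At a zero the matrix of difference quotients is the Jacobian matrix, so it is invertible nearby, also for two
  distinct points \<open>x\<close> and \<open>y\<close>.
\<close>

lemma locally_injective:
  assumes "s0 \<notin> B" "x0 \<in> Z s0"
  shows "\<exists>U N. open U \<and> s0 \<in> U \<and> open N \<and> x0 \<in> N \<and>
    (\<forall>s\<in>U. inj_on (F s) N)"
proof -
  let ?\<xi> = "\<lambda>t :: complex \<times> (complex ^ 'n) \<times> (complex ^ 'n). hom_coords (fst (snd t))"
  let ?\<eta> = "\<lambda>t :: complex \<times> (complex ^ 'n) \<times> (complex ^ 'n). hom_coords (snd (snd t))"
  have "\<exists>R. (\<forall>s X Y. Q s i X - Q s i Y = (\<Sum>v\<in>UNIV. R v s X Y * (X v - Y v))) \<and>
    (\<forall>s X v. R v s X X = partial v (Q s i) X) \<and>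
    (\<forall>v. continuous_on UNIV (\<lambda>t. R v (fst t) (?\<xi> t) (?\<eta> t)))" for i
  proof (rule hom_Hadamard[OF hom_Q])
    show "continuous_on UNIV (\<lambda>t :: complex \<times> (complex ^ 'n) \<times> (complex ^ 'n). a (fst t))"
      if "a \<in> A" for a
      using continuous_on_compose2[OF A_continuous[OF that] continuous_on_fst[OF continuous_on_id]]
      by auto
  qed (intro continuous_hc continuous_intros)+
  then have "\<forall>i. \<exists>R. (\<forall>s X Y. Q s i X - Q s i Y = (\<Sum>v\<in>UNIV. R v s X Y * (X v - Y v))) \<and>
    (\<forall>s X v. R v s X X = partial v (Q s i) X) \<and>
    (\<forall>v. continuous_on UNIV (\<lambda>t. R v (fst t) (?\<xi> t) (?\<eta> t)))" ..
  from choice[OF this] obtain R where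
    R: "\<And>i s X Y. Q s i X - Q s i Y = (\<Sum>v\<in>UNIV. R i v s X Y * (X v - Y v))"
      "\<And>i s X v. R i v s X X = partial v (Q s i) X"
      "\<And>i v. continuous_on UNIV (\<lambda>t. R i v (fst t) (?\<xi> t) (?\<eta> t))" by auto
  define M where "M = (\<lambda>t. (\<chi> i j. R i (Some j) (fst t) (?\<xi> t) (?\<eta> t)) :: complex ^ 'n ^ 'n)"
  have diff: "F s x - F s y = M (s, x, y) *v (x - y)" for s x y
    by (simp add: vec_eq_iff F_def M_def R(1) UNIV_option_sum matrix_vector_mult_def)
  have "continuous_on UNIV (\<lambda>t. det (M t))"
    unfolding det_def M_def by (intro continuous_intros) (simp add: R(3))
  then have "open ((\<lambda>t. det (M t)) -` (- {0}))" by (intro open_vimage) auto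
  moreover have "(s0, x0, x0) \<in> (\<lambda>t. det (M t)) -` (- {0})"
    using jac_nonzero[OF assms] by (simp add: M_def R(2) jacobian_def)
  ultimately obtain U W where UW: "open U" "open W" "s0 \<in> U" "(x0, x0) \<in> W"
    "U \<times> W \<subseteq> (\<lambda>t. det (M t)) -` (- {0})" by (metis open_prod_elim mem_Sigma_iff)
  from UW(2,4) obtain N1 N2 where N: "open N1" "open N2" "x0 \<in> N1" "x0 \<in> N2" "N1 \<times> N2 \<subseteq> W"
    by (metis open_prod_elim mem_Sigma_iff)
  have "inj_on (F s) (N1 \<inter> N2)" if "s \<in> U" for s
  proof (rule inj_onI)
    fix x y assume "x \<in> N1 \<inter> N2" "y \<in> N1 \<inter> N2" "F s x = F s y"
    with that have *: "s \<in> U" "x \<in> N1 \<inter> N2" "y \<in> N1 \<inter> N2" "F s x = F s y" by auto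
    have "(s, x, y) \<in> U \<times> W" using * N(5) by auto
    then have "det (M (s, x, y)) \<noteq> 0" using UW(5) by blast
    then have "\<exists>B. B ** M (s, x, y) = mat 1"
      using invertible_det_nz[of "M (s, x, y)"] by (auto simp: invertible_def)
    moreover have "M (s, x, y) *v (x - y) = 0" using diff[of s x y] * by simp
    ultimately show "x = y" using matrix_left_invertible_ker[of "M (s, x, y)"] by auto
  qed
  with UW N show ?thesis by (intro exI[of _ U] exI[of _ "N1 \<inter> N2"]) auto
qed

text \<open>
  By local injectivity, \<open>(s, x) \<mapsto> (s, F s x)\<close> is a homeomorphism near \<open>(s0, x0)\<close>, with open image by
  invariance of domain. Its inverse on the slice \<open>F = 0\<close> is the section; this stands in for the implicit
  function theorem.
\<close>

lemma local_section:
  assumes "s0 \<notin> B" "x0 \<in> Z s0" "open N0" "x0 \<in> N0"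
  shows "\<exists>U N \<sigma>. open U \<and> s0 \<in> U \<and> open N \<and> x0 \<in> N \<and> N \<subseteq> N0 \<and>
    continuous_on U \<sigma> \<and> (\<forall>s\<in>U. Z s \<inter> N = {\<sigma> s})"
proof -
  obtain U1 N1 where *: "open U1" "s0 \<in> U1" "open N1" "x0 \<in> N1"
    "\<forall>s\<in>U1. inj_on (F s) N1"
    using locally_injective[OF assms(1,2)] by blast
  define N where "N = N1 \<inter> N0"
  define \<Phi> where "\<Phi> = (\<lambda>t. (fst t, F (fst t) (snd t)))"
  have oN: "open (U1 \<times> N)" using * assms by (auto simp: N_def intro: open_Times)
  have c\<Phi>: "continuous_on (U1 \<times> N) \<Phi>" unfolding \<Phi>_def
    by (intro continuous_intros continuous_on_subset[OF continuous_F]) auto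
  have inj: "inj_on \<Phi> (U1 \<times> N)"
  proof (rule inj_onI)
    fix a b assume ab: "a \<in> U1 \<times> N" "b \<in> U1 \<times> N" "\<Phi> a = \<Phi> b"
    then have "fst a = fst b" "F (fst a) (snd a) = F (fst a) (snd b)" by (auto simp: \<Phi>_def)
    moreover have "inj_on (F (fst a)) N1" "snd a \<in> N1" "snd b \<in> N1"
      using ab(1,2) *(5) by (auto simp: N_def)
    ultimately show "a = b" by (auto intro: prod_eqI dest: inj_onD)
  qed
  obtain g where g: "homeomorphism (U1 \<times> N) (\<Phi> ` (U1 \<times> N)) \<Phi> g"
    by (rule invariance_of_domain_homeomorphism[OF oN c\<Phi> order.refl inj])
  have oV: "open (\<Phi> ` (U1 \<times> N))" by (rule invariance_of_domain[OF c\<Phi> oN inj])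
  define U where "U = (\<lambda>s. (s, 0)) -` (\<Phi> ` (U1 \<times> N))"
  have "open U" unfolding U_def by (rule open_vimage[OF oV]) (intro continuous_intros)
  moreover have "(s0, 0) = \<Phi> (s0, x0)" using assms(2) by (simp add: \<Phi>_def Z_iff_F)
  then have "s0 \<in> U" using * assms(4) by (auto simp: U_def N_def)
  moreover have "continuous_on U (\<lambda>s. snd (g (s, 0)))"
    by (rule continuous_on_snd, rule continuous_on_compose2[OF homeomorphism_cont2[OF g]])
      (auto simp: U_def intro!: continuous_intros)
  moreover have "Z s \<inter> N = {snd (g (s, 0))}" if "s \<in> U" for s
  proof -
    have "(s, 0) \<in> \<Phi> ` (U1 \<times> N)" using that by (simp add: U_def)
    then have 1: "g (s, 0) \<in> U1 \<times> N" "\<Phi> (g (s, 0)) = (s, 0)"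
      using homeomorphism_image2[OF g] homeomorphism_apply2[OF g] by blast+
    then have 2: "s \<in> U1" "snd (g (s, 0)) \<in> N" "F s (snd (g (s, 0))) = 0"
      by (auto simp: \<Phi>_def mem_Times_iff)
    have "x = snd (g (s, 0))" if "x \<in> Z s" "x \<in> N" for x
    proof (rule inj_onD[of "F s" N1])
      show "inj_on (F s) N1" using *(5) 2(1) by blast
      show "F s x = F s (snd (g (s, 0)))" using that(1) 2(3) by (simp add: Z_iff_F)
    qed (use that(2) 2(2) in \<open>auto simp: N_def\<close>)
    moreover have "snd (g (s, 0)) \<in> Z s \<inter> N" using 2 by (simp add: Z_iff_F)
    ultimately show ?thesis by blast
  qed
  moreover have "open N" "x0 \<in> N" "N \<subseteq> N0" using * assms by (auto simp: N_def)
  ultimately show ?thesis by (intro exI[of _ U] exI[of _ N] exI[of _ "\<lambda>s. snd (g (s, 0))"]) simp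
qed

lemma limit_of_zeros:
  assumes "s \<longlonglongrightarrow> s0" "x \<longlonglongrightarrow> x0" "\<And>m. x m \<in> Z (s m)"
  shows "x0 \<in> Z s0"
proof -
  have "(\<lambda>m. (s m, x m)) \<longlonglongrightarrow> (s0, x0)" by (intro tendsto_Pair assms)
  from continuous_on_tendsto_compose[OF continuous_F this]
  have "(\<lambda>m. F (s m) (x m)) \<longlonglongrightarrow> F s0 x0" by simp
  moreover have "(\<lambda>m. F (s m) (x m)) = (\<lambda>m. 0)" using assms(3) by (simp add: Z_iff_F)
  ultimately show ?thesis by (simp add: Z_iff_F LIMSEQ_const_iff)
qed

text \<open>
  Properness. Unbounded zeros over parameters tending to \<open>s0\<close>, normalised in homogeneous coordinates, accumulate at a
  zero of \<open>Q s0\<close> at infinity.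
\<close>

lemma zeros_bounded:
  assumes "s0 \<notin> B"
  shows "\<exists>e>0. \<exists>R. \<forall>s x. dist s s0 < e \<longrightarrow> x \<in> Z s \<longrightarrow> norm x \<le> R"
proof (rule ccontr)
  assume no: "\<not> ?thesis"
  have "\<exists>s x. dist s s0 < inverse (Suc m) \<and> x \<in> Z s \<and> norm x > real m" for m :: nat
  proof -
    have "inverse (real (Suc m)) > 0" by simp
    with no have "\<not> (\<forall>s x. dist s s0 < inverse (Suc m) \<longrightarrow> x \<in> Z s \<longrightarrow> norm x \<le> real m)" by blast
    then show ?thesis by (simp add: not_le)
  qed
  then obtain s x where sx: "\<And>m. dist (s m) s0 < inverse (Suc m)" "\<And>m. x m \<in> Z (s m)"
    "\<And>m. norm (x m) > real m" by metis
  have s: "s \<longlonglongrightarrow> s0"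
    by (rule metric_tendsto_imp_tendsto[OF LIMSEQ_inverse_real_of_nat])
      (use sx(1) in \<open>auto intro!: always_eventually less_imp_le\<close>)
  define w where "w = (\<lambda>m. (\<chi> v. hom_coords (x m) v) :: complex ^ ('n option))"
  define y where "y = (\<lambda>m. (\<chi> v. hom_coords (x m) v / of_real (norm (w m))) :: complex ^ ('n option))"
  have "w m $ None = 1" for m by (simp add: w_def)
  then have wnz: "norm (w m) > 0" for m by (metis one_neq_zero zero_index zero_less_norm_iff)
  have "norm (x m) \<le> real CARD('n) * norm (w m)" for m
  proof -
    have "norm (x m) \<le> (\<Sum>i\<in>UNIV. norm (x m $ i))"
      unfolding norm_vec_def by (rule L2_set_le_sum) simp
    also have "\<dots> \<le> (\<Sum>i\<in>(UNIV :: 'n set). norm (w m))"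
    proof (rule sum_mono)
      fix i show "norm (x m $ i) \<le> norm (w m)"
        using Finite_Cartesian_Product.norm_nth_le[of "w m" "Some i"] by (simp add: w_def)
    qed
    finally show ?thesis by simp
  qed
  then have "real m / real CARD('n) \<le> norm (w m)" for m
    using sx(3)[of m] by (auto simp: divide_le_eq mult.commute intro: order.trans[OF less_imp_le])
  then have "filterlim (\<lambda>m. norm (w m)) at_top sequentially"
    by (intro filterlim_at_top_mono[OF filterlim_tendsto_pos_mult_at_top[OF
        tendsto_const _ filterlim_real_sequentially, of "inverse (real CARD('n))"]])
      (auto simp: field_simps intro!: always_eventually)
  then have inv0: "(\<lambda>m. inverse (norm (w m))) \<longlonglongrightarrow> 0" by (rule tendsto_inverse_0_at_top)
  have "y m = inverse (norm (w m)) *\<^sub>R w m" for m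
    by (simp add: vec_eq_iff y_def) (simp add: w_def scaleR_conv_of_real divide_inverse mult.commute)
  then have "norm (y m) = 1" for m using wnz[of m] by simp
  then have "\<forall>m. y m \<in> sphere 0 1" by simp
  then obtain y0 r where y0: "y0 \<in> sphere 0 1" "strict_mono r" "(y \<circ> r) \<longlonglongrightarrow> y0"
    using compact_sphere[of "0 :: complex ^ ('n option)" 1] unfolding compact_def by metis
  have "Q s0 i (($) y0) = 0" for i
  proof -
    have "continuous_on UNIV (\<lambda>t :: complex \<times> (complex ^ ('n option)). Q (fst t) i (($) (snd t)))"
      by (intro continuous_Q continuous_intros)
    moreover have "(\<lambda>m. (s (r m), y (r m))) \<longlonglongrightarrow> (s0, y0)"
      using y0(3) LIMSEQ_subseq_LIMSEQ[OF s y0(2)] by (intro tendsto_Pair) (auto simp: o_def)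
    ultimately have "(\<lambda>m. Q (fst (s (r m), y (r m))) i (($) (snd (s (r m), y (r m))))) \<longlonglongrightarrow>
        Q (fst (s0, y0)) i (($) (snd (s0, y0)))"
      by (rule continuous_on_tendsto_compose[where s=UNIV]) auto
    then have "(\<lambda>m. Q (s (r m)) i (($) (y (r m)))) \<longlonglongrightarrow> Q s0 i (($) y0)" by simp
    moreover have "Q (s m) i (($) (y m)) = 0" for m
    proof -
      have "(($) (y m)) = (\<lambda>v. inverse (of_real (norm (w m))) * hom_coords (x m) v)"
        by (rule ext) (simp add: y_def divide_inverse mult.commute)
      with hom_homogeneous[OF hom_Q] sx(2)[of m] show ?thesis by (simp add: Z_def)
    qed
    ultimately show ?thesis by (simp add: LIMSEQ_const_iff)
  qed
  moreover have "y0 \<noteq> 0" using y0(1) by auto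
  then have "($) y0 \<noteq> (\<lambda>v. 0)" by (auto simp: vec_eq_iff fun_eq_iff)
  ultimately have "y0 $ None \<noteq> 0" using nondegenerate_Q[OF assms] by (auto simp: nondegenerate_def)
  moreover have "(\<lambda>m. y (r m) $ None) \<longlonglongrightarrow> y0 $ None"
    using y0(3) by (intro tendsto_vec_nth) (simp add: o_def)
  moreover have "(\<lambda>m. y (r m) $ None) \<longlonglongrightarrow> of_real 0"
    using LIMSEQ_subseq_LIMSEQ[OF tendsto_of_real[OF inv0, where 'a=complex] y0(2)]
    by (simp add: y_def o_def divide_inverse)
  ultimately show False using LIMSEQ_unique[of "\<lambda>m. y (r m) $ None" "y0 $ None" "of_real 0"] by simp
qed

lemma finite_Z:
  assumes "s \<notin> B"
  shows "finite (Z s)"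
proof -
  obtain e R where "e > 0" "\<forall>s' x. dist s' s < e \<longrightarrow> x \<in> Z s' \<longrightarrow> norm x \<le> R"
    using zeros_bounded[OF assms] by blast
  then have "bounded (Z s)" by (metis boundedI dist_self)
  moreover have "closed (Z s)"
    unfolding closed_sequential_limits using limit_of_zeros[OF tendsto_const] by blast
  ultimately have c: "compact (Z s)" by (simp add: compact_eq_bounded_closed)
  have "\<not> x islimpt Z s" if "x \<in> Z s" for x
  proof -
    obtain U N where *: "s \<in> U" "open N" "x \<in> N"
      "\<forall>s\<in>U. inj_on (F s) N"
      using locally_injective[OF assms \<open>x \<in> Z s\<close>] by blast
    show ?thesis
    proof
      assume "x islimpt Z s"
      with *(2,3) obtain y where "y \<in> Z s" "y \<in> N" "y \<noteq> x" by (auto simp: islimpt_def)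
      with inj_onD[of "F s" N x y] * that show False by (auto simp: Z_iff_F)
    qed
  qed
  from finite_not_islimpt_in_compact[OF c this] show ?thesis by simp
qed

text \<open>
  Local sections through the finitely many zeros over \<open>s0\<close> have disjoint images near these zeros, and by properness
  no other zeros occur over a small neighbourhood.
\<close>

lemma evenly_covered:
  assumes "s0 \<notin> B"
  shows "\<exists>U N \<sigma>. open U \<and> s0 \<in> U \<and> U \<subseteq> - B \<and> disjoint_family_on N (Z s0) \<and>
    (\<forall>x\<in>Z s0. open (N x) \<and> continuous_on U (\<sigma> x) \<and> (\<forall>s\<in>U. Z s \<inter> N x = {\<sigma> x s})) \<and>
    (\<forall>s\<in>U. Z s \<subseteq> (\<Union>x\<in>Z s0. N x))"
proof -
  have fin: "finite (Z s0)" by (rule finite_Z[OF assms])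
  have "\<forall>x. \<exists>d>0. \<forall>y\<in>Z s0. y \<noteq> x \<longrightarrow> d \<le> dist x y" using finite_set_avoid[OF fin] by blast
  from choice[OF this] obtain \<delta> where
    \<delta>: "\<forall>x. 0 < \<delta> x \<and> (\<forall>y\<in>Z s0. y \<noteq> x \<longrightarrow> \<delta> x \<le> dist x y)" ..
  define P where "P x U N \<sigma> \<longleftrightarrow> open U \<and> s0 \<in> U \<and> open N \<and> x \<in> N \<and> N \<subseteq> ball x (\<delta> x / 2) \<and>
    continuous_on U \<sigma> \<and> (\<forall>s\<in>U. Z s \<inter> N = {\<sigma> s})" for x U N \<sigma>
  have "\<forall>x\<in>Z s0. \<exists>U N \<sigma>. P x U N \<sigma>"
    unfolding P_def using \<delta> by (intro ballI local_section assms) auto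
  then obtain U N \<sigma> where P: "\<forall>x\<in>Z s0. P x (U x) (N x) (\<sigma> x)" by metis
  have N: "open (\<Union>x\<in>Z s0. N x)" "Z s0 \<subseteq> (\<Union>x\<in>Z s0. N x)" using P by (auto simp: P_def)
  have "\<exists>e>0. \<forall>s. dist s s0 < e \<longrightarrow> Z s \<subseteq> (\<Union>x\<in>Z s0. N x)"
  proof (rule ccontr)
    assume no: "\<not> ?thesis"
    obtain e R where eR: "e > 0" "\<forall>s x. dist s s0 < e \<longrightarrow> x \<in> Z s \<longrightarrow> norm x \<le> R"
      using zeros_bounded[OF assms] by blast
    have "\<exists>s x. dist s s0 < min e (inverse (Suc m)) \<and> x \<in> Z s \<and> x \<notin> (\<Union>x\<in>Z s0. N x)" for m :: nat
    proof -
      have "min e (inverse (Suc m)) > 0" using eR(1) by simp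
      with no show ?thesis by blast
    qed
    then obtain s x where sx: "\<And>m. dist (s m) s0 < min e (inverse (Suc m))" "\<And>m. x m \<in> Z (s m)"
      "\<And>m. x m \<notin> (\<Union>x\<in>Z s0. N x)" by metis
    have s: "s \<longlonglongrightarrow> s0"
      by (rule metric_tendsto_imp_tendsto[OF LIMSEQ_inverse_real_of_nat])
        (use sx(1) in \<open>auto intro!: always_eventually less_imp_le\<close>)
    have "dist (s m) s0 < e" for m using sx(1)[of m] by simp
    then have "\<forall>m. x m \<in> cball 0 R" using eR(2) sx(2) by auto
    then obtain x0 r where r: "strict_mono r" "(x \<circ> r) \<longlonglongrightarrow> x0"
      using compact_cball[of "0 :: complex ^ 'n" R] unfolding compact_def by metis
    have "x0 \<in> Z s0"
      by (rule limit_of_zeros[OF LIMSEQ_subseq_LIMSEQ[OF s r(1)] r(2)]) (simp add: sx(2))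
    moreover have "closed (- (\<Union>x\<in>Z s0. N x))" using N(1) by (simp only: closed_Compl)
    then have "x0 \<in> - (\<Union>x\<in>Z s0. N x)"
      using closed_sequentially[of "- (\<Union>x\<in>Z s0. N x)" "x \<circ> r" x0] r(2) sx(3) by simp
    ultimately show False using N(2) by blast
  qed
  then obtain e where e: "e > 0" "\<forall>s. dist s s0 < e \<longrightarrow> Z s \<subseteq> (\<Union>x\<in>Z s0. N x)" by blast
  define V where "V = (\<Inter>x\<in>Z s0. U x) \<inter> ball s0 e \<inter> - B"
  have "open V" unfolding V_def using fin P finite_imp_closed[OF finite_B]
    by (intro open_Int open_INT) (auto simp: P_def)
  moreover have "s0 \<in> V" "V \<subseteq> - B" using P e(1) assms by (auto simp: V_def P_def)
  moreover have "disjoint_family_on N (Z s0)"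
    unfolding disjoint_family_on_def
  proof (intro ballI impI equals0I)
    fix x y z assume xy: "x \<in> Z s0" "y \<in> Z s0" "x \<noteq> y" and "z \<in> N x \<inter> N y"
    then have "dist x z < \<delta> x / 2" "dist y z < \<delta> y / 2" using P by (auto simp: P_def subset_eq)
    moreover have "dist x y \<le> dist x z + dist y z" by (rule dist_triangle2)
    moreover have "\<delta> x \<le> dist x y" using \<delta> xy by metis
    moreover have "\<delta> y \<le> dist x y" using \<delta> xy by (metis dist_commute)
    ultimately show False by linarith
  qed
  moreover have "\<forall>x\<in>Z s0. open (N x) \<and> continuous_on V (\<sigma> x) \<and> (\<forall>s\<in>V. Z s \<inter> N x = {\<sigma> x s})"
  proof
    fix x assume x: "x \<in> Z s0"
    then have "V \<subseteq> U x" by (auto simp: V_def)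
    with P x show "open (N x) \<and> continuous_on V (\<sigma> x) \<and> (\<forall>s\<in>V. Z s \<inter> N x = {\<sigma> x s})"
      unfolding P_def by (meson continuous_on_subset subsetD)
  qed
  moreover have "\<forall>s\<in>V. Z s \<subseteq> (\<Union>x\<in>Z s0. N x)"
    using e(2) by (auto simp: V_def dist_commute)
  ultimately show ?thesis by (intro exI[of _ V] exI[of _ N] exI[of _ \<sigma>] conjI)
qed

lemma connected_base: "connected (- B)"
  unfolding Compl_eq_Diff_UNIV
  by (rule connected_open_delete_finite) (simp_all add: connected_UNIV finite_B)

lemma card_Z_constant:
  assumes "s \<notin> B" "s' \<notin> B"
  shows "card (Z s) = card (Z s')"
proof (rule connected_local_const[where f="\<lambda>s. card (Z s)", OF connected_base])
  show "\<forall>s\<in>- B. \<forall>\<^sub>F t in at s within - B. card (Z s) = card (Z t)"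
  proof
    fix s0 assume "s0 \<in> - B"
    then have "s0 \<notin> B" by simp
    from evenly_covered[OF this] obtain U N \<sigma> where
      U: "open U" "s0 \<in> U" "U \<subseteq> - B" "disjoint_family_on N (Z s0)"
      "\<forall>x\<in>Z s0. open (N x) \<and> continuous_on U (\<sigma> x) \<and> (\<forall>s\<in>U. Z s \<inter> N x = {\<sigma> x s})"
      "\<forall>s\<in>U. Z s \<subseteq> (\<Union>x\<in>Z s0. N x)"
      by (elim exE conjE) (rule that)
    have "card (Z s0) = card (Z s)" if "s \<in> U" for s
    proof (rule bij_betw_same_card[of "\<lambda>x. \<sigma> x s"])
      have *: "\<sigma> x s \<in> Z s \<inter> N x" if "x \<in> Z s0" for x using U(5) \<open>s \<in> U\<close> that by simp
      have "inj_on (\<lambda>x. \<sigma> x s) (Z s0)"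
      proof (rule inj_onI, rule ccontr)
        fix x y assume xy: "x \<in> Z s0" "y \<in> Z s0" "\<sigma> x s = \<sigma> y s" "x \<noteq> y"
        then have "N x \<inter> N y = {}" using U(4) by (simp add: disjoint_family_on_def)
        moreover have "\<sigma> x s \<in> N x" "\<sigma> x s \<in> N y" using *[OF xy(1)] *[OF xy(2)] xy(3) by auto
        ultimately show False by blast
      qed
      moreover have "(\<lambda>x. \<sigma> x s) ` Z s0 = Z s"
      proof
        show "(\<lambda>x. \<sigma> x s) ` Z s0 \<subseteq> Z s" using * by blast
        show "Z s \<subseteq> (\<lambda>x. \<sigma> x s) ` Z s0"
        proof
          fix y assume "y \<in> Z s"
          then obtain x where "x \<in> Z s0" "y \<in> Z s \<inter> N x" using U(6) \<open>s \<in> U\<close> by blast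
          with U(5) \<open>s \<in> U\<close> show "y \<in> (\<lambda>x. \<sigma> x s) ` Z s0" by auto
        qed
      qed
      ultimately show "bij_betw (\<lambda>x. \<sigma> x s) (Z s0) (Z s)" by (simp add: bij_betw_def)
    qed
    with U(1,2) show "\<forall>\<^sub>F t in at s0 within - B. card (Z s0) = card (Z t)"
      unfolding eventually_at_topological by blast
  qed
qed (use assms in auto)

lemma covering:
  assumes "s1 \<notin> B" "Z s1 \<noteq> {}"
  shows "covering_space (SIGMA s:- B. Z s) fst (- B)"
proof
  show "continuous_on (SIGMA s:- B. Z s) fst" by (intro continuous_intros)
  have "Z s \<noteq> {}" if "s \<notin> B" for s
    using card_Z_constant[OF that assms(1)] finite_Z[OF assms(1)] assms(2) by auto
  then show "fst ` (SIGMA s:- B. Z s) = - B" by force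
  fix s0 assume "s0 \<in> - B"
  then have "s0 \<notin> B" by simp
  from evenly_covered[OF this] obtain U N \<sigma> where
    U: "open U" "s0 \<in> U" "U \<subseteq> - B" "disjoint_family_on N (Z s0)"
    "\<forall>x\<in>Z s0. open (N x) \<and> continuous_on U (\<sigma> x) \<and> (\<forall>s\<in>U. Z s \<inter> N x = {\<sigma> x s})"
    "\<forall>s\<in>U. Z s \<subseteq> (\<Union>x\<in>Z s0. N x)"
    by (elim exE conjE) (rule that)
  let ?C = "SIGMA s:- B. Z s"
  define v where "v = (\<lambda>x. ?C \<inter> U \<times> N x) ` Z s0"
  have "\<Union>v = ?C \<inter> fst -` U" using U(6) by (fastforce simp: v_def)
  moreover have "\<forall>u\<in>v. openin (top_of_set ?C) u"
    using U(1,5) by (auto simp: v_def intro!: openin_open_Int open_Times)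
  moreover have "pairwise disjnt v"
    using U(4) by (fastforce simp: v_def pairwise_def disjnt_def disjoint_family_on_def)
  moreover have "\<exists>q. homeomorphism u U fst q" if u: "u \<in> v" for u
  proof -
    from u obtain x where x: "x \<in> Z s0" and u: "u = ?C \<inter> U \<times> N x" by (auto simp: v_def)
    have mem: "u = (\<lambda>s. (s, \<sigma> x s)) ` U"
      using U(5) x U(3) unfolding u by (auto simp: set_eq_iff)
    have c: "continuous_on U (\<sigma> x)" using U(5) x by blast
    have "homeomorphism u U fst (\<lambda>s. (s, \<sigma> x s))"
      unfolding mem by (intro homeomorphismI continuous_intros c) auto
    then show ?thesis by (rule exI[where x="\<lambda>s. (s, \<sigma> x s)"])
  qed
  moreover have "openin (top_of_set (- B)) U" using U(1,3) by (simp add: open_subset)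
  ultimately show "\<exists>T. s0 \<in> T \<and> openin (top_of_set (- B)) T \<and> (\<exists>v. \<Union>v = ?C \<inter> fst -` T \<and>
      (\<forall>u\<in>v. openin (top_of_set ?C) u) \<and> pairwise disjnt v \<and> (\<forall>u\<in>v. \<exists>q. homeomorphism u T fst q))"
    using U(2) by (intro exI[of _ U] conjI exI[of _ v]) auto
qed

lemma zero_path_lift:
  assumes g: "continuous_on {0..1} g" "g ` {0..1} \<subseteq> - B" and x1: "x1 \<in> Z (g (1::real))"
  shows "\<exists>x. continuous_on {0..1} x \<and> (\<forall>t\<in>{0..1}. x t \<in> Z (g t)) \<and> x 1 = x1"
proof -
  have "g 1 \<in> g ` {0..1}" by (rule imageI) simp
  with g(2) have "g 1 \<notin> B" by blast
  then have cov: "covering_space (SIGMA s:- B. Z s) fst (- B)" using x1 by (intro covering) auto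
  have mem: "(g 1, x1) \<in> (SIGMA s:- B. Z s)" using \<open>g 1 \<notin> B\<close> x1 by simp
  have "path (reversepath g)" "path_image (reversepath g) \<subseteq> - B"
    using g unfolding path_reversepath path_image_reversepath by (simp_all add: path_def path_image_def)
  moreover have "pathstart (reversepath g) = fst (g 1, x1)" by (simp add: pathfinish_def)
  ultimately have "\<exists>h. path h \<and> path_image h \<subseteq> (SIGMA s:- B. Z s) \<and>
    pathstart h = (g 1, x1) \<and> (\<forall>t\<in>{0..1}. fst (h t) = reversepath g t)"
    by (rule covering_space_lift_path_strong[OF cov mem, of "reversepath g"])
      (intro exI conjI ballI, assumption+)
  then obtain h where h: "path h" "path_image h \<subseteq> (SIGMA s:- B. Z s)"
    "pathstart h = (g 1, x1)" "\<forall>t\<in>{0..1}. fst (h t) = reversepath g t" by blast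
  have 1: "continuous_on {0..1} (\<lambda>t. snd (h (1 - t)))"
  proof (rule continuous_on_snd, rule continuous_on_compose2[of "{0..1}" h])
    show "continuous_on {0..1} h" using h(1) by (simp add: path_def)
    show "continuous_on {0..1} (\<lambda>t::real. 1 - t)" by (intro continuous_intros)
  qed auto
  have 2: "snd (h (1 - t)) \<in> Z (g t)" if t: "t \<in> {0..1}" for t
  proof -
    have t': "1 - t \<in> {0..1}" using t by auto
    then have "h (1 - t) \<in> (SIGMA s:- B. Z s)" using h(2) unfolding path_image_def by blast
    moreover have "fst (h (1 - t)) = g t" using bspec[OF h(4) t'] by (simp add: reversepath_def)
    ultimately show ?thesis by (auto simp: mem_Sigma_iff)
  qed
  show ?thesis
    using 1 2 h(3) by (intro exI[of _ "\<lambda>t. snd (h (1 - t))"]) (auto simp: pathstart_def)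
qed

end


section \<open>Polynomial functions on affine space\<close>

definition monomial_at :: "('k \<Rightarrow>\<^sub>0 nat) \<Rightarrow> ('k \<Rightarrow> 'a::comm_semiring_1) \<Rightarrow> 'a" where
  "monomial_at m a = (\<Prod>k\<in>Poly_Mapping.keys m. a k ^ Poly_Mapping.lookup m k)"

lemma mon_superset:
  "finite K \<Longrightarrow> Poly_Mapping.keys m \<subseteq> K \<Longrightarrow> monomial_at m a = (\<Prod>k\<in>K. a k ^ Poly_Mapping.lookup m k)"
  unfolding monomial_at_def by (rule prod.mono_neutral_left) (auto simp: in_keys_iff)

lemma mon_add: "monomial_at (m + n) a = monomial_at m a * monomial_at n a"
proof -
  let ?K = "Poly_Mapping.keys m \<union> Poly_Mapping.keys n"
  have "monomial_at (m + n) a = (\<Prod>k\<in>?K. a k ^ Poly_Mapping.lookup (m + n) k)"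
    by (rule mon_superset) (use keys_add[of m n] in auto)
  also have "\<dots> = monomial_at m a * monomial_at n a"
    by (simp add: lookup_add power_add prod.distrib mon_superset[of ?K m] mon_superset[of ?K n])
  finally show ?thesis .
qed

lemma mpoly_at_superset:
  "finite K \<Longrightarrow> Poly_Mapping.keys p \<subseteq> K \<Longrightarrow>
    mpoly_at p a = (\<Sum>m\<in>K. Poly_Mapping.lookup p m * monomial_at m a)"
  unfolding mpoly_at_def monomial_at_def by (rule sum.mono_neutral_left) (auto simp: in_keys_iff)

lemma mpoly_at_add: "mpoly_at (p + q) a = mpoly_at p a + mpoly_at q a"
proof -
  let ?K = "Poly_Mapping.keys p \<union> Poly_Mapping.keys q"
  have "mpoly_at (p + q) a = (\<Sum>m\<in>?K. Poly_Mapping.lookup (p + q) m * monomial_at m a)"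
    by (rule mpoly_at_superset) (use keys_add[of p q] in auto)
  also have "\<dots> = mpoly_at p a + mpoly_at q a"
    by (simp add: lookup_add distrib_right sum.distrib mpoly_at_superset[of ?K p] mpoly_at_superset[of ?K q])
  finally show ?thesis .
qed

lemma mpoly_at_eq: "mpoly_at p a = (\<Sum>m\<in>Poly_Mapping.keys p. Poly_Mapping.lookup p m * monomial_at m a)"
  by (rule mpoly_at_superset) auto

lemma mpoly_at_zero: "mpoly_at 0 a = 0"
  by (simp add: mpoly_at_def)

lemma mpoly_at_sum: "mpoly_at (\<Sum>i\<in>S. p i) a = (\<Sum>i\<in>S. mpoly_at (p i) a)"
  by (induction S rule: infinite_finite_induct) (auto simp: mpoly_at_add mpoly_at_zero)

lemma mpoly_at_single: "mpoly_at (Poly_Mapping.single m c) a = c * monomial_at m a"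
  by (subst mpoly_at_superset[of "{m}"]) auto

lemma sum_singles: "(\<Sum>m\<in>Poly_Mapping.keys p. Poly_Mapping.single m (Poly_Mapping.lookup p m)) = p"
proof (rule poly_mapping_eqI)
  fix k
  show "Poly_Mapping.lookup (\<Sum>m\<in>Poly_Mapping.keys p.
      Poly_Mapping.single m (Poly_Mapping.lookup p m)) k = Poly_Mapping.lookup p k"
    by (cases "k \<in> Poly_Mapping.keys p")
      (auto simp: lookup_sum lookup_single when_def in_keys_iff)
qed

lemma mpoly_at_mult: "mpoly_at (p * q) a = mpoly_at p a * mpoly_at q a"
proof -
  have "p * q = (\<Sum>m\<in>Poly_Mapping.keys p. \<Sum>n\<in>Poly_Mapping.keys q.
      Poly_Mapping.single (m + n) (Poly_Mapping.lookup p m * Poly_Mapping.lookup q n))"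
    by (subst (1) sum_singles[of p, symmetric], subst (1) sum_singles[of q, symmetric])
      (simp add: sum_product mult_single)
  then have "mpoly_at (p * q) a = (\<Sum>m\<in>Poly_Mapping.keys p. \<Sum>n\<in>Poly_Mapping.keys q.
      (Poly_Mapping.lookup p m * monomial_at m a) * (Poly_Mapping.lookup q n * monomial_at n a))"
    by (simp add: mpoly_at_sum mpoly_at_single mon_add mult_ac)
  also have "\<dots> = mpoly_at p a * mpoly_at q a"
    by (simp add: mpoly_at_def monomial_at_def sum_product)
  finally show ?thesis .
qed

text \<open>
  The coordinate ring of the affine space with coordinates indexed by \<open>I\<close>, as a set of functions. Proving it to be a
  \<^locale>\<open>coeff_ring\<close> is what allows the hypersurface found by elimination to
  be read as a subvariety.
\<close>

definition mpoly_funs :: "'k set \<Rightarrow> (('k \<Rightarrow> complex) \<Rightarrow> complex) set" where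
  "mpoly_funs I = {mpoly_at p | p. \<forall>m\<in>Poly_Mapping.keys p. Poly_Mapping.keys m \<subseteq> I}"

interpretation mpoly_funs: coeff_ring "mpoly_funs I"
proof
  show "(\<lambda>_. c) \<in> mpoly_funs I" for c
  proof -
    have "mpoly_at (Poly_Mapping.single 0 c) = (\<lambda>_. c)"
      by (rule ext) (simp add: mpoly_at_single monomial_at_def)
    from this[symmetric] show ?thesis unfolding mpoly_funs_def
      by (intro CollectI exI[of _ "Poly_Mapping.single 0 c"] conjI) auto
  qed
next
  fix a b assume "a \<in> mpoly_funs I" "b \<in> mpoly_funs I"
  then obtain p q where p: "a = mpoly_at p" "\<forall>m\<in>Poly_Mapping.keys p. Poly_Mapping.keys m \<subseteq> I"
    and q: "b = mpoly_at q" "\<forall>m\<in>Poly_Mapping.keys q. Poly_Mapping.keys m \<subseteq> I"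
    by (auto simp: mpoly_funs_def)
  have "\<forall>m\<in>Poly_Mapping.keys (p + q). Poly_Mapping.keys m \<subseteq> I"
    using p q keys_add[of p q] by blast
  then show "(\<lambda>x. a x + b x) \<in> mpoly_funs I"
    using p q by (auto simp: mpoly_funs_def mpoly_at_add intro!: exI[of _ "p + q"])
  have "\<forall>m\<in>Poly_Mapping.keys (p * q). Poly_Mapping.keys m \<subseteq> I"
  proof
    fix m assume "m \<in> Poly_Mapping.keys (p * q)"
    then obtain m1 m2 where "m = m1 + m2" "m1 \<in> Poly_Mapping.keys p" "m2 \<in> Poly_Mapping.keys q"
      using keys_mult[of p q] by blast
    with p(2) q(2) keys_add[of m1 m2] show "Poly_Mapping.keys m \<subseteq> I" by blast
  qed
  then show "(\<lambda>x. a x * b x) \<in> mpoly_funs I"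
    using p q by (auto simp: mpoly_funs_def mpoly_at_mult intro!: exI[of _ "p * q"])
qed

lemma coordinate_in_mpoly_funs: "k \<in> I \<Longrightarrow> (\<lambda>a. a k) \<in> mpoly_funs I"
proof -
  assume "k \<in> I"
  have "mpoly_at (Poly_Mapping.single (Poly_Mapping.single k 1) 1) = (\<lambda>a. a k)"
    by (rule ext) (simp add: mpoly_at_single monomial_at_def)
  from this[symmetric] \<open>k \<in> I\<close> show ?thesis unfolding mpoly_funs_def
    by (intro CollectI exI[of _ "Poly_Mapping.single (Poly_Mapping.single k 1) 1"] conjI) auto
qed

lemma proper_subvarietyI:
  assumes "\<Delta> \<in> mpoly_funs I" "\<Delta> a \<noteq> 0" "a \<in> I \<rightarrow>\<^sub>E UNIV"
  shows "proper_subvariety I {a \<in> I \<rightarrow>\<^sub>E UNIV. \<Delta> a = 0}"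
proof -
  obtain p where "\<Delta> = mpoly_at p" "\<forall>m\<in>Poly_Mapping.keys p. Poly_Mapping.keys m \<subseteq> I"
    using assms(1) by (auto simp: mpoly_funs_def)
  then have "subvariety I {a \<in> I \<rightarrow>\<^sub>E UNIV. \<Delta> a = 0}"
    unfolding subvariety_def by (intro exI[of _ "{p}"]) auto
  with assms(2,3) show ?thesis by (auto simp: proper_subvariety_def)
qed

interpretation univariate: coeff_ring "range (poly :: complex poly \<Rightarrow> complex \<Rightarrow> complex)"
proof
  show "(\<lambda>_. c) \<in> range poly" for c :: complex
    by (rule range_eqI[of _ _ "[:c:]"]) auto
  fix a b :: "complex \<Rightarrow> complex"
  assume "a \<in> range poly" "b \<in> range poly"
  then obtain p q where "a = poly p" "b = poly q" by blast
  then have "(\<lambda>x. a x + b x) = poly (p + q)" "(\<lambda>x. a x * b x) = poly (p * q)" by auto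
  then show "(\<lambda>x. a x + b x) \<in> range poly" "(\<lambda>x. a x * b x) \<in> range poly"
    by (metis rangeI)+
qed

lemma mpoly_fun_on_line:
  assumes "\<Delta> \<in> mpoly_funs I"
  shows "\<exists>P. \<forall>s. \<Delta> (\<lambda>k. a k + s * (b k - a k)) = poly P s"
proof -
  obtain p where p: "\<Delta> = mpoly_at p" using assms by (auto simp: mpoly_funs_def)
  let ?P = "\<Sum>m\<in>Poly_Mapping.keys p. [:Poly_Mapping.lookup p m:] *
    (\<Prod>k\<in>Poly_Mapping.keys m. [:a k, b k - a k:] ^ Poly_Mapping.lookup m k)"
  have "\<Delta> (\<lambda>k. a k + s * (b k - a k)) = poly ?P s" for s
    by (simp add: p mpoly_at_def poly_sum poly_prod)
  then show ?thesis by (intro exI[of _ ?P] allI)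
qed

text \<open>
  On the line joining \<open>a\<close> and \<open>b\<close> both functions are nonzero polynomials in one variable, so they have finitely many roots.
\<close>

lemma mpoly_funs_no_zero_divisors:
  assumes "\<Delta> \<in> mpoly_funs I" "\<Delta>' \<in> mpoly_funs I" "\<Delta> a \<noteq> 0" "\<Delta>' b \<noteq> 0"
  shows "\<exists>c. \<Delta> c \<noteq> 0 \<and> \<Delta>' c \<noteq> 0"
proof -
  obtain P where P: "\<forall>s. \<Delta> (\<lambda>k. a k + s * (b k - a k)) = poly P s"
    using mpoly_fun_on_line[OF assms(1)] by blast
  obtain P' where P': "\<forall>s. \<Delta>' (\<lambda>k. a k + s * (b k - a k)) = poly P' s"
    using mpoly_fun_on_line[OF assms(2)] by blast
  have "P \<noteq> 0" using spec[OF P, of 0] assms(3) by auto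
  moreover have "P' \<noteq> 0" using spec[OF P', of 1] assms(4) by auto
  ultimately have "finite {s. poly (P * P') s = 0}" by (intro poly_roots_finite) simp
  then obtain s where "poly (P * P') s \<noteq> 0"
    using infinite_UNIV_char_0[where 'a=complex] by (metis (mono_tags, lifting) UNIV_eq_I mem_Collect_eq)
  then show ?thesis using P P' by (metis mult_eq_0_iff poly_mult)
qed

lemma mpoly_funs_cong:
  assumes "\<Delta> \<in> mpoly_funs I" "\<And>k. k \<in> I \<Longrightarrow> a k = b k"
  shows "\<Delta> a = \<Delta> b"
proof -
  obtain p where p: "\<Delta> = mpoly_at p" "\<forall>m\<in>Poly_Mapping.keys p. Poly_Mapping.keys m \<subseteq> I"
    using assms(1) by (auto simp: mpoly_funs_def)
  have "a k = b k" if "m \<in> Poly_Mapping.keys p" "k \<in> Poly_Mapping.keys m" for m k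
    using assms(2) p(2) that by blast
  then show ?thesis
    unfolding p(1) mpoly_at_def by (intro sum.cong arg_cong2[of _ _ _ _ times] prod.cong refl) simp
qed

section \<open>Homogenised Lagrange and start systems\<close>

text \<open>
  The form of degree \<open>d\<close> belonging to the polynomial with coefficients \<open>\<alpha>\<close>. Coefficients of monomials of
  higher degree are ignored, which lets \<open>\<alpha>\<close> range over arbitrary points of the parameter space.
\<close>

definition homogenise :: "nat \<Rightarrow> (('n::finite \<Rightarrow>\<^sub>0 nat) \<Rightarrow> complex) \<Rightarrow> ('n option \<Rightarrow> complex) \<Rightarrow> complex" where
  "homogenise d \<alpha> X = (\<Sum>m | mdegree m \<le> d. \<alpha> m * (monomial_at m (\<lambda>i. X (Some i)) * X None ^ (d - mdegree m)))"

lemma mdegree_alt: "mdegree m = (\<Sum>k\<in>UNIV. Poly_Mapping.lookup m (k :: 'n::finite))"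
  unfolding mdegree_def by (rule sum.mono_neutral_left) (auto simp: in_keys_iff)

lemma finite_mdegree_le: "finite {m :: 'n::finite \<Rightarrow>\<^sub>0 nat. mdegree m \<le> d}"
proof (rule finite_imageD)
  show "inj_on Poly_Mapping.lookup {m :: 'n \<Rightarrow>\<^sub>0 nat. mdegree m \<le> d}"
    by (auto intro: inj_onI poly_mapping_eqI)
  have "Poly_Mapping.lookup m k \<le> d" if "mdegree m \<le> d" for m :: "'n \<Rightarrow>\<^sub>0 nat" and k
    using that member_le_sum[of k UNIV "Poly_Mapping.lookup m"] by (simp add: mdegree_alt)
  then have "Poly_Mapping.lookup ` {m :: 'n \<Rightarrow>\<^sub>0 nat. mdegree m \<le> d} \<subseteq> UNIV \<rightarrow>\<^sub>E {..d}"
    by (auto simp: PiE_def)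
  then show "finite (Poly_Mapping.lookup ` {m :: 'n \<Rightarrow>\<^sub>0 nat. mdegree m \<le> d})"
    by (rule finite_subset) (intro finite_PiE, auto)
qed

lemma mon_UNIV: "monomial_at m a = (\<Prod>k\<in>UNIV. a k ^ Poly_Mapping.lookup m (k :: 'n::finite))"
  by (rule mon_superset) auto

lemma hom_hform:
  fixes c :: "('n::finite \<Rightarrow>\<^sub>0 nat) \<Rightarrow> 'p \<Rightarrow> complex"
  assumes "coeff_ring A" "\<And>m. mdegree m \<le> d \<Longrightarrow> c m \<in> A"
  shows "hom_family A d (\<lambda>p. homogenise d (\<lambda>m. c m p))"
proof -
  interpret coeff_ring A by fact
  have "hom_family A d (\<lambda>p X. c m p * (monomial_at m (\<lambda>i. X (Some i)) * X None ^ (d - mdegree m)))"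
    if "mdegree m \<le> d" for m
  proof (rule hom_scale[OF assms(2)[OF that] hom_mult_eq[OF _ hom_var_power]])
    show "hom_family A (mdegree m) (\<lambda>p X. monomial_at m (\<lambda>i. X (Some i)))"
      unfolding mon_UNIV mdegree_alt
      by (rule hom_prod[where k="Poly_Mapping.lookup m"]) (auto intro: hom_var_power)
  qed (use that in simp)
  then show ?thesis unfolding homogenise_def[abs_def] by (intro hom_sum) auto
qed

lemma hform_add: "homogenise d (\<lambda>m. \<alpha> m + \<beta> m) X = homogenise d \<alpha> X + homogenise d \<beta> X"
  by (simp add: homogenise_def distrib_right sum.distrib)

lemma hform_diff: "homogenise d (\<lambda>m. \<alpha> m - \<beta> m) X = homogenise d \<alpha> X - homogenise d \<beta> X"
  by (simp add: homogenise_def left_diff_distrib sum_subtractf)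

lemma hform_cmult: "homogenise d (\<lambda>m. c * \<alpha> m) X = c * homogenise d \<alpha> X"
  by (simp add: homogenise_def sum_distrib_left mult.assoc)

lemma hform_sum: "homogenise d (\<lambda>m. \<Sum>i\<in>S. \<alpha> i m) X = (\<Sum>i\<in>S. homogenise d (\<alpha> i) X)"
  unfolding homogenise_def sum_distrib_right by (rule sum.swap)

lemma hform_monomial:
  "mdegree n \<le> d \<Longrightarrow> homogenise d (\<lambda>m. if m = n then 1 else 0) X =
    monomial_at n (\<lambda>i. X (Some i)) * X None ^ (d - mdegree n)"
  by (simp add: homogenise_def if_distrib[of "\<lambda>x. x * _"] sum.delta[OF finite_mdegree_le] cong: if_cong)

lemma hform_cong: "(\<And>m. mdegree m \<le> d \<Longrightarrow> \<alpha> m = \<beta> m) \<Longrightarrow> homogenise d \<alpha> = homogenise d \<beta>"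
  by (rule ext) (auto simp: homogenise_def intro!: sum.cong)

lemma hform_dehomogenise:
  assumes "\<And>m. m \<in> Poly_Mapping.keys p \<Longrightarrow> mdegree m \<le> d"
  shows "homogenise d (Poly_Mapping.lookup p) (case_option 1 y) = mpoly_at p y"
  by (subst mpoly_at_superset[OF finite_mdegree_le[of d]]) (use assms in \<open>auto simp: homogenise_def\<close>)

lemma mon_derivative:
  "((\<lambda>z. monomial_at m (y(i := z))) has_field_derivative
    of_nat (Poly_Mapping.lookup m i) * monomial_at (m - Poly_Mapping.single i 1) y) (at (y i))"
  for y :: "'n::finite \<Rightarrow> complex"
proof -
  let ?r = "\<Prod>k\<in>-{i}. y k ^ Poly_Mapping.lookup m k"
  let ?m' = "m - Poly_Mapping.single i (1::nat)"
  have split: "monomial_at n x = x i ^ Poly_Mapping.lookup n i * (\<Prod>k\<in>-{i}. x k ^ Poly_Mapping.lookup n k)"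
    for n and x :: "'n \<Rightarrow> complex"
    unfolding mon_UNIV by (subst prod.remove[of _ i]) (auto simp: Compl_eq_Diff_UNIV)
  have "Poly_Mapping.lookup ?m' k = Poly_Mapping.lookup m k - (if k = i then 1 else 0)" for k
    by (simp add: minus_poly_mapping.rep_eq lookup_single when_def)
  then have m': "monomial_at ?m' y = y i ^ (Poly_Mapping.lookup m i - 1) * ?r"
    by (subst split) auto
  have "monomial_at m (y(i := z)) = z ^ Poly_Mapping.lookup m i * ?r" for z
    by (subst split) auto
  then show ?thesis
    unfolding m' by (auto intro!: derivative_eq_intros)
qed

lemma mpoly_at_mpderiv: "mpoly_at (mpderiv i p) y = (\<Sum>m\<in>Poly_Mapping.keys p.
    Poly_Mapping.lookup p m * (of_nat (Poly_Mapping.lookup m i) * monomial_at (m - Poly_Mapping.single i 1) y))"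
  by (simp add: mpderiv_def mpoly_at_sum mpoly_at_single mult_ac)

lemma pd_hform:
  assumes "\<And>m. m \<in> Poly_Mapping.keys p \<Longrightarrow> mdegree m \<le> d"
  shows "partial (Some i) (homogenise d (Poly_Mapping.lookup p)) (case_option 1 y) = mpoly_at (mpderiv i p) y"
proof (rule pd_eqI)
  have "(case_option 1 y)(Some i := z) = case_option 1 (y(i := z))" for z
    by (rule ext) (auto split: option.split)
  moreover have "((\<lambda>z. mpoly_at p (y(i := z))) has_field_derivative mpoly_at (mpderiv i p) y) (at (y i))"
    unfolding mpoly_at_mpderiv mpoly_at_eq[of p]
    by (intro DERIV_sum DERIV_cmult mon_derivative)
  ultimately show "((\<lambda>z. homogenise d (Poly_Mapping.lookup p) ((case_option 1 y)(Some i := z)))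
      has_field_derivative mpoly_at (mpderiv i p) y) (at (case_option 1 y (Some i)))"
    using hform_dehomogenise[OF assms] by simp
qed

definition degrees :: "'n \<Rightarrow> nat \<Rightarrow> 'n \<Rightarrow> nat" where
  "degrees i1 d i = (if i = i1 then d else d - 1)"

text \<open>
  The systems with the multiplier eliminated. The equation for the index \<open>i1\<close> would be trivial; its place is taken by the constraint.
\<close>

definition lagrange_forms :: "'n::finite \<Rightarrow> nat \<Rightarrow> ('n \<Rightarrow> complex) \<Rightarrow> (('n \<Rightarrow>\<^sub>0 nat) \<Rightarrow> complex) \<Rightarrow>
    'n \<Rightarrow> ('n option \<Rightarrow> complex) \<Rightarrow> complex" where
  "lagrange_forms i1 d u \<alpha> i = (if i = i1 then homogenise d \<alpha> else
     (\<lambda>X. u i1 * partial (Some i) (homogenise d \<alpha>) X - u i * partial (Some i1) (homogenise d \<alpha>) X))"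

definition start_forms :: "'n::finite \<Rightarrow> nat \<Rightarrow> ('n \<Rightarrow> complex) \<Rightarrow> ('n option \<Rightarrow> complex) \<Rightarrow>
    'n \<Rightarrow> ('n option \<Rightarrow> complex) \<Rightarrow> complex" where
  "start_forms i1 d u c i = (if i = i1 then (\<lambda>X. c None * X None ^ d + c (Some i1) * X (Some i1) ^ d) else
     (\<lambda>X. u i1 * (of_nat d * c (Some i)) * X (Some i) ^ (d - 1) -
          u i * (of_nat d * c (Some i1)) * X (Some i1) ^ (d - 1)))"

text \<open>
  Only the identity contributes: a permutation that moves no index except to \<open>i1\<close> moves none.
\<close>

lemma det_diagonal_plus_column:
  fixes M :: "complex ^ 'n ^ 'n"
  assumes "\<And>i j. i \<noteq> j \<Longrightarrow> j \<noteq> i1 \<Longrightarrow> M $ i $ j = 0"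
  shows "det M = (\<Prod>i\<in>UNIV. M $ i $ i)"
proof -
  have "(\<Prod>i\<in>UNIV. M $ i $ \<pi> i) = 0" if "\<pi> permutes UNIV" "\<pi> \<noteq> id" for \<pi>
  proof -
    have "\<exists>i. \<pi> i \<noteq> i \<and> \<pi> i \<noteq> i1"
    proof (rule ccontr)
      assume no: "\<not> ?thesis"
      have "\<pi> i = i" for i
      proof (cases "i = i1")
        case True with no show ?thesis by metis
      next
        case False
        with no permutes_inj[OF that(1)] show ?thesis by (metis injD)
      qed
      with that(2) show False by (simp add: fun_eq_iff)
    qed
    with assms show ?thesis by (metis (no_types, lifting) UNIV_I finite prod_zero)
  qed
  then have "det M = (\<Sum>\<pi>\<in>{id}. of_int (sign \<pi>) * (\<Prod>i\<in>UNIV. M $ i $ \<pi> i))"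
    unfolding det_def by (intro sum.mono_neutral_right) (auto simp: permutes_id)
  then show ?thesis by (simp add: sign_id)
qed

lemma pd_diff_powers:
  "partial v (\<lambda>X. a * X w ^ k - b * X w' ^ k) X =
    (if w = v then a * (of_nat k * X w ^ (k - 1)) else 0) - (if w' = v then b * (of_nat k * X w' ^ (k - 1)) else 0)"
  by (rule pd_eqI) (auto intro!: derivative_eq_intros)

lemma sum_degs: "(\<Sum>i\<in>UNIV. degrees i1 d i - 1) = (d - 1) + card (- {i1}) * (d - 2)" for i1 :: "'n::finite"
proof -
  have "(\<Sum>i\<in>UNIV. degrees i1 d i - 1) = (degrees i1 d i1 - 1) + (\<Sum>i\<in>-{i1}. degrees i1 d i - 1)"
    by (subst sum.remove[of _ i1]) (auto simp: Compl_eq_Diff_UNIV)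
  also have "(\<Sum>i\<in>-{i1}. degrees i1 d i - 1) = (\<Sum>i\<in>-{i1}. d - 2)"
    by (intro sum.cong) (auto simp: degrees_def)
  finally show ?thesis by (simp only: degrees_def if_True refl sum_constant of_nat_id)
qed

lemma jac_sform:
  fixes i1 :: "'n::finite"
  shows "jacobian (start_forms i1 d u c) X = (of_nat d * c (Some i1)) * X (Some i1) ^ (d - 1) *
    (\<Prod>i\<in>-{i1}. u i1 * (of_nat d * c (Some i)) * of_nat (d - 1)) * (\<Prod>i\<in>-{i1}. X (Some i) ^ (d - 2))"
proof -
  let ?M = "(\<chi> i j. partial (Some j) (start_forms i1 d u c i) X) :: complex ^ 'n ^ 'n"
  have h: "partial (Some j) (start_forms i1 d u c i1) X =
    (if j = i1 then of_nat d * c (Some i1) * X (Some i1) ^ (d - 1) else 0)" for j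
    unfolding start_forms_def by (rule pd_eqI) (auto intro!: derivative_eq_intros)
  have q: "partial (Some j) (start_forms i1 d u c i) X =
    (if i = j then u i1 * (of_nat d * c (Some i)) * (of_nat (d - 1) * X (Some i) ^ (d - 1 - 1)) else 0) -
    (if i1 = j then u i * (of_nat d * c (Some i1)) * (of_nat (d - 1) * X (Some i1) ^ (d - 1 - 1)) else 0)"
    if "i \<noteq> i1" for i j
    using that by (simp add: start_forms_def pd_diff_powers)
  have "det ?M = (\<Prod>i\<in>UNIV. ?M $ i $ i)"
  proof (rule det_diagonal_plus_column[of i1])
    fix i j assume "i \<noteq> j" "j \<noteq> i1"
    then show "?M $ i $ j = 0" by (cases "i = i1") (auto simp: h q)
  qed
  also have "\<dots> = ?M $ i1 $ i1 * (\<Prod>i\<in>-{i1}. ?M $ i $ i)"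
    by (subst prod.remove[of _ i1]) (auto simp: Compl_eq_Diff_UNIV)
  also have "(\<Prod>i\<in>-{i1}. ?M $ i $ i) =
      (\<Prod>i\<in>-{i1}. (u i1 * (of_nat d * c (Some i)) * of_nat (d - 1)) * X (Some i) ^ (d - 2))"
    by (intro prod.cong refl) (auto simp: q numeral_2_eq_2)
  finally show ?thesis by (simp add: jacobian_def h prod.distrib mult_ac)
qed

lemma start_in_radical:
  fixes i1 :: "'n::finite"
  assumes d: "d \<ge> 2" and u: "\<And>i. u i \<noteq> 0" and c: "\<And>k. c k \<noteq> 0"
  shows "\<exists>K. idl (critical_gens (degrees i1 d) (d - 1) (start_forms i1 d u c)
    (\<lambda>X. of_nat d * c (Some i1) * X (Some i1) ^ (d - 1))) K (\<lambda>X. X v ^ K)"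
proof (rule start_base[OF d, where ?c0.0="c None" and ?c1.0="c (Some i1)"
      and a="\<lambda>i. u i1 * (of_nat d * c (Some i))" and b="\<lambda>i. u i * (of_nat d * c (Some i1))"])
  let ?critical_gens = "critical_gens (degrees i1 d) (d - 1) (start_forms i1 d u c) (\<lambda>X. of_nat d * c (Some i1) * X (Some i1) ^ (d - 1))"
  have gen: "(degrees i1 d i, start_forms i1 d u c i) \<in> ?critical_gens" for i by (auto simp: critical_gens_def)
  show "(d, \<lambda>X. c None * X None ^ d + c (Some i1) * X (Some i1) ^ d) \<in> ?critical_gens"
    using gen[of i1] by (simp add: degrees_def start_forms_def)
  show "(d - 1, \<lambda>X. u i1 * (of_nat d * c (Some i)) * X (Some i) ^ (d - 1) -
      u i * (of_nat d * c (Some i1)) * X (Some i1) ^ (d - 1)) \<in> ?critical_gens" if "i \<noteq> i1" for i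
    using gen[of i] that by (simp add: degrees_def start_forms_def)
  let ?C = "(of_nat d * c (Some i1)) * (of_nat d * c (Some i1)) *
    (\<Prod>i\<in>-{i1}. u i1 * (of_nat d * c (Some i)) * of_nat (d - 1))"
  have "X None * (of_nat d * c (Some i1) * X (Some i1) ^ (d - 1)) * jacobian (start_forms i1 d u c) X =
    ?C * (X None * X (Some i1) ^ (2 * (d - 1)) * (\<Prod>i\<in>-{i1}. X (Some i) ^ (d - 2)))" for X
    unfolding jac_sform mult_2 power_add by (simp only: mult_ac)
  moreover have "1 + (d - 1) + (\<Sum>i\<in>UNIV. degrees i1 d i - 1) = 1 + 2 * (d - 1) + card (- {i1}) * (d - 2)"
    unfolding sum_degs by simp
  ultimately show "(1 + 2 * (d - 1) + card (- {i1}) * (d - 2),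
      \<lambda>X. ?C * (X None * X (Some i1) ^ (2 * (d - 1)) * (\<Prod>i\<in>-{i1}. X (Some i) ^ (d - 2)))) \<in> ?critical_gens"
    unfolding critical_gens_def by (simp only: insert_iff simp_thms)
  show "?C \<noteq> 0" using d u c by simp
qed (use d u c in auto)

text \<open>
  The coefficients of \<open>x 1 ^ d + C + (\<Sum>i. x i ^ d - d * x i)\<close>, the sum ranging over the indices other than \<open>i1\<close>, with
  the constant \<open>C\<close> required by \<open>lagrange_base\<close>.
\<close>

definition base_coefficients :: "'n::finite \<Rightarrow> nat \<Rightarrow> ('n \<Rightarrow>\<^sub>0 nat) \<Rightarrow> complex" where
  "base_coefficients i1 d m = (if m = Poly_Mapping.single i1 d then 1 else 0) +
     of_nat (d - 1) * of_nat (card (- {i1}) + 1) * (if m = 0 then 1 else 0) +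
     (\<Sum>i\<in>-{i1}. (if m = Poly_Mapping.single i d then 1 else 0) -
        of_nat d * (if m = Poly_Mapping.single i 1 then 1 else 0))"

lemma hform_base_coeff:
  fixes i1 :: "'n::finite"
  assumes "d \<ge> 1"
  shows "homogenise d (base_coefficients i1 d) X = X (Some i1) ^ d +
    of_nat (d - 1) * of_nat (card (- {i1}) + 1) * X None ^ d +
    (\<Sum>i\<in>-{i1}. X (Some i) ^ d - of_nat d * (X (Some i) * X None ^ (d - 1)))"
proof -
  have "mdegree (Poly_Mapping.single i k) = k" for i :: 'n and k
    by (cases "k = 0") (auto simp: mdegree_def)
  moreover have "mdegree (0 :: 'n \<Rightarrow>\<^sub>0 nat) = 0" by (simp add: mdegree_def)
  moreover have "monomial_at (Poly_Mapping.single i k) y = y i ^ k" for i :: 'n and k and y :: "'n \<Rightarrow> complex"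
    by (cases "k = 0") (auto simp: monomial_at_def)
  moreover have "monomial_at 0 y = 1" for y :: "'n \<Rightarrow> complex" by (simp add: monomial_at_def)
  ultimately show ?thesis using assms
    unfolding base_coefficients_def[abs_def]
    by (simp add: hform_add hform_diff hform_cmult hform_sum hform_monomial del: One_nat_def of_nat_diff)
qed

lemma pd_base:
  fixes i1 j :: "'n::finite"
  assumes "d \<ge> 1"
  shows "partial (Some j) (homogenise d (base_coefficients i1 d)) = (if j = i1 then \<lambda>X. of_nat d * X (Some i1) ^ (d - 1)
    else (\<lambda>X. of_nat d * X (Some j) ^ (d - 1) - of_nat d * X None ^ (d - 1)))"
proof (rule ext, rule pd_eqI)
  fix X :: "'n option \<Rightarrow> complex"
  have "((\<lambda>z. \<Sum>i\<in>S. (X(Some j := z)) (Some i) ^ d - of_nat d * ((X(Some j := z)) (Some i) * (X(Some j := z)) None ^ (d - 1)))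
    has_field_derivative (\<Sum>i\<in>S. if i = j then of_nat d * X (Some j) ^ (d - 1) - of_nat d * X None ^ (d - 1) else 0))
    (at (X (Some j)))" for S
    by (rule DERIV_sum) (auto intro!: derivative_eq_intros)
  moreover have "((\<lambda>z. (X(Some j := z)) (Some i1) ^ d +
    of_nat (d - 1) * of_nat (card (- {i1}) + 1) * (X(Some j := z)) None ^ d)
    has_field_derivative (if j = i1 then of_nat d * X (Some i1) ^ (d - 1) else 0)) (at (X (Some j)))"
    by (auto intro!: derivative_eq_intros)
  ultimately have "((\<lambda>z. homogenise d (base_coefficients i1 d) (X(Some j := z))) has_field_derivative
    (if j = i1 then of_nat d * X (Some i1) ^ (d - 1) else 0) +
    (\<Sum>i\<in>-{i1}. if i = j then of_nat d * X (Some j) ^ (d - 1) - of_nat d * X None ^ (d - 1) else 0))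
    (at (X (Some j)))"
    unfolding hform_base_coeff[OF assms] by (intro DERIV_add)
  then show "((\<lambda>z. homogenise d (base_coefficients i1 d) (X(Some j := z))) has_field_derivative
      (if j = i1 then \<lambda>X. of_nat d * X (Some i1) ^ (d - 1)
        else (\<lambda>X. of_nat d * X (Some j) ^ (d - 1) - of_nat d * X None ^ (d - 1))) X) (at (X (Some j)))"
    by (cases "j = i1") auto
qed

text \<open>
  With \<open>u = (1, 0, \<dots>, 0)\<close> the eliminated equations are \<open>\<partial>f/\<partial>x i = 0\<close> for \<open>i\<close> other than \<open>i1\<close>. As
  \<open>f\<close> is a sum of polynomials in one variable each, the Jacobian matrix is diagonal apart from the row of \<open>i1\<close>.
\<close>

lemma lagrange_in_radical:
  fixes i1 :: "'n::finite"
  assumes d: "d \<ge> 2"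
  shows "\<exists>K. idl (critical_gens (degrees i1 d) (d - 1) (lagrange_forms i1 d (\<lambda>i. if i = i1 then 1 else 0) (base_coefficients i1 d))
    (partial (Some i1) (homogenise d (base_coefficients i1 d)))) K (\<lambda>X. X v ^ K)"
proof -
  let ?L = "lagrange_forms i1 d (\<lambda>i. if i = i1 then 1 else 0) (base_coefficients i1 d)"
  let ?critical_gens = "critical_gens (degrees i1 d) (d - 1) ?L (partial (Some i1) (homogenise d (base_coefficients i1 d)))"
  note partial = pd_base[OF order.trans[OF one_le_numeral d]]
  have L1: "?L i1 = homogenise d (base_coefficients i1 d)" by (simp add: lagrange_forms_def)
  have Li: "?L i = (\<lambda>X. of_nat d * X (Some i) ^ (d - 1) - of_nat d * X None ^ (d - 1))" if "i \<noteq> i1" for i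
    using that by (simp add: lagrange_forms_def partial)
  have jacobian: "jacobian ?L X = of_nat d * X (Some i1) ^ (d - 1) *
    (\<Prod>i\<in>-{i1}. of_nat d * of_nat (d - 1)) * (\<Prod>i\<in>-{i1}. X (Some i) ^ (d - 2))" for X
  proof -
    let ?M = "(\<chi> i j. partial (Some j) (?L i) X) :: complex ^ 'n ^ 'n"
    have q: "?M $ i $ j = (if i = j then of_nat d * (of_nat (d - 1) * X (Some i) ^ (d - 1 - 1)) else 0)"
      if "i \<noteq> i1" for i j
      using that by (simp add: Li pd_diff_powers)
    have "det ?M = det (transpose ?M)" by simp
    also have "\<dots> = (\<Prod>i\<in>UNIV. transpose ?M $ i $ i)"
      by (rule det_diagonal_plus_column[of i1]) (use q in \<open>simp add: transpose_def\<close>)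
    also have "\<dots> = ?M $ i1 $ i1 * (\<Prod>i\<in>-{i1}. ?M $ i $ i)"
      by (subst prod.remove[of _ i1]) (auto simp: Compl_eq_Diff_UNIV transpose_def)
    also have "(\<Prod>i\<in>-{i1}. ?M $ i $ i) = (\<Prod>i\<in>-{i1}. (of_nat d * of_nat (d - 1)) * X (Some i) ^ (d - 2))"
      by (intro prod.cong refl, subst q) (auto simp: numeral_2_eq_2)
    finally show ?thesis by (simp add: jacobian_def L1 partial prod.distrib mult_ac power_mult_distrib)
  qed
  have gen: "(degrees i1 d i, ?L i) \<in> ?critical_gens" for i by (auto simp: critical_gens_def)
  show ?thesis
  proof (rule lagrange_base[OF d refl, where ?i1.0=i1])
    have "homogenise d (base_coefficients i1 d) = (\<lambda>X. X (Some i1) ^ d +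
      of_nat (d - 1) * of_nat (card (- {i1}) + 1) * X None ^ d +
      (\<Sum>i\<in>-{i1}. X (Some i) ^ d - of_nat d * (X (Some i) * X None ^ (d - 1))))"
      by (rule ext, rule hform_base_coeff) (use d in simp)
    with gen[of i1] show "(d, \<lambda>X. X (Some i1) ^ d +
      of_nat (d - 1) * of_nat (card (- {i1}) + 1) * X None ^ d +
      (\<Sum>i\<in>-{i1}. X (Some i) ^ d - of_nat d * (X (Some i) * X None ^ (d - 1)))) \<in> ?critical_gens"
      unfolding L1 by (simp only: degrees_def if_True refl)
    show "(d - 1, \<lambda>X. of_nat d * X (Some i) ^ (d - 1) - of_nat d * X None ^ (d - 1)) \<in> ?critical_gens"
      if "i \<noteq> i1" for i
      using gen[of i] that unfolding Li[OF that] by (simp only: degrees_def if_False)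
    let ?C = "of_nat d * of_nat d * (\<Prod>i\<in>-{i1}. of_nat d * of_nat (d - 1)) :: complex"
    have "X None * partial (Some i1) (homogenise d (base_coefficients i1 d)) X * jacobian ?L X =
      ?C * (X None * X (Some i1) ^ (2 * (d - 1)) * (\<Prod>i\<in>-{i1}. X (Some i) ^ (d - 2)))" for X
      unfolding jacobian partial mult_2 power_add by (simp only: if_True refl mult_ac)
    moreover have "1 + (d - 1) + (\<Sum>i\<in>UNIV. degrees i1 d i - 1) = 1 + 2 * (d - 1) + card (- {i1}) * (d - 2)"
      unfolding sum_degs by simp
    ultimately show "(1 + 2 * (d - 1) + card (- {i1}) * (d - 2),
        \<lambda>X. ?C * (X None * X (Some i1) ^ (2 * (d - 1)) * (\<Prod>i\<in>-{i1}. X (Some i) ^ (d - 2)))) \<in> ?critical_gens"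
      unfolding critical_gens_def by (simp only: insert_iff simp_thms)
    show "?C \<noteq> 0" using d by simp
  qed
qed

lemma hom_lform:
  assumes A: "coeff_ring A" and u: "\<And>i. u i \<in> A" and c: "\<And>m. mdegree m \<le> d \<Longrightarrow> c m \<in> A"
  shows "hom_family A (degrees i1 d i) (\<lambda>p. lagrange_forms i1 d (\<lambda>i. u i p) (\<lambda>m. c m p) i)"
    "hom_family A (d - 1) (\<lambda>p. partial (Some i1) (homogenise d (\<lambda>m. c m p)))"
proof -
  interpret coeff_ring A by fact
  have h: "hom_family A d (\<lambda>p. homogenise d (\<lambda>m. c m p))" by (rule hom_hform[OF A c])
  show "hom_family A (d - 1) (\<lambda>p. partial (Some i1) (homogenise d (\<lambda>m. c m p)))" by (rule hom_pd[OF h])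
  show "hom_family A (degrees i1 d i) (\<lambda>p. lagrange_forms i1 d (\<lambda>i. u i p) (\<lambda>m. c m p) i)"
    using h by (auto simp: lagrange_forms_def degrees_def intro!: hom_diff hom_scale[OF u] hom_pd[OF h, unfolded One_nat_def])
qed

theorem generic_lagrange_nondegenerate:
  fixes i1 :: "'n::finite"
  assumes d: "d \<ge> 2"
  shows "\<exists>\<Delta>\<in>mpoly_funs (uf_index d). (\<exists>a. \<Delta> a \<noteq> 0) \<and> (\<forall>a. \<Delta> a \<noteq> 0 \<longrightarrow>
    nondegenerate (lagrange_forms i1 d (\<lambda>i. a (Inl i)) (\<lambda>m. a (Inr m))) (partial (Some i1) (homogenise d (\<lambda>m. a (Inr m)))))"
proof -
  let ?I = "uf_index d :: ('n + ('n \<Rightarrow>\<^sub>0 nat)) set"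
  let ?a = "case_sum (\<lambda>i. if i = i1 then 1 else 0) (base_coefficients i1 d)"
  have ring: "coeff_ring (mpoly_funs ?I)" by unfold_locales
  have 1: "(\<lambda>a. a (Inl i)) \<in> mpoly_funs ?I" for i
    by (rule coordinate_in_mpoly_funs) (auto simp: uf_index_def)
  have 2: "(\<lambda>a. a (Inr m)) \<in> mpoly_funs ?I" if "mdegree m \<le> d" for m
    by (rule coordinate_in_mpoly_funs) (use that in \<open>auto simp: uf_index_def\<close>)
  have "\<exists>\<Delta>\<in>mpoly_funs ?I. \<Delta> ?a = 1 \<and> (\<forall>a. \<Delta> a \<noteq> 0 \<longrightarrow>
    nondegenerate (lagrange_forms i1 d (\<lambda>i. a (Inl i)) (\<lambda>m. a (Inr m))) (partial (Some i1) (homogenise d (\<lambda>m. a (Inr m)))))"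
  proof (rule mpoly_funs.generically_nondegenerate[where k="degrees i1 d" and l="d - 1"])
    show "\<exists>K. idl (critical_gens (degrees i1 d) (d - 1) (lagrange_forms i1 d (\<lambda>i. ?a (Inl i)) (\<lambda>m. ?a (Inr m)))
        (partial (Some i1) (homogenise d (\<lambda>m. ?a (Inr m))))) K (\<lambda>X. X v ^ K)" for v
      using lagrange_in_radical[OF d, of i1 v] by simp
  qed (rule hom_lform[OF ring 1 2]; assumption)+
  then obtain \<Delta> where "\<Delta> \<in> mpoly_funs ?I" "\<Delta> ?a = 1" "\<forall>a. \<Delta> a \<noteq> 0 \<longrightarrow>
    nondegenerate (lagrange_forms i1 d (\<lambda>i. a (Inl i)) (\<lambda>m. a (Inr m))) (partial (Some i1) (homogenise d (\<lambda>m. a (Inr m))))"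
    by blast
  then show ?thesis by (intro bexI[of _ \<Delta>] conjI exI[of _ ?a]) auto
qed


section \<open>The line from the start system to the Lagrange system\<close>

lemma avoid_finitely_many_lines:
  fixes W :: "complex set"
  assumes "finite W" "0 \<notin> W"
  shows "\<exists>\<Gamma>. open \<Gamma> \<and> closure \<Gamma> = UNIV \<and> (\<forall>\<gamma>\<in>\<Gamma>. \<forall>w\<in>W. \<forall>r. \<gamma> \<noteq> complex_of_real r * w)"
proof -
  define T where "T = (\<Union>w\<in>W. {\<gamma>. inner (\<i> * w) \<gamma> = 0})"
  have "closed T \<and> interior T = {}"
    unfolding T_def using assms
  proof (induction W rule: finite_induct)
    case (insert w W)
    have "interior ({\<gamma>. inner (\<i> * w) \<gamma> = 0} \<union> (\<Union>w\<in>W. {\<gamma>. inner (\<i> * w) \<gamma> = 0})) =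
        interior {\<gamma>. inner (\<i> * w) \<gamma> = 0}"
      using insert by (intro interior_closed_Un_empty_interior closed_hyperplane) auto
    also have "\<dots> = {}" using insert.prems by (intro interior_hyperplane) auto
    finally show ?case using insert closed_hyperplane[of "\<i> * w" 0] by (simp add: closed_Un)
  qed auto
  then have "closed T" "interior T = {}" by blast+
  then have "open (- T)" "closure (- T) = UNIV" by (simp_all add: closure_complement open_Compl)
  moreover have "inner (\<i> * w) (complex_of_real r * w) = 0" for w r
    by (simp add: inner_complex_def algebra_simps)
  then have "\<forall>\<gamma>\<in>- T. \<forall>w\<in>W. \<forall>r. \<gamma> \<noteq> complex_of_real r * w" by (auto simp: T_def)
  ultimately show ?thesis by blast
qed

text \<open>
  A Lagrange system known to be nondegenerate, joined to a start system with nonzero data.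
\<close>

locale start_to_lagrange =
  fixes i1 :: "'n::finite" and d :: nat and u :: "'n \<Rightarrow> complex"
    and \<alpha> :: "('n \<Rightarrow>\<^sub>0 nat) \<Rightarrow> complex" and c :: "'n option \<Rightarrow> complex"
  assumes d: "d \<ge> 2" and u: "\<And>i. u i \<noteq> 0" and c: "\<And>k. c k \<noteq> 0"
    and nondegenerate_lagrange: "nondegenerate (lagrange_forms i1 d u \<alpha>) (partial (Some i1) (homogenise d \<alpha>))"
begin

text \<open>
  The constraint along the line of systems. At intermediate \<open>s\<close> the functions \<open>g s i\<close> below are not its partial derivatives,
  because the start system is not the Lagrange system of one polynomial.
\<close>

definition h :: "complex \<Rightarrow> ('n option \<Rightarrow> complex) \<Rightarrow> complex" where
  "h s X = (1 - s) * (c None * X None ^ d + c (Some i1) * X (Some i1) ^ d) + s * homogenise d \<alpha> X"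

definition g :: "complex \<Rightarrow> 'n \<Rightarrow> ('n option \<Rightarrow> complex) \<Rightarrow> complex" where
  "g s i X = (1 - s) * (of_nat d * c (Some i) * X (Some i) ^ (d - 1)) + s * partial (Some i) (homogenise d \<alpha>) X"

definition Q :: "complex \<Rightarrow> 'n \<Rightarrow> ('n option \<Rightarrow> complex) \<Rightarrow> complex" where
  "Q s i = (if i = i1 then h s else (\<lambda>X. u i1 * g s i X - u i * g s i1 X))"

definition exceptional :: "complex set" where
  "exceptional = {s. \<not> nondegenerate (Q s) (g s i1)}"

lemma Q_0: "Q 0 = start_forms i1 d u c" and g_0: "g 0 i1 = (\<lambda>X. of_nat d * c (Some i1) * X (Some i1) ^ (d - 1))"
  by (auto simp: Q_def start_forms_def g_def h_def fun_eq_iff)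

lemma Q_1: "Q 1 = lagrange_forms i1 d u \<alpha>" and g_1: "g 1 i = partial (Some i) (homogenise d \<alpha>)"
  by (auto simp: Q_def lagrange_forms_def g_def h_def fun_eq_iff)

lemma linear_in_range: "(\<lambda>s. s) \<in> range (poly :: complex poly \<Rightarrow> _)" "(\<lambda>s. 1 - s) \<in> range (poly :: complex poly \<Rightarrow> _)"
proof -
  show "(\<lambda>s. s) \<in> range (poly :: complex poly \<Rightarrow> _)"
    by (rule range_eqI[of _ _ "[:0, 1:]"]) (simp add: fun_eq_iff)
  show "(\<lambda>s. 1 - s) \<in> range (poly :: complex poly \<Rightarrow> _)"
    by (rule range_eqI[of _ _ "[:1, -1:]"]) (simp add: fun_eq_iff)
qed

lemma univariate_ring: "coeff_ring (range (poly :: complex poly \<Rightarrow> _))"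
  by unfold_locales

lemma hom_hform_const: "hom_family (range poly) d (\<lambda>s :: complex. homogenise d \<alpha>)"
  by (rule hom_hform[OF univariate_ring]) (rule univariate.const_in)

lemma hom_g: "hom_family (range poly) (d - 1) (\<lambda>s. g s i)"
  unfolding g_def[abs_def]
  by (intro hom_add hom_scale[OF linear_in_range(1)] hom_scale[OF linear_in_range(2)]
      univariate.hom_cmult univariate.hom_var_power univariate.hom_pd[OF hom_hform_const])

lemma hom_Q: "hom_family (range poly) (degrees i1 d i) (\<lambda>s. Q s i)"
proof (cases "i = i1")
  case True
  have "hom_family (range poly) d h"
    unfolding h_def[abs_def]
    by (intro hom_add hom_scale[OF linear_in_range(1)] hom_scale[OF linear_in_range(2)]
        univariate.hom_cmult univariate.hom_var_power hom_hform_const)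
  with True show ?thesis by (simp add: Q_def degrees_def)
next
  case False
  then show ?thesis
    using univariate.hom_diff[OF univariate.hom_cmult univariate.hom_cmult, OF hom_g hom_g]
    by (simp add: Q_def degrees_def)
qed

text \<open>
  Elimination with base point \<open>s = 0\<close> gives a polynomial in \<open>s\<close> that is nonzero at \<open>0\<close> and vanishes at every
  exceptional parameter.
\<close>

lemma finite_exceptional: "finite exceptional" and zero_not_exceptional: "0 \<notin> exceptional"
proof -
  have "\<exists>\<Delta>\<in>range poly. \<Delta> 0 = 1 \<and> (\<forall>s. \<Delta> s \<noteq> 0 \<longrightarrow> nondegenerate (Q s) (g s i1))"
    by (rule univariate.generically_nondegenerate[OF hom_Q hom_g])
      (unfold Q_0 g_0, rule start_in_radical[OF d u c])
  then obtain P where P: "poly P 0 = 1" "\<forall>s. poly P s \<noteq> 0 \<longrightarrow> nondegenerate (Q s) (g s i1)" by blast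
  then have "exceptional \<subseteq> {s. poly P s = 0}" by (auto simp: exceptional_def)
  moreover have "P \<noteq> 0" using P(1) by auto
  ultimately show "finite exceptional" using poly_roots_finite finite_subset by blast
  show "0 \<notin> exceptional" using P by (simp add: exceptional_def)
qed

lemma one_not_exceptional: "1 \<notin> exceptional"
  using nondegenerate_lagrange by (simp add: exceptional_def Q_1 g_1)

sublocale nondegenerate_family "range poly" Q "\<lambda>s. g s i1" "degrees i1 d" exceptional
proof
  show "continuous_on UNIV a" if "a \<in> range poly" for a :: "complex \<Rightarrow> complex"
    using that by (auto intro!: continuous_intros)
  show "hom_family (range poly) (degrees i1 d i) (\<lambda>s. Q s i)" for i by (rule hom_Q)
  show "finite exceptional" by (rule finite_exceptional)
  show "nondegenerate (Q s) (g s i1)" if "s \<notin> exceptional" for s using that by (simp add: exceptional_def)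
qed

lemma g_nonzero: "s \<notin> exceptional \<Longrightarrow> x \<in> Z s \<Longrightarrow> g s i1 (hom_coords x) \<noteq> 0"
proof -
  assume s: "s \<notin> exceptional" and x: "x \<in> Z s"
  have "hom_coords x \<noteq> (\<lambda>v. 0)" by (metis hc_simps(1) zero_neq_one)
  with s x show ?thesis by (auto simp: exceptional_def nondegenerate_def Z_def)
qed

text \<open>
  Nondegeneracy makes the passage from \<open>(x, \<lambda>)\<close> to \<open>x\<close> a bijection on solutions.
\<close>

lemma eliminate_multiplier:
  assumes "s \<notin> exceptional"
  shows "h s (hom_coords x) = 0 \<and> (\<forall>i. u i = l * g s i (hom_coords x)) \<longleftrightarrow> x \<in> Z s \<and> l = u i1 / g s i1 (hom_coords x)"
proof
  assume *: "h s (hom_coords x) = 0 \<and> (\<forall>i. u i = l * g s i (hom_coords x))"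
  then have "x \<in> Z s" by (simp add: Z_def Q_def)
  moreover have "u i1 = l * g s i1 (hom_coords x)" using * by blast
  ultimately show "x \<in> Z s \<and> l = u i1 / g s i1 (hom_coords x)"
    using g_nonzero[OF assms] by simp
next
  assume *: "x \<in> Z s \<and> l = u i1 / g s i1 (hom_coords x)"
  then have nz: "g s i1 (hom_coords x) \<noteq> 0" using g_nonzero[OF assms] by blast
  have Q: "Q s i (hom_coords x) = 0" for i using * by (simp add: Z_def)
  have l: "l * g s i1 (hom_coords x) = u i1" using * nz by simp
  have "u i = l * g s i (hom_coords x)" for i
  proof (cases "i = i1")
    case True
    with l show ?thesis by simp
  next
    case False
    with Q[of i] have "u i * g s i1 (hom_coords x) = u i1 * g s i (hom_coords x)" by (simp add: Q_def)
    also have "\<dots> = (l * g s i (hom_coords x)) * g s i1 (hom_coords x)" by (simp flip: l)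
    finally show ?thesis using nz by simp
  qed
  moreover have "h s (hom_coords x) = 0" using Q[of i1] by (simp add: Q_def)
  ultimately show "h s (hom_coords x) = 0 \<and> (\<forall>i. u i = l * g s i (hom_coords x))" by blast
qed

text \<open>
  The start system is triangular: the coordinate \<open>x i1\<close> is one of \<open>d\<close> roots, and then every other coordinate is one
  of \<open>d - 1\<close> roots.
\<close>

lemma card_Z_0: "card (Z 0) = d * (d - 1) ^ (CARD('n) - 1)"
proof -
  define R where "R = {z. z ^ d = - c None / c (Some i1)}"
  define \<kappa> where "\<kappa> i = u i * c (Some i1) / (u i1 * c (Some i))" for i
  define E where "E a = (\<Pi>\<^sub>E i\<in>-{i1}. {z. z ^ (d - 1) = \<kappa> i * a ^ (d - 1)})" for a
  have R: "card R = d" unfolding R_def using d c by (intro card_nth_roots) auto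
  have "finite R" using R d card.infinite by fastforce
  have "a \<noteq> 0" if "a \<in> R" for a
    using that c[of None] c[of "Some i1"] d by (auto simp: R_def power_0_left)
  then have roots: "card {z. z ^ (d - 1) = \<kappa> i * a ^ (d - 1)} = d - 1" if "a \<in> R" for a i
    using that u c d by (intro card_nth_roots) (auto simp: \<kappa>_def)
  have cE: "card (E a) = (d - 1) ^ (CARD('n) - 1)" if "a \<in> R" for a
    unfolding E_def using roots[OF that] by (simp add: card_PiE card_Diff_singleton Compl_eq_Diff_UNIV)
  have "finite (E a)" if "a \<in> R" for a
    unfolding E_def using roots[OF that] d card.infinite by (intro finite_PiE) fastforce+
  then have "card (SIGMA a:R. E a) = (\<Sum>a\<in>R. card (E a))"
    using \<open>finite R\<close> by (intro card_SigmaI) auto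
  also have "\<dots> = d * (d - 1) ^ (CARD('n) - 1)" using cE R by simp
  finally have "card (SIGMA a:R. E a) = d * (d - 1) ^ (CARD('n) - 1)" .
  moreover have "card (SIGMA a:R. E a) = card (Z 0)"
  proof (rule bij_betw_same_card[of "\<lambda>(a, f). \<chi> i. if i = i1 then a else f i"], rule bij_betw_byWitness)
    let ?back = "\<lambda>x. (x $ i1, restrict (($) x) (- {i1}))"
    have Z0: "x \<in> Z 0 \<longleftrightarrow> x $ i1 \<in> R \<and> (\<forall>i. i \<noteq> i1 \<longrightarrow> x $ i ^ (d - 1) = \<kappa> i * x $ i1 ^ (d - 1))" for x
    proof -
      have "Q 0 i1 (hom_coords x) = 0 \<longleftrightarrow> x $ i1 \<in> R"
        using c by (auto simp: Q_0 start_forms_def R_def field_simps add_eq_0_iff)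
      moreover have "Q 0 i (hom_coords x) = 0 \<longleftrightarrow> x $ i ^ (d - 1) = \<kappa> i * x $ i1 ^ (d - 1)" if "i \<noteq> i1" for i
        using that u c d by (auto simp: Q_0 start_forms_def \<kappa>_def field_simps)
      ultimately show ?thesis unfolding Z_def mem_Collect_eq by metis
    qed
    show "\<forall>p\<in>SIGMA a:R. E a. ?back ((\<lambda>(a, f). \<chi> i. if i = i1 then a else f i) p) = p"
      by (auto simp: E_def PiE_def extensional_def fun_eq_iff)
    show "\<forall>x\<in>Z 0. (\<lambda>(a, f). \<chi> i. if i = i1 then a else f i) (?back x) = x"
      by (auto simp: vec_eq_iff)
    show "(\<lambda>(a, f). \<chi> i. if i = i1 then a else f i) ` (SIGMA a:R. E a) \<subseteq> Z 0"
      by (auto simp: Z0 E_def PiE_def Pi_def)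
    show "?back ` Z 0 \<subseteq> (SIGMA a:R. E a)" by (auto simp: Z0 E_def)
  qed
  ultimately show ?thesis by simp
qed

lemma card_lagrange_solutions:
  "card {z. h 1 (hom_coords (fst z)) = 0 \<and> (\<forall>i. u i = snd z * g 1 i (hom_coords (fst z)))} =
    d * (d - 1) ^ (CARD('n) - 1)"
proof -
  have "{z. h 1 (hom_coords (fst z)) = 0 \<and> (\<forall>i. u i = snd z * g 1 i (hom_coords (fst z)))} =
      (\<lambda>x. (x, u i1 / g 1 i1 (hom_coords x))) ` Z 1"
    unfolding eliminate_multiplier[OF one_not_exceptional] by auto
  then show ?thesis
    using card_Z_constant[OF one_not_exceptional zero_not_exceptional] by (simp add: card_image inj_on_def card_Z_0)
qed

text \<open>
  The parameter \<open>s = t * \<gamma> / (1 - t + t * \<gamma>)\<close> equals \<open>b\<close> for some \<open>t\<close> only if \<open>\<gamma>\<close> is a real multiple of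
  \<open>b / (1 - b)\<close>, and the denominator vanishes only if \<open>\<gamma>\<close> is a real multiple of \<open>-1\<close>.
\<close>

lemma lagrange_solution_path:
  "\<exists>\<Gamma>. open \<Gamma> \<and> closure \<Gamma> = UNIV \<and> (\<forall>\<gamma>\<in>\<Gamma>. \<forall>x1 l1.
     h 1 (hom_coords x1) = 0 \<and> (\<forall>i. u i = l1 * g 1 i (hom_coords x1)) \<longrightarrow>
     (\<exists>x l. continuous_on {0..1} x \<and> continuous_on {0..1} l \<and> x 1 = x1 \<and> l 1 = l1 \<and>
       (\<forall>t\<in>{0..1}. \<exists>s. of_real t * \<gamma> = (1 - of_real t + of_real t * \<gamma>) * s \<and>
          h s (hom_coords (x t)) = 0 \<and> (\<forall>i. u i = l t * g s i (hom_coords (x t))))))"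
proof -
  define W where "W = insert (- 1) ((\<lambda>b. b / (1 - b)) ` exceptional)"
  have "finite W" "0 \<notin> W" using finite_exceptional zero_not_exceptional one_not_exceptional by (auto simp: W_def)
  then obtain \<Gamma> where \<Gamma>: "open \<Gamma>" "closure \<Gamma> = UNIV"
    "\<And>\<gamma> w r. \<gamma> \<in> \<Gamma> \<Longrightarrow> w \<in> W \<Longrightarrow> \<gamma> \<noteq> complex_of_real r * w"
    using avoid_finitely_many_lines by metis
  have "\<exists>x l. continuous_on {0..1} x \<and> continuous_on {0..1} l \<and> x 1 = x1 \<and> l 1 = l1 \<and>
       (\<forall>t\<in>{0..1}. \<exists>s. of_real t * \<gamma> = (1 - of_real t + of_real t * \<gamma>) * s \<and>
          h s (hom_coords (x t)) = 0 \<and> (\<forall>i. u i = l t * g s i (hom_coords (x t))))"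
    if \<gamma>: "\<gamma> \<in> \<Gamma>" and sol: "h 1 (hom_coords x1) = 0 \<and> (\<forall>i. u i = l1 * g 1 i (hom_coords x1))" for \<gamma> x1 l1
  proof -
    define D where "D t = 1 - complex_of_real t + of_real t * \<gamma>" for t
    define s where "s t = of_real t * \<gamma> / D t" for t
    have D: "D t \<noteq> 0" for t
    proof
      assume D0: "D t = 0"
      then have "t \<noteq> 0" by (auto simp: D_def)
      then have "\<gamma> = complex_of_real ((1 - t) / t) * (- 1)"
        using D0 by (simp add: D_def field_simps eq_neg_iff_add_eq_0)
      with \<Gamma>(3)[OF \<gamma>, of "-1" "(1 - t) / t"] show False by (simp add: W_def)
    qed
    have s: "s t \<notin> exceptional" for t
    proof
      assume b: "s t \<in> exceptional"
      define b where "b = s t"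
      have eq: "of_real t * \<gamma> * (1 - b) = b * (1 - of_real t)"
        using D[of t] by (simp add: b_def s_def D_def field_simps)
      have "b \<noteq> 0" "b \<noteq> 1" using b zero_not_exceptional one_not_exceptional by (auto simp: b_def)
      then have "t \<noteq> 0" using eq by auto
      then have "\<gamma> = complex_of_real ((1 - t) / t) * (b / (1 - b))"
        using eq \<open>b \<noteq> 1\<close> by (simp add: field_simps)
      moreover have "b / (1 - b) \<in> W" using b by (simp add: W_def b_def)
      ultimately show False using \<Gamma>(3)[OF \<gamma>] by blast
    qed
    have cs: "continuous_on {0..1} s"
      unfolding s_def using D by (auto simp: D_def intro!: continuous_intros)
    have s1: "s 1 = 1" using D[of 1] by (simp add: s_def D_def)
    have x1: "x1 \<in> Z 1" and l1: "l1 = u i1 / g 1 i1 (hom_coords x1)"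
      using sol unfolding eliminate_multiplier[OF one_not_exceptional] by auto
    have "s ` {0..1} \<subseteq> - exceptional" using s by blast
    from zero_path_lift[OF cs this, of x1] x1 obtain x where
      x: "continuous_on {0..1} x" "\<forall>t\<in>{0..1}. x t \<in> Z (s t)" "x 1 = x1" by (auto simp: s1)
    define l where "l t = u i1 / g (s t) i1 (hom_coords (x t))" for t
    have "continuous_on {0..1} (\<lambda>t. g (s t) i1 (hom_coords (x t)))"
    proof (rule hom_continuous[OF hom_g])
      fix a :: "complex \<Rightarrow> complex" assume "a \<in> range poly"
      from continuous_on_compose2[OF A_continuous[OF this] cs]
      show "continuous_on {0..1} (\<lambda>t. a (s t))" by simp
    qed (rule continuous_hc[OF x(1)])
    then have "continuous_on {0..1} l"
      unfolding l_def using g_nonzero[OF s] x(2) by (intro continuous_intros) auto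
    moreover have "l 1 = l1" by (simp add: l_def s1 x(3) l1)
    moreover have "of_real t * \<gamma> = (1 - of_real t + of_real t * \<gamma>) * s t \<and>
        h (s t) (hom_coords (x t)) = 0 \<and> (\<forall>i. u i = l t * g (s t) i (hom_coords (x t)))" if t: "t \<in> {0..1}" for t
    proof
      show "of_real t * \<gamma> = (1 - of_real t + of_real t * \<gamma>) * s t"
        using D[of t] by (simp add: s_def D_def)
      show "h (s t) (hom_coords (x t)) = 0 \<and> (\<forall>i. u i = l t * g (s t) i (hom_coords (x t)))"
        unfolding eliminate_multiplier[OF s] using x(2) t by (simp add: l_def)
    qed
    ultimately show ?thesis
      using x(1,3) by (intro exI[of _ x] exI[of _ l] conjI ballI exI[of _ "s _"]) auto
  qed
  with \<Gamma>(1,2) show ?thesis by (intro exI[of _ \<Gamma>]) auto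
qed

end

section \<open>Genericity and the homotopy\<close>

lemma lookup_complexify: "Poly_Mapping.lookup (complexify f) m = complex_of_real (Poly_Mapping.lookup f m)"
  by (simp add: complexify_def Poly_Mapping.map.rep_eq when_def)

lemma complexify_degree:
  assumes "total_degree f = d" "m \<in> Poly_Mapping.keys (complexify f)"
  shows "mdegree m \<le> d"
proof -
  have "m \<in> Poly_Mapping.keys f" using assms(2) by (simp add: in_keys_iff lookup_complexify)
  then show ?thesis unfolding assms(1)[symmetric] total_degree_def by (intro Max_ge) auto
qed

lemma uf_point_simps:
  "uf_point d u f (Inl i) = complex_of_real (u $ i)"
  "mdegree m \<le> d \<Longrightarrow> uf_point d u f (Inr m) = complex_of_real (Poly_Mapping.lookup f m)"
proof -
  have "Inl i \<in> uf_index d" by (auto simp: uf_index_def)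
  then show "uf_point d u f (Inl i) = complex_of_real (u $ i)" by (simp add: uf_point_def)
next
  assume "mdegree m \<le> d"
  then have "Inr m \<in> uf_index d" by (auto simp: uf_index_def)
  then show "uf_point d u f (Inr m) = complex_of_real (Poly_Mapping.lookup f m)"
    by (simp add: uf_point_def)
qed

lemma start_to_lagrange_uf_point:
  fixes i1 :: "'n::finite" and f :: "('n, real) mpoly"
  assumes "d \<ge> 2" "\<And>i. u $ i \<noteq> 0" "\<And>k. c k \<noteq> 0"
    "nondegenerate (lagrange_forms i1 d (\<lambda>i. uf_point d u f (Inl i)) (\<lambda>m. uf_point d u f (Inr m)))
      (partial (Some i1) (homogenise d (\<lambda>m. uf_point d u f (Inr m))))"
  shows "start_to_lagrange i1 d (\<lambda>i. complex_of_real (u $ i)) (Poly_Mapping.lookup (complexify f)) c"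
proof
  have "homogenise d (\<lambda>m. uf_point d u f (Inr m)) = homogenise d (Poly_Mapping.lookup (complexify f))"
    by (rule hform_cong) (simp add: uf_point_simps lookup_complexify)
  then show "nondegenerate (lagrange_forms i1 d (\<lambda>i. complex_of_real (u $ i)) (Poly_Mapping.lookup (complexify f)))
    (partial (Some i1) (homogenise d (Poly_Mapping.lookup (complexify f))))"
    using assms(4) by (simp add: lagrange_forms_def[abs_def] uf_point_simps(1) cong: if_cong)
qed (use assms in auto)

lemma lagrange_system_eq:
  assumes "total_degree f = d"
  shows "lagrange_system u f (x, l) =
    (\<chi> i. complex_of_real (u $ i) - l * partial (Some i) (homogenise d (Poly_Mapping.lookup (complexify f))) (hom_coords x),
      homogenise d (Poly_Mapping.lookup (complexify f)) (hom_coords x))"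
  using complexify_degree[OF assms]
  by (simp add: lagrange_system_def hom_coords_def hform_dehomogenise pd_hform)

lemma lagrange_and_homotopy:
  fixes u :: "real ^ 'n::finite" and f :: "('n, real) mpoly"
  assumes "start_to_lagrange i1 d (\<lambda>i. complex_of_real (u $ i)) (Poly_Mapping.lookup (complexify f)) c"
    and deg: "total_degree f = d"
  shows "card {z. lagrange_system u f z = 0} = d * (d - 1) ^ (CARD('n) - 1)"
    and "\<exists>\<Gamma> :: complex set. open \<Gamma> \<and> closure \<Gamma> = UNIV \<and>
      (\<forall>\<gamma>\<in>\<Gamma>. \<forall>z. lagrange_system u f z = 0 \<longrightarrow>
        (\<exists>p. solution_path (homotopy (start_system i1 d u c) \<gamma> (lagrange_system u f)) p \<and>
             start_system i1 d u c (p 0) = 0 \<and> (p \<longlongrightarrow> z) (at_left 1)))"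
proof -
  let ?\<alpha> = "Poly_Mapping.lookup (complexify f)"
  interpret start_to_lagrange i1 d "\<lambda>i. complex_of_real (u $ i)" ?\<alpha> c by fact
  have lagr: "lagrange_system u f (x, l) = 0 \<longleftrightarrow>
    h 1 (hom_coords x) = 0 \<and> (\<forall>i. complex_of_real (u $ i) = l * g 1 i (hom_coords x))" for x l
    by (auto simp: lagrange_system_eq[OF deg] h_def g_def vec_eq_iff zero_prod_def)
  have "{z. lagrange_system u f z = 0} =
    {z. h 1 (hom_coords (fst z)) = 0 \<and> (\<forall>i. complex_of_real (u $ i) = snd z * g 1 i (hom_coords (fst z)))}"
    using lagr by (auto split: prod.splits)
  then show "card {z. lagrange_system u f z = 0} = d * (d - 1) ^ (CARD('n) - 1)"
    using card_lagrange_solutions by simp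
  obtain \<Gamma> where \<Gamma>: "open \<Gamma>" "closure \<Gamma> = UNIV" "\<forall>\<gamma>\<in>\<Gamma>. \<forall>x1 l1.
     h 1 (hom_coords x1) = 0 \<and> (\<forall>i. complex_of_real (u $ i) = l1 * g 1 i (hom_coords x1)) \<longrightarrow>
     (\<exists>x l. continuous_on {0..1} x \<and> continuous_on {0..1} l \<and> x 1 = x1 \<and> l 1 = l1 \<and>
       (\<forall>t\<in>{0..1}. \<exists>s. of_real t * \<gamma> = (1 - of_real t + of_real t * \<gamma>) * s \<and>
          h s (hom_coords (x t)) = 0 \<and> (\<forall>i. complex_of_real (u $ i) = l t * g s i (hom_coords (x t)))))"
    using lagrange_solution_path by blast
  have H0: "homotopy (start_system i1 d u c) \<gamma> (lagrange_system u f) t (x, l) = 0"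
    if st: "of_real t * \<gamma> = (1 - of_real t + of_real t * \<gamma>) * s"
      and hs: "h s (hom_coords x) = 0" and gs: "\<And>i. complex_of_real (u $ i) = l * g s i (hom_coords x)"
    for t \<gamma> s x l
  proof -
    define D where "D = 1 - complex_of_real t + of_real t * \<gamma>"
    have 1: "of_real t * \<gamma> = D * s" "complex_of_real (1 - t) = D * (1 - s)"
      using st by (simp_all add: D_def algebra_simps)
    have "complex_of_real (1 - t) * (of_real (u $ i) - of_nat d * l * c (Some i) * x $ i ^ (d - 1)) +
        of_real t * \<gamma> * (of_real (u $ i) - l * partial (Some i) (homogenise d ?\<alpha>) (hom_coords x)) =
        D * (of_real (u $ i) - l * g s i (hom_coords x))" for i
      unfolding 1 by (simp add: g_def algebra_simps)
    moreover have "complex_of_real (1 - t) * (c None + c (Some i1) * x $ i1 ^ d) +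
        of_real t * \<gamma> * homogenise d ?\<alpha> (hom_coords x) = D * h s (hom_coords x)"
      unfolding 1 by (simp add: h_def algebra_simps)
    ultimately show ?thesis
      using hs gs by (simp add: homotopy_def lagrange_system_eq[OF deg] start_system_def
          vec_eq_iff zero_prod_def)
  qed
  have "\<exists>p. solution_path (homotopy (start_system i1 d u c) \<gamma> (lagrange_system u f)) p \<and>
      start_system i1 d u c (p 0) = 0 \<and> (p \<longlongrightarrow> z) (at_left 1)"
    if \<gamma>: "\<gamma> \<in> \<Gamma>" and z: "lagrange_system u f z = 0" for \<gamma> z
  proof -
    obtain x1 l1 where z_eq: "z = (x1, l1)" by (cases z)
    obtain x l where xl: "continuous_on {0..1} x" "continuous_on {0..1} l" "x 1 = x1" "l 1 = l1"
      "\<forall>t\<in>{0..1}. \<exists>s. of_real t * \<gamma> = (1 - of_real t + of_real t * \<gamma>) * s \<and>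
          h s (hom_coords (x t)) = 0 \<and> (\<forall>i. complex_of_real (u $ i) = l t * g s i (hom_coords (x t)))"
      using \<Gamma>(3) \<gamma> z unfolding z_eq lagr by blast
    define p where "p t = (x t, l t)" for t
    have cp: "continuous_on {0..1} p" unfolding p_def by (intro continuous_intros xl)
    have Hp: "homotopy (start_system i1 d u c) \<gamma> (lagrange_system u f) t (p t) = 0"
      if "t \<in> {0..1}" for t
      unfolding p_def using xl(5) that H0 by blast
    have "continuous_on {0..<1} p" by (rule continuous_on_subset[OF cp]) auto
    then have "solution_path (homotopy (start_system i1 d u c) \<gamma> (lagrange_system u f)) p"
      using Hp by (auto simp: solution_path_def)
    moreover have "start_system i1 d u c (p 0) = 0"
      using Hp[of 0] by (simp add: homotopy_def prod_eq_iff vec_eq_iff)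
    moreover have "(p \<longlongrightarrow> p 1) (at 1 within {0..1})" using cp by (simp add: continuous_on_def)
    then have "(p \<longlongrightarrow> z) (at_left 1)"
      by (simp add: at_within_Icc_at_left p_def z_eq xl(3,4))
    ultimately show ?thesis by blast
  qed
  with \<Gamma>(1,2) show "\<exists>\<Gamma> :: complex set. open \<Gamma> \<and> closure \<Gamma> = UNIV \<and>
      (\<forall>\<gamma>\<in>\<Gamma>. \<forall>z. lagrange_system u f z = 0 \<longrightarrow>
        (\<exists>p. solution_path (homotopy (start_system i1 d u c) \<gamma> (lagrange_system u f)) p \<and>
             start_system i1 d u c (p 0) = 0 \<and> (p \<longlongrightarrow> z) (at_left 1)))"
    by blast
qed

text \<open>
  \<open>V\<close> is cut out by the polynomial of \<open>generic_lagrange_nondegenerate\<close> times the product of the entries of \<open>u\<close>, and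
  \<open>W\<close> by the product of the \<open>c k\<close>. The first polynomial is known to be nonzero only at a base point where entries of \<open>u\<close>
  may vanish, so properness of \<open>V\<close> comes from the absence of zero divisors.
\<close>

theorem theorem3p3:
  fixes i1 :: "'n::finite" and d :: nat
  assumes "d \<ge> 2"
  shows "\<exists>V W.
    proper_subvariety (uf_index d :: ('n + ('n \<Rightarrow>\<^sub>0 nat)) set) V \<and>
    proper_subvariety (UNIV :: 'n option set) W \<and>
    (\<forall>(u :: real ^ 'n) (f :: ('n, real) mpoly).
       total_degree f = d \<and> uf_point d u f \<notin> V \<longrightarrow>
         card {z. lagrange_system u f z = 0} = d * (d - 1) ^ (CARD('n) - 1) \<and>
         (\<forall>c. c \<notin> W \<longrightarrow>
            (\<exists>\<Gamma> :: complex set. open \<Gamma> \<and> closure \<Gamma> = UNIV \<and>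
               (\<forall>\<gamma>\<in>\<Gamma>. \<forall>z. lagrange_system u f z = 0 \<longrightarrow>
                  (\<exists>p. solution_path
                          (homotopy (start_system i1 d u c) \<gamma> (lagrange_system u f)) p \<and>
                       start_system i1 d u c (p 0) = 0 \<and>
                       (p \<longlongrightarrow> z) (at_left 1))))))"
proof -
  let ?I = "uf_index d :: ('n + ('n \<Rightarrow>\<^sub>0 nat)) set"
  obtain \<Delta> a where \<Delta>: "\<Delta> \<in> mpoly_funs ?I" "\<Delta> a \<noteq> 0" "\<forall>a. \<Delta> a \<noteq> 0 \<longrightarrow>
    nondegenerate (lagrange_forms i1 d (\<lambda>i. a (Inl i)) (\<lambda>m. a (Inr m))) (partial (Some i1) (homogenise d (\<lambda>m. a (Inr m))))"
    using generic_lagrange_nondegenerate[OF assms, of i1] by (elim bexE conjE exE)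
  define \<Delta>u where "\<Delta>u a = (\<Prod>i\<in>UNIV. a (Inl i))" for a :: "'n + ('n \<Rightarrow>\<^sub>0 nat) \<Rightarrow> complex"
  have \<Delta>u: "\<Delta>u \<in> mpoly_funs ?I"
    unfolding \<Delta>u_def[abs_def]
    by (intro mpoly_funs.prod_in coordinate_in_mpoly_funs) (auto simp: uf_index_def)
  have "\<Delta>u (\<lambda>_. 1) \<noteq> 0" by (simp add: \<Delta>u_def)
  then have "\<exists>b. \<Delta> b \<noteq> 0 \<and> \<Delta>u b \<noteq> 0"
    by (rule mpoly_funs_no_zero_divisors[OF \<Delta>(1) \<Delta>u \<Delta>(2)])
  then obtain b where b: "\<Delta> b \<noteq> 0 \<and> \<Delta>u b \<noteq> 0" ..
  have prod: "(\<lambda>a. \<Delta> a * \<Delta>u a) \<in> mpoly_funs ?I" by (rule mpoly_funs.mult_in[OF \<Delta>(1) \<Delta>u])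
  have "\<Delta> (restrict b ?I) = \<Delta> b" "\<Delta>u (restrict b ?I) = \<Delta>u b"
    by (rule mpoly_funs_cong[OF \<Delta>(1)], simp) (rule mpoly_funs_cong[OF \<Delta>u], simp)
  with b have "\<Delta> (restrict b ?I) * \<Delta>u (restrict b ?I) \<noteq> 0" by simp
  then have V: "proper_subvariety ?I {a \<in> ?I \<rightarrow>\<^sub>E UNIV. \<Delta> a * \<Delta>u a = 0}"
    by (rule proper_subvarietyI[OF prod]) simp
  have "(\<lambda>c. \<Prod>k\<in>UNIV. c k) \<in> mpoly_funs (UNIV :: 'n option set)"
    by (intro mpoly_funs.prod_in coordinate_in_mpoly_funs) auto
  then have W: "proper_subvariety (UNIV :: 'n option set) {c \<in> UNIV \<rightarrow>\<^sub>E UNIV. (\<Prod>k\<in>UNIV. c k) = 0}"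
    by (rule proper_subvarietyI[where a="\<lambda>_. 1"]) auto
  have main: "start_to_lagrange i1 d (\<lambda>i. complex_of_real (u $ i)) (Poly_Mapping.lookup (complexify f)) c"
    if V: "uf_point d u f \<notin> {a \<in> ?I \<rightarrow>\<^sub>E UNIV. \<Delta> a * \<Delta>u a = 0}" and c: "\<And>k. c k \<noteq> 0"
    for u :: "real ^ 'n" and f :: "('n, real) mpoly" and c
  proof (rule start_to_lagrange_uf_point[OF assms _ c])
    have uf: "uf_point d u f \<in> ?I \<rightarrow>\<^sub>E UNIV" unfolding uf_point_def by simp
    have nz: "\<Delta> (uf_point d u f) \<noteq> 0" "\<Delta>u (uf_point d u f) \<noteq> 0"
      using V uf by simp_all
    show "u $ i \<noteq> 0" for i
      using nz(2) by (simp add: \<Delta>u_def uf_point_simps(1))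
    show "nondegenerate (lagrange_forms i1 d (\<lambda>i. uf_point d u f (Inl i)) (\<lambda>m. uf_point d u f (Inr m)))
      (partial (Some i1) (homogenise d (\<lambda>m. uf_point d u f (Inr m))))"
      using \<Delta>(3) nz(1) by blast
  qed
  show ?thesis
  proof (rule exI[of _ "{a \<in> ?I \<rightarrow>\<^sub>E UNIV. \<Delta> a * \<Delta>u a = 0}"],
      rule exI[of _ "{c \<in> UNIV \<rightarrow>\<^sub>E UNIV. (\<Prod>k\<in>UNIV. c k) = 0}"], intro conjI allI impI)
    fix u :: "real ^ 'n" and f :: "('n, real) mpoly"
    assume uf: "total_degree f = d \<and> uf_point d u f \<notin> {a \<in> ?I \<rightarrow>\<^sub>E UNIV. \<Delta> a * \<Delta>u a = 0}"
    then have deg: "total_degree f = d" and uf: "uf_point d u f \<notin> {a \<in> ?I \<rightarrow>\<^sub>E UNIV. \<Delta> a * \<Delta>u a = 0}"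
      by simp_all
    show "card {z. lagrange_system u f z = 0} = d * (d - 1) ^ (CARD('n) - 1)"
      by (rule lagrange_and_homotopy(1)[OF main[OF uf, of "\<lambda>_. 1"] deg]) simp
    fix c :: "'n option \<Rightarrow> complex"
    assume "c \<notin> {c \<in> UNIV \<rightarrow>\<^sub>E UNIV. (\<Prod>k\<in>UNIV. c k) = 0}"
    then have "(\<Prod>k\<in>UNIV. c k) \<noteq> 0" by simp
    then have "c k \<noteq> 0" for k by simp
    from lagrange_and_homotopy(2)[OF main[OF uf this] deg]
    show "\<exists>\<Gamma> :: complex set. open \<Gamma> \<and> closure \<Gamma> = UNIV \<and>
               (\<forall>\<gamma>\<in>\<Gamma>. \<forall>z. lagrange_system u f z = 0 \<longrightarrow>
                  (\<exists>p. solution_path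
                          (homotopy (start_system i1 d u c) \<gamma> (lagrange_system u f)) p \<and>
                       start_system i1 d u c (p 0) = 0 \<and>
                       (p \<longlongrightarrow> z) (at_left 1)))" .
  qed (rule V, rule W)
qed

end
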